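(* Let $\Lambda_0=e^{2\pi in_0/m_0}$, with $m_0\ge1$, $0\le n_0\le m_0-1$, $n_0$ and $m_0$ coprime. Let $r_1>0$, $g\in B_{r_1}$, and let $\hat\Psi^g$ be the Borel transform at $\Lambda_0$ associated with $g$. When viewed as a holomorphic function of two variables, $\hat\Psi^g$ can be written $$\hat\Psi^g(\xi,z)=\sum_{k=0}^{m_0-1}\Big(\frac k{m_0}-\frac12\Big)g(\Lambda_0^kz)-\sum_{k=0}^{m_0-1}\sum_{a\in\mathbb Z^*}\frac{e^{2\pi i\frac{ka}{m_0}}}{2\pi ia}\Big[g\big(\Lambda_0^kz\,e^{\frac{m_0\xi}{2\pi ia}}\big)-g(\Lambda_0^kz)\Big]$$ for $|\mathrm{Im}\,\xi|$ and $|z|$ small enough. In particular, for each $z\in\mathbb D^*$, the function $\xi\mapsto\hat\Psi^\delta(\xi,z)$ is meromorphic with simple poles only, located at the points $\xi_{a,b}(z)$ ($a\in\mathbb Z^*$, $b\in\mathbb Z$), with $C_{a,b}$ as corresponding residues. Moreover, for any $z\in\mathbb D^*$ and for any line $\Delta$ of $\mathbb C$ passing through the origin and avoiding the poles $\xi_{a,b}(z)$, the function $(1+|\xi|)^{-1}\hat\Psi^\delta(\xi,z)$ is bounded for $\xi\in\Delta$.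
   Context: $\mathbb D=\{|q|<1\}$, $\mathbb E=\{|q|>1\}$, $\mathbb S^1=\{|q|=1\}$, $\mathbb D^*=\mathbb D\setminus\{0\}$, $\mathbb Z^*=\mathbb Z\setminus\{0\}$. $B_r$ is the Banach space of bounded holomorphic functions on $\{|z|<r\}$ vanishing at $0$. **Borel transform.** For $g=\sum_{n\ge1}g_nz^n\in B_{r_1}$, let $f(q,z)=\sum_{n\ge1}g_n\frac{z^n}{q^n-1}$ ($q\in\mathbb D\cup\mathbb E$), the solution of $f(q,qz)-f(q,z)=g(z)$ vanishing at $z=0$. The function $\eta\mapsto\Psi^g(\eta)=\eta f(\Lambda_0e^\eta,\cdot)$, with values in $B_{r_2}$ ($r_2<r_1$), admits a Gevrey-1 asymptotic expansion $\tilde\Psi^g(\eta)=\sum_{p\ge0}\Psi^g_p\,\eta^p$ as $\eta$ tends to $0$ from the left or from the right (with $\Lambda_0e^\eta$ in suitable open disks contained in $\mathbb D$, resp. $\mathbb E$, tangent to $\mathbb S^1$ at $\Lambda_0$), i.e. the remainder at order $N$ is bounded by $c_0c_1^N\,N!\,|\eta|^N$. Its Borel transform is $$\hat\Psi^g(\xi,z)=\sum_{n\ge0}\Psi^g_{n+1}(z)\frac{\xi^n}{n!}.$$ $\hat\Psi^\delta$ denotes $\hat\Psi^g$ for $g(z)=\delta(z)=\frac z{1-z}$. **Moving singular points.** For $a\in\mathbb Z^*$, $b\in\mathbb Z$, $z\in\mathbb D^*$ (with a determination of $\log$ chosen once and for all), $$\xi_{a,b}(z)=\frac{2\pi a}{m_0}\Big(-i\log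 z+\frac{2\pi b}{m_0}\Big),\qquad C_{a,b}=\frac1{m_0}\,e^{2\pi iab\,n_0'/m_0},$$ where $n_0'+m_0\mathbb Z$ is the multiplicative inverse of $n_0+m_0\mathbb Z$ in $\mathbb Z/m_0\mathbb Z$. *)

theory Defs
  imports "HOL-Complex_Analysis.Complex_Analysis" "HOL-Number_Theory.Cong"
begin

definition B_space :: "real \<Rightarrow> (complex \<Rightarrow> complex) set" where
  "B_space r = {g. g holomorphic_on ball 0 r \<and> bounded (g ` ball 0 r) \<and> g 0 = 0}"

text \<open>The solution, vanishing at \<open>z = 0\<close>, of the cohomological equation
  \<open>f(q, q z) - f(q, z) = g(z)\<close>, for \<open>q\<close> off the unit circle.\<close>

definition cohom_sol :: "(complex \<Rightarrow> complex) \<Rightarrow> complex \<Rightarrow> complex \<Rightarrow> complex" where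
  "cohom_sol g q z =
     (\<Sum>n. fps_nth (fps_expansion g 0) (Suc n) * z ^ Suc n / (q ^ Suc n - 1))"

text \<open>The open disks of radius \<open>\<rho>\<close> lying outside, resp. inside, the unit disk and tangent to the
  unit circle at \<open>\<Lambda>\<close> (for \<open>\<bar>\<Lambda>\<bar> = 1\<close> and \<open>0 < \<rho> < 1\<close>), in the coordinate \<open>\<eta>\<close> such that
  \<open>q = \<Lambda> exp \<eta>\<close>; the bound on \<open>Im \<eta>\<close> selects the determination of \<open>\<eta>\<close> close to \<open>0\<close>.\<close>

definition right_region :: "complex \<Rightarrow> real \<Rightarrow> complex set" where
  "right_region \<Lambda> \<rho> = {\<eta>. \<bar>Im \<eta>\<bar> < pi \<and> \<Lambda> * exp \<eta> \<in> ball (of_real (1 + \<rho>) * \<Lambda>) \<rho>}"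

definition left_region :: "complex \<Rightarrow> real \<Rightarrow> complex set" where
  "left_region \<Lambda> \<rho> = {\<eta>. \<bar>Im \<eta>\<bar> < pi \<and> \<Lambda> * exp \<eta> \<in> ball (of_real (1 - \<rho>) * \<Lambda>) \<rho>}"

text \<open>\<open>c\<close> is the Gevrey-1 asymptotic expansion of \<open>\<eta> f(\<Lambda> exp \<eta>, \<cdot>)\<close> in every space
  \<open>B_space r\<close> with \<open>0 < r < R\<close>, from the left and from the right. The quantification over all
  \<open>z \<in> ball 0 r\<close> expresses the estimate of the remainder in the supremum norm.\<close>

definition gevrey_expansion ::
  "complex \<Rightarrow> (complex \<Rightarrow> complex) \<Rightarrow> real \<Rightarrow> (nat \<Rightarrow> complex \<Rightarrow> complex) \<Rightarrow> bool" where
  "gevrey_expansion \<Lambda> g R c \<longleftrightarrow>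
     (\<forall>r. 0 < r \<and> r < R \<longrightarrow>
        (\<forall>p. c p \<in> B_space r) \<and>
        (\<exists>\<rho> c0 c1. 0 < \<rho> \<and> \<rho> < 1 \<and> c0 > 0 \<and> c1 > 0 \<and>
           (\<forall>N. \<forall>\<eta> \<in> left_region \<Lambda> \<rho> \<union> right_region \<Lambda> \<rho>. \<forall>z \<in> ball 0 r.
              norm (\<eta> * cohom_sol g (\<Lambda> * exp \<eta>) z - (\<Sum>p<N. c p z * \<eta> ^ p))
                \<le> c0 * c1 ^ N * fact N * norm \<eta> ^ N)))"

text \<open>The asymptotic expansion is unique on \<open>ball 0 R\<close>; the choice only affects values outside of
  that ball.\<close>

definition Psi_coeff ::
  "complex \<Rightarrow> (complex \<Rightarrow> complex) \<Rightarrow> real \<Rightarrow> nat \<Rightarrow> complex \<Rightarrow> complex" where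
  "Psi_coeff \<Lambda> g R = (SOME c. gevrey_expansion \<Lambda> g R c)"

text \<open>\<open>w\<close> is the sum of the (convergent) Borel transform at \<open>(\<xi>, z)\<close>.\<close>

definition Borel_sums ::
  "complex \<Rightarrow> (complex \<Rightarrow> complex) \<Rightarrow> real \<Rightarrow> complex \<Rightarrow> complex \<Rightarrow> complex \<Rightarrow> bool" where
  "Borel_sums \<Lambda> g R \<xi> z w \<longleftrightarrow>
     (\<lambda>n. Psi_coeff \<Lambda> g R (Suc n) z * \<xi> ^ n / fact n) sums w"

text \<open>Differentiability with a complex linear differential; used for open \<open>S\<close>.\<close>

definition holomorphic2_on ::
  "(complex \<times> complex \<Rightarrow> complex) \<Rightarrow> (complex \<times> complex) set \<Rightarrow> bool" where
  "holomorphic2_on F S \<longleftrightarrow>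
     (\<forall>p\<in>S. \<exists>a b. (F has_derivative (\<lambda>h. a * fst h + b * snd h)) (at p within S))"

definition delta :: "complex \<Rightarrow> complex" where
  "delta z = z / (1 - z)"

definition borel_term ::
  "nat \<Rightarrow> complex \<Rightarrow> (complex \<Rightarrow> complex) \<Rightarrow> nat \<Rightarrow> complex \<Rightarrow> complex \<Rightarrow> int \<Rightarrow> complex" where
  "borel_term m \<Lambda> g k \<xi> z a =
     exp (2 * pi * \<i> * of_nat k * of_int a / of_nat m) / (2 * pi * \<i> * of_int a)
       * (g (\<Lambda> ^ k * z * exp (of_nat m * \<xi> / (2 * pi * \<i> * of_int a))) - g (\<Lambda> ^ k * z))"

text \<open>The singular point \<open>\<xi>\<^bsub>a,b\<^esub>(z)\<close>, where \<open>lz\<close> is the chosen value of \<open>log z\<close>.\<close>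

definition sing_pt :: "nat \<Rightarrow> complex \<Rightarrow> int \<Rightarrow> int \<Rightarrow> complex" where
  "sing_pt m lz a b =
     2 * pi * of_int a / of_nat m * (- \<i> * lz + 2 * pi * of_int b / of_nat m)"

definition sing_res :: "nat \<Rightarrow> int \<Rightarrow> int \<Rightarrow> int \<Rightarrow> complex" where
  "sing_res m n' a b =
     1 / of_nat m * exp (2 * pi * \<i> * of_int a * of_int b * of_int n' / of_nat m)"

end

theory Submission
  imports Defs
begin

text \<open>The coefficient of \<open>g\<^sub>n z\<^sup>n\<close> in \<open>\<Psi>\<close> is \<open>\<eta> / (\<mu> exp (n \<eta>) - 1)\<close> with \<open>\<mu> = \<Lambda>\<^sup>n\<close> an \<open>m\<close>-th root of
  unity. Its Taylor series at \<open>\<eta> = 0\<close> has radius of convergence of order \<open>1/n\<close>; beyond that radius, the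
  tangency of the disks (\<open>\<bar>\<eta>\<bar>\<^sup>2 = O(\<bar>Re \<eta>\<bar>)\<close>) still bounds the function itself, and summing
  \<open>\<bar>g\<^sub>n\<bar> r\<^sup>n n\<^sup>N = O(c\<^sup>N N!)\<close> over \<open>n\<close> yields the Gevrey-1 estimate. The partial fraction expansion of the
  cotangent, split according to residue classes modulo \<open>m\<close>, expresses the Taylor coefficients of order at least two as
  \<open>- \<Sum>\<^sub>k \<mu>\<^sup>k \<Sum>\<^sub>a exp (2\<pi>i k a / m) m\<^sup>p / (2\<pi>i a)\<^sup>p\<^sup>+\<^sup>1\<close>; after division by factorials one can interchange the
  sums, and the sums over \<open>p\<close> and \<open>n\<close> reassemble the values of \<open>g\<close> in the formula.
  For \<open>g = \<delta>\<close>, locally only finitely many \<open>a\<close> contribute singular terms, and on a line through the origin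
  that avoids the poles the mean value theorem bounds the \<open>a\<close>-th term by \<open>O(\<bar>\<xi>\<bar> / a\<^sup>2)\<close>.\<close>

section \<open>Taylor coefficients of \<open>s / (\<mu> exp s - 1)\<close> at a root of unity \<open>\<mu>\<close>\<close>

text \<open>The poles of \<open>1 / (\<mu> exp s - 1)\<close> are the points 2\<pi>\<i>a/m with a in
  one residue class modulo m, all with residue 1. The sum over k is the finite Fourier expansion of
  the indicator of this class; as \<mu> = \<Lambda>^n, its characters act on z^n as the rotations
  from z to \<Lambda>^k z. Dividing by factorials turns the geometric series of each simple fraction
  into an exponential series, whence the factors exp (m\<xi>/(2\<pi>\<i>a)) in the argument of g.
  Absolute convergence over a, on which every interchange of sums depends, rests on two factors 1/a:
  one is the Fourier coefficient, the other comes from subtracting g(\<Lambda>^k z). The coefficient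
  of \<eta> itself has only the first factor, and its sum over a would converge only conditionally;
  it is therefore computed by finite geometric sums and becomes the first sum of the formula. For
  the growth on lines, the point is that the a-th term is a function of \<xi>/a and that a line
  through the origin is stable under division by a.\<close>

lemma pi_cot_eq_Digamma_diff:
  fixes z :: complex
  assumes "z \<notin> \<int>"
  shows "pi * cot (pi * z) = Digamma (1 - z) - Digamma z"
proof -
  have nz: "z \<notin> \<int>\<^sub>\<le>\<^sub>0" "1 - z \<notin> \<int>\<^sub>\<le>\<^sub>0"
    using assms Ints_diff[of 1 "1 - z"] nonpos_Ints_subset_Ints by auto
  have sin0: "sin (of_real pi * z) \<noteq> 0"
    using assms by (subst sin_eq_0) auto
  \<comment> \<open>The two sides of the reflection formula
    \<open>rGamma z * rGamma (1 - z) = sin (pi * z) / pi\<close> are differentiated; the left one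
    has \<open>Digamma (1 - z) - Digamma z\<close> as its logarithmic derivative.\<close>
  have "((\<lambda>z. rGamma z * rGamma (1 - z)) has_field_derivative
          rGamma z * rGamma (1 - z) * (Digamma (1 - z) - Digamma z)) (at z)"
    using nz by (auto intro!: derivative_eq_intros simp: algebra_simps)
  moreover have "((\<lambda>z. sin (of_real pi * z) / of_real pi) has_field_derivative cos (of_real pi * z)) (at z)"
    by (auto intro!: derivative_eq_intros)
  ultimately have "rGamma z * rGamma (1 - z) * (Digamma (1 - z) - Digamma z) = cos (of_real pi * z)"
    by (intro DERIV_unique) (simp_all add: rGamma_reflection_complex)
  thus ?thesis
    using sin0 by (simp add: rGamma_reflection_complex cot_def field_simps)
qed

text \<open>Writing the cotangent through \<open>Digamma\<close> puts the poles at the positive and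
  at the nonpositive integers into separate summands. Each can be differentiated into
  \<open>Polygamma\<close> values, whose series are the two halves of the partial fraction
  expansion.\<close>

lemma inverse_exp_minus_1_eq_Digamma:
  fixes z :: complex
  assumes "z \<notin> \<int>"
  shows "1 / (exp (2 * pi * \<i> * z) - 1) = - 1 / 2 + (Digamma (1 - z) - Digamma z) / (2 * pi * \<i>)"
proof -
  define t where "t = of_real pi * z"
  have sin0: "sin t \<noteq> 0"
    using assms unfolding t_def by (subst sin_eq_0) auto
  have cs: "cos t * cos t = 1 - sin t * sin t"
    using sin_cos_squared_add[of t] by (simp add: power2_eq_square eq_diff_eq add.commute)
  have "exp (2 * pi * \<i> * z) = (exp (\<i> * t)) ^ 2"
    by (simp add: t_def exp_double[symmetric] algebra_simps)
  also have "\<dots> = (cos t + \<i> * sin t)^2"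
    by (simp add: exp_Euler)
  also have "(cos t + \<i> * sin t)^2 = 1 + 2 * \<i> * sin t * (cos t + \<i> * sin t)"
    by (simp add: power2_eq_square algebra_simps cs)
  finally have e: "exp (2 * pi * \<i> * z) - 1 = 2 * \<i> * sin t * (cos t + \<i> * sin t)"
    by simp
  have c: "(cos t + \<i> * sin t) * (cos t - \<i> * sin t) = 1"
    using sin_cos_squared_add[of t] by (simp add: power2_eq_square algebra_simps)
  hence nz: "cos t + \<i> * sin t \<noteq> 0" by auto
  have "1 / (exp (2 * pi * \<i> * z) - 1) = (cos t - \<i> * sin t) / (2 * \<i> * sin t)"
    unfolding e using sin0 nz by (subst c[symmetric]) simp
  also have "\<dots> = - 1 / 2 + cot t / (2 * \<i>)"
    using sin0 by (simp add: cot_def field_simps)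
  also have "cot t = (Digamma (1 - z) - Digamma z) / pi"
    using pi_cot_eq_Digamma_diff[OF assms] by (simp add: t_def field_simps)
  finally show ?thesis by (simp add: field_simps)
qed

text \<open>The regular part of \<open>1 / (exp (2\<pi>ij/m) exp s - 1)\<close> at \<open>s = 0\<close>: with \<open>w = j/m + s/(2\<pi>i)\<close> that function is
  \<open>- 1/2 + cot (\<pi>w) / (2i)\<close>, and for \<open>j = 0\<close> the shift of the second argument by \<open>1\<close> removes the pole.\<close>

definition cot_kernel :: "nat \<Rightarrow> nat \<Rightarrow> complex \<Rightarrow> complex" where
  "cot_kernel m j s = - 1 / 2 +
     (Digamma (1 - of_nat j / of_nat m - s / (2 * pi * \<i>))
      - Digamma ((if j = 0 then 1 else of_nat j / of_nat m) + s / (2 * pi * \<i>))) / (2 * pi * \<i>)"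

lemma Digamma_arg_not_nonpos_Ints:
  fixes w :: complex
  assumes "norm w < r" "r \<le> x"
  shows "of_real x + w \<notin> \<int>\<^sub>\<le>\<^sub>0"
proof
  assume "of_real x + w \<in> \<int>\<^sub>\<le>\<^sub>0"
  then obtain n where "of_real x + w = of_int n" "n \<le> 0" by (auto elim!: nonpos_Ints_cases)
  hence "Re (of_real x + w) \<le> 0" by (simp only: Re_complex_of_real complex_Re_of_int of_int_le_0_iff)
  moreover have "\<bar>Re w\<bar> < r" using abs_Re_le_cmod[of w] assms by linarith
  ultimately show False using assms by simp
qed

text \<open>The origin of the radius 2\<pi>/m: both base points are at least 1/m (for j = 0 owing to
  the shift by 1), and s/(2\<pi>\<i>) is smaller than 1/m, so both arguments keep a positive real
  part.\<close>

lemma cot_kernel_args: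
  fixes s :: complex
  assumes "j < m" "norm s < 2 * pi / m"
  shows "1 - of_nat j / of_nat m - s / (2 * pi * \<i>) \<notin> \<int>\<^sub>\<le>\<^sub>0"
    and "(if j = 0 then 1 else of_nat j / of_nat m) + s / (2 * pi * \<i>) \<notin> \<int>\<^sub>\<le>\<^sub>0"
proof -
  define w where "w = s / (2 * pi * \<i>)"
  have w: "norm w < 1 / m"
    using assms by (simp add: w_def norm_divide norm_mult field_simps)
  have "1 / m \<le> 1 - j / m" using assms by (simp add: field_simps)
  from Digamma_arg_not_nonpos_Ints[OF _ this, of "-w"] w
  show "1 - of_nat j / of_nat m - s / (2 * pi * \<i>) \<notin> \<int>\<^sub>\<le>\<^sub>0"
    by (simp add: w_def)
  have "1 / m \<le> (if j = 0 then 1 else j / m)" using assms by (simp add: field_simps)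
  from Digamma_arg_not_nonpos_Ints[OF _ this, of "w"] w
  show "(if j = 0 then 1 else of_nat j / of_nat m) + s / (2 * pi * \<i>) \<notin> \<int>\<^sub>\<le>\<^sub>0"
    by (simp add: w_def split: if_splits)
qed

lemma cot_kernel_holomorphic:
  assumes "j < m"
  shows "cot_kernel m j holomorphic_on ball 0 (2 * pi / m)"
  unfolding cot_kernel_def
  using cot_kernel_args[OF assms]
  by (auto intro!: holomorphic_intros holomorphic_on_compose_gen
     [OF _ holomorphic_on_Polygamma[of "- \<int>\<^sub>\<le>\<^sub>0"], unfolded o_def])

lemma cot_kernel_eq:
  assumes "j < m" "norm s < 2 * pi / m" "s \<noteq> 0 \<or> j \<noteq> 0"
  shows "1 / (exp (2 * pi * \<i> * of_nat j / of_nat m) * exp s - 1) = (if j = 0 then 1 / s else 0) + cot_kernel m j s"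
proof -
  define w where "w = s / (2 * pi * \<i>)"
  define z where "z = of_nat j / of_nat m + w"
  have w: "norm w < 1 / m"
    using assms by (simp add: w_def norm_divide norm_mult field_simps)
  have s: "s = 2 * pi * \<i> * w" by (simp add: w_def)
  \<comment> \<open>An integer different from j/m is at distance at least 1/m from it, whereas
    \<open>w\<close> is smaller than 1/m in modulus. An integral \<open>z\<close> thus forces i = j
    = 0 and w = 0, which the third hypothesis excludes.\<close>
  have "z \<notin> \<int>"
  proof
    assume "z \<in> \<int>"
    then obtain i where i: "z = of_int i" by (auto elim!: Ints_cases)
    have "w = of_real (of_int i - j / m)" using i by (simp add: z_def eq_diff_eq add.commute)
    hence "norm w = \<bar>of_int i - j / m\<bar>" by (metis norm_of_real real_norm_def)
    hence "\<bar>of_int i - j / m\<bar> < 1 / m" using w by simp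
    hence "\<bar>of_int i - j / m\<bar> * m < 1" using assms(1) by (simp add: field_simps)
    also have "\<bar>of_int i - j / m\<bar> * m = \<bar>(of_int i - j / m) * m\<bar>" by (simp add: abs_mult)
    also have "(of_int i - j / m) * m = of_int (i * int m - int j)"
      using assms(1) by (simp add: field_simps)
    finally have "i * int m = int j" by linarith
    hence "i = 0 \<and> j = 0" using assms(1)
      by (metis dvd_triv_right int_dvd_int_iff mult_eq_0_iff nat_dvd_not_less of_nat_0_eq_iff not_gr0 not_less0)
    hence "w = 0" using i by (simp add: z_def)
    thus False using assms s \<open>i = 0 \<and> j = 0\<close> by auto
  qed
  have "1 / (exp (2 * pi * \<i> * of_nat j / of_nat m) * exp s - 1) = 1 / (exp (2 * pi * \<i> * z) - 1)"
    by (simp add: s z_def exp_add[symmetric] algebra_simps)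
  also have "\<dots> = - 1 / 2 + (Digamma (1 - z) - Digamma z) / (2 * pi * \<i>)"
    by (rule inverse_exp_minus_1_eq_Digamma) fact
  also have "\<dots> = (if j = 0 then 1 / s else 0) + cot_kernel m j s"
  proof (cases "j = 0")
    case True
    hence "z = w" by (simp add: z_def)
    moreover have "w \<noteq> 0" using assms True s by auto
    \<comment> \<open>The recurrence isolates the pole; divided by 2\<pi>\<i>, the term 1/w becomes
      the 1/s of the statement.\<close>
    ultimately have "Digamma z = Digamma (1 + w) - 1 / w"
      using Digamma_plus1[of w] by (simp add: add.commute)
    thus ?thesis using True \<open>w \<noteq> 0\<close>
      by (simp add: cot_kernel_def s \<open>z = w\<close> diff_divide_distrib)
  qed (simp add: cot_kernel_def z_def w_def algebra_simps)
  finally show ?thesis .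
qed

definition cot_kernel_coeff :: "nat \<Rightarrow> nat \<Rightarrow> nat \<Rightarrow> complex" where
  "cot_kernel_coeff m j p = (deriv ^^ p) (cot_kernel m j) 0 / fact p"

lemma cot_kernel_sums:
  assumes "j < m" "norm s < 2 * pi / m"
  shows "(\<lambda>p. cot_kernel_coeff m j p * s ^ p) sums cot_kernel m j s"
  using holomorphic_power_series[OF cot_kernel_holomorphic[OF assms(1)], of s] assms(2)
  by (simp add: cot_kernel_coeff_def)

text \<open>The value is 1/(\<mu> - 1) for \<mu> \<noteq> 1 and -1/2 for \<mu> = 1, rewritten as a
  finite Fourier sum in the powers of \<mu>. With \<mu> = \<Lambda>^n, this is what later produces
  the terms (k/m - 1/2) g(\<Lambda>^k z).\<close>

lemma cot_kernel_coeff_0: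
  assumes "j < m"
  shows "cot_kernel_coeff m j 0 =
           (\<Sum>k<m. (of_nat k / of_nat m - 1 / 2) * exp (2 * pi * \<i> * of_nat j / of_nat m) ^ k)"
proof (cases "j = 0")
  case True
  have gauss: "(\<Sum>k<m. of_nat k :: complex) = of_nat m * (of_nat m - 1) / 2"
    by (induction m) (simp_all add: field_simps)
  have "(\<Sum>k<m. (of_nat k / of_nat m - 1 / 2 :: complex)) = (\<Sum>k<m. of_nat k) / of_nat m - of_nat m / 2"
    by (simp add: sum_subtractf sum_divide_distrib)
  hence "(\<Sum>k<m. (of_nat k / of_nat m - 1 / 2 :: complex)) = - 1 / 2"
    using assms unfolding gauss by (simp add: diff_divide_distrib)
  thus ?thesis using True by (simp add: cot_kernel_coeff_def cot_kernel_def)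
next
  case False
  define \<mu> where "\<mu> = exp (2 * pi * \<i> * of_nat j / of_nat m)"
  have "\<mu> ^ m = exp (of_nat j * (2 * pi * \<i>))"
    using assms by (simp add: \<mu>_def exp_of_nat_mult[symmetric] mult_ac)
  also have "\<dots> = exp (2 * pi * \<i>) ^ j" by (rule exp_of_nat_mult)
  finally have \<mu>m: "\<mu> ^ m = 1" by (simp add: exp_two_pi_i)
  have k0: "1 / (\<mu> - 1) = cot_kernel m j 0"
    using cot_kernel_eq[OF assms, of 0] False assms by (simp add: \<mu>_def)
  have "\<mu> \<noteq> 1"
  proof
    assume "\<mu> = 1"
    then obtain n :: int where "Im (2 * pi * \<i> * of_nat j / of_nat m) = of_int (2 * n) * pi"
      by (auto simp: \<mu>_def exp_eq_1)
    hence "2 * pi * real j / real m = 2 * pi * real_of_int n" by simp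
    hence "2 * pi * real j = 2 * pi * (real_of_int n * real m)"
      using assms by (simp add: divide_eq_eq)
    hence "real_of_int (int j) = of_int (n * int m)" by simp
    hence "int j = n * int m" by (simp only: of_int_eq_iff)
    thus False using assms False
      by (metis dvd_triv_right int_dvd_int_iff nat_dvd_not_less not_gr0)
  qed
  have 1: "(\<Sum>k<m. \<mu> ^ k) = 0"
    using geometric_sum[OF \<open>\<mu> \<noteq> 1\<close>, of m] \<mu>m by simp
  \<comment> \<open>Summation by parts. At n = m the geometric sum vanishes and \<mu>^m = 1, which
    leaves m.\<close>
  have *: "(\<Sum>k<n. of_nat k * \<mu> ^ k) * (\<mu> - 1) = of_nat n * \<mu> ^ n - \<mu> * (\<Sum>k<n. \<mu> ^ k)" for n
    by (induction n) (auto simp: algebra_simps)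
  have "(\<Sum>k<m. of_nat k * \<mu> ^ k) * (\<mu> - 1) = of_nat m"
    using *[of m] 1 \<mu>m by simp
  hence 2: "(\<Sum>k<m. of_nat k * \<mu> ^ k) = of_nat m / (\<mu> - 1)"
    using \<open>\<mu> \<noteq> 1\<close> by (simp add: field_simps)
  have "(\<Sum>k<m. (of_nat k / of_nat m - 1 / 2) * \<mu> ^ k) =
          (\<Sum>k<m. of_nat k * \<mu> ^ k) / of_nat m - (\<Sum>k<m. \<mu> ^ k) / 2"
    by (simp add: sum_subtractf sum_divide_distrib algebra_simps)
  also have "\<dots> = 1 / (\<mu> - 1)" using 1 2 assms by simp
  finally show ?thesis using k0 by (simp add: cot_kernel_coeff_def \<mu>_def)
qed

section \<open>Higher Taylor coefficients: partial fractions and finite Fourier expansion\<close>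

lemma cot_kernel_coeff_Polygamma:
  assumes "j < m" "p > 0"
  shows "cot_kernel_coeff m j p = ((-1) ^ p * Polygamma p (1 - of_nat j / of_nat m) -
            Polygamma p (if j = 0 then 1 else of_nat j / of_nat m)) / (2 * pi * \<i>) ^ Suc p / fact p"
proof -
  define u where "u = 1 / (2 * pi * \<i>)"
  define A where "A = (1 - of_nat j / of_nat m :: complex)"
  define B where "B = (if j = 0 then 1 else of_nat j / of_nat m :: complex)"
  let ?S = "ball (0::complex) (2 * pi / m)"
  have r: "2 * pi / m > 0" using assms by simp
  have args: "(-u) * s + A \<notin> \<int>\<^sub>\<le>\<^sub>0" "u * s + B \<notin> \<int>\<^sub>\<le>\<^sub>0" if "s \<in> ?S" for s
    using cot_kernel_args[OF assms(1), of s] that by (simp_all add: u_def A_def B_def algebra_simps)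
  have opn: "open (- \<int>\<^sub>\<le>\<^sub>0 :: complex set)" by (simp add: open_Compl)
  have hol: "Digamma holomorphic_on (- \<int>\<^sub>\<le>\<^sub>0 :: complex set)" by (intro holomorphic_on_Polygamma) auto
  have d: "(deriv ^^ p) (\<lambda>s. Digamma ((-u) * s + A)) 0 = (-u) ^ p * Polygamma p A"
          "(deriv ^^ p) (\<lambda>s. Digamma (u * s + B)) 0 = u ^ p * Polygamma p B"
    using args[of 0] r
    by (subst higher_deriv_compose_linear'[OF hol _ opn, where S = ?S]; use args in \<open>simp add: higher_deriv_Polygamma\<close>)+
  have h: "(\<lambda>s. Digamma ((-u) * s + A)) holomorphic_on ?S" "(\<lambda>s. Digamma (u * s + B)) holomorphic_on ?S"
    using args by (auto intro!: holomorphic_intros holomorphic_on_compose_gen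
     [OF _ hol, unfolded o_def])
  have k: "cot_kernel m j = (\<lambda>s. u * (Digamma ((-u) * s + A) - Digamma (u * s + B)) + (- 1 / 2))"
    by (auto simp: cot_kernel_def u_def A_def B_def fun_eq_iff algebra_simps diff_divide_distrib)
  have "(deriv ^^ p) (cot_kernel m j) 0 = (deriv ^^ p) (\<lambda>s. u * (Digamma ((-u) * s + A) - Digamma (u * s + B))) 0
          + (deriv ^^ p) (\<lambda>_. - 1 / 2) 0"
    unfolding k using h r by (intro higher_deriv_add[of _ ?S]) (auto intro!: holomorphic_intros)
  also have "(deriv ^^ p) (\<lambda>_. - 1 / 2) (0::complex) = 0" using assms(2) by (simp add: higher_deriv_const)
  also have "(deriv ^^ p) (\<lambda>s. u * (Digamma ((-u) * s + A) - Digamma (u * s + B))) 0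
     = u * (deriv ^^ p) (\<lambda>s. (Digamma ((-u) * s + A) - Digamma (u * s + B))) 0"
    using h r by (intro higher_deriv_cmult[of _ ?S]) (auto intro!: holomorphic_intros)
  also have "(deriv ^^ p) (\<lambda>s. (Digamma ((-u) * s + A) - Digamma (u * s + B))) 0 =
      (-u) ^ p * Polygamma p A - u ^ p * Polygamma p B"
    unfolding d[symmetric] using h r by (intro higher_deriv_diff[of _ ?S]) auto
  finally show ?thesis
    by (simp add: cot_kernel_coeff_def A_def B_def u_def power_minus' field_simps)
qed

lemma Polygamma_has_sum:
  assumes "x > 0" "p > 0"
  shows "((\<lambda>n. inverse ((of_real x + of_nat n :: complex) ^ Suc p)) has_sum
            ((-1) ^ Suc p * Polygamma p (of_real x) / fact p)) UNIV"
proof (rule norm_summable_imp_has_sum)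
  show "(\<lambda>n. inverse ((of_real x + of_nat n :: complex) ^ Suc p)) sums
          ((-1) ^ Suc p * Polygamma p (of_real x) / fact p)"
    using assms by (intro Polygamma_LIMSEQ) auto
  have "norm (inverse ((of_real x + of_nat n :: complex) ^ Suc p)) = inverse ((x + of_nat n) ^ Suc p)" for n
  proof -
    have "of_real x + of_nat n = (of_real (x + of_nat n) :: complex)" by simp
    hence "norm (of_real x + of_nat n :: complex) = x + of_nat n"
      using assms by (metis abs_of_nonneg add_nonneg_nonneg less_imp_le norm_of_real of_nat_0_le_iff)
    thus ?thesis by (simp only: norm_inverse norm_power)
  qed
  \<comment> \<open>The norms form the same series for the real number \<open>x\<close>, so the real
    Polygamma series supplies the absolute convergence needed for rearranging the sum along the
    integers.\<close>
  thus "summable (\<lambda>n. norm (inverse ((of_real x + of_nat n :: complex) ^ Suc p)))"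
    using Polygamma_LIMSEQ[of x p] assms by (simp only:) (auto simp: sums_iff)
qed

text \<open>The points 2\<pi>\<i>a/m with a congruent to -j modulo m are the poles of
  \<open>1 / (\<mu> exp s - 1)\<close>, and expanding 1/(s - 2\<pi>\<i>a/m) in powers of s gives
  minus the summand. The index a = 0, which belongs to the class only for j = 0, is the pole already
  removed from \<open>cot_kernel\<close>.\<close>

lemma cot_kernel_coeff_has_sum:
  assumes "j < m" "p > 0"
  shows "((\<lambda>a. if int m dvd a + int j then (of_nat m / (2 * pi * \<i> * of_int a)) ^ Suc p else 0)
            has_sum - cot_kernel_coeff m j p) (-{0})"
proof -
  define c :: complex where "c = 1 / (2 * pi * \<i>)"
  define h where "h a = (of_nat m / (2 * pi * \<i> * of_int a) :: complex) ^ Suc p" for a :: int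
  define A where "A = 1 - real j / real m"
  define j' where "j' = (if j = 0 then m else j)"
  define B where "B = real j' / real m"
  have pos: "A > 0" "B > 0" using assms by (auto simp: A_def B_def j'_def)
  \<comment> \<open>The positive and the negative members of the residue class of -j. Divided by m
    they are A + n and -(B + n); \<open>j'\<close> replaces 0 by m because 0 itself is excluded from
    its class.\<close>
  let ?P = "\<lambda>n::nat. int m * (int n + 1) - int j"
  let ?N = "\<lambda>n::nat. - (int m * int n + int j')"
  have inj: "inj_on ?P UNIV" "inj_on ?N UNIV" using assms by (auto simp: inj_on_def)
  have hP: "h (?P n) = c ^ Suc p * inverse ((of_real A + of_nat n) ^ Suc p)" for n
  proof -
    have "of_int (?P n) = of_nat m * (of_real A + of_nat n :: complex)"
      using assms by (simp add: A_def field_simps)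
    hence "of_nat m / (2 * pi * \<i> * of_int (?P n)) = c * inverse (of_real A + of_nat n)"
      using assms by (simp only:) (simp add: c_def divide_simps)
    thus ?thesis by (simp only: h_def power_mult_distrib power_inverse)
  qed
  have hN: "h (?N n) = (- c) ^ Suc p * inverse ((of_real B + of_nat n) ^ Suc p)" for n
  proof -
    have "of_int (?N n) = - of_nat m * (of_real B + of_nat n :: complex)"
      using assms by (simp add: B_def field_simps)
    hence "of_nat m / (2 * pi * \<i> * of_int (?N n)) = (- c) * inverse (of_real B + of_nat n)"
      using assms by (simp only:) (simp add: c_def divide_simps)
    thus ?thesis by (simp only: h_def power_mult_distrib power_inverse)
  qed
  have "((h \<circ> ?P) has_sum c ^ Suc p * ((-1) ^ Suc p * Polygamma p (of_real A) / fact p)) UNIV"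
    using Polygamma_has_sum[OF pos(1) assms(2)] unfolding o_def hP by (intro has_sum_cmult_right)
  hence 1: "(h has_sum c ^ Suc p * ((-1) ^ Suc p * Polygamma p (of_real A) / fact p)) (range ?P)"
    by (subst has_sum_reindex[OF inj(1)])
  have "((h \<circ> ?N) has_sum (- c) ^ Suc p * ((-1) ^ Suc p * Polygamma p (of_real B) / fact p)) UNIV"
    using Polygamma_has_sum[OF pos(2) assms(2)] unfolding o_def hN by (intro has_sum_cmult_right)
  hence 2: "(h has_sum (- c) ^ Suc p * ((-1) ^ Suc p * Polygamma p (of_real B) / fact p)) (range ?N)"
    by (subst has_sum_reindex[OF inj(2)])
  have Ppos: "?P n > 0" for n
  proof -
    have "int m * 1 \<le> int m * (int n + 1)" by (intro mult_left_mono) auto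
    thus ?thesis using assms by linarith
  qed
  have Nneg: "?N n < 0" for n
  proof -
    have "int m * int n \<ge> 0" by simp
    moreover have "int j' > 0" using assms by (simp add: j'_def)
    ultimately show ?thesis by linarith
  qed
  have "?P x \<noteq> ?N y" for x y using Ppos[of x] Nneg[of y] by linarith
  hence "range ?P \<inter> range ?N = {}" by blast
  from has_sum_Un_disjoint[OF 1 2 this]
  have 3: "(h has_sum (c ^ Suc p * ((-1) ^ Suc p * Polygamma p (of_real A) / fact p) +
      (- c) ^ Suc p * ((-1) ^ Suc p * Polygamma p (of_real B) / fact p))) (range ?P \<union> range ?N)" .
  have cover: "a \<in> range ?P \<union> range ?N" if "a \<noteq> 0" and d: "int m dvd a + int j" for a
  proof -
    from d obtain l where l: "a + int j = int m * l" by auto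
    show ?thesis
    proof (cases "a > 0")
      case True
      hence "l > 0" using l by (metis add_pos_nonneg of_nat_0_le_iff zero_less_mult_pos not_gr_zero assms(1) not_less0 of_nat_0_less_iff)
      hence "a = ?P (nat (l - 1))" using l by simp
      thus ?thesis by blast
    next
      case False
      show ?thesis
      proof (cases "j = 0")
        case True
        hence "l < 0" using l False that(1) assms
          by (metis add_0_right linorder_neqE_linordered_idom mult_eq_0_iff of_nat_0 of_nat_0_less_iff zero_less_mult_iff)
        hence "a = ?N (nat (- l - 1))" using l True by (simp add: j'_def algebra_simps)
        thus ?thesis by blast
      next
        case jn: False
        have "l \<le> 0"
        proof (rule ccontr)
          assume "\<not> l \<le> 0"
          hence "int m * 1 \<le> int m * l" by (intro mult_left_mono) auto
          thus False using l False assms by linarith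
        qed
        hence "a = ?N (nat (- l))" using l jn by (simp add: j'_def algebra_simps)
        thus ?thesis by blast
      qed
    qed
  qed
  have dv: "int m dvd ?P n + int j" "int m dvd ?N n + int j" for n
    by (auto simp: j'_def)
  have nz: "?P n \<noteq> 0" "?N n \<noteq> 0" for n using Ppos[of n] Nneg[of n] by linarith+
  have set: "range ?P \<union> range ?N = {a. a \<noteq> 0 \<and> int m dvd a + int j}"
  proof (intro equalityI subsetI CollectI)
    show "a \<noteq> 0 \<and> int m dvd a + int j" if "a \<in> range ?P \<union> range ?N" for a
      using that dv nz by (elim UnE imageE) (simp_all only: not_False_eq_True simp_thms)
  qed (use cover in simp)
  have "((\<lambda>a. if int m dvd a + int j then h a else 0) has_sum (c ^ Suc p * ((-1) ^ Suc p * Polygamma p (of_real A) / fact p) +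
      (- c) ^ Suc p * ((-1) ^ Suc p * Polygamma p (of_real B) / fact p))) (-{0})"
    using 3 unfolding set by (rule has_sum_cong_neutral[THEN iffD1, rotated -1]) auto
  moreover have "c ^ Suc p * ((-1) ^ Suc p * Polygamma p (of_real A) / fact p) +
      (- c) ^ Suc p * ((-1) ^ Suc p * Polygamma p (of_real B) / fact p) = - cot_kernel_coeff m j p"
  proof -
    have "of_real A = 1 - (of_nat j / of_nat m :: complex)"
         "of_real B = (if j = 0 then 1 else of_nat j / of_nat m :: complex)"
      using assms by (auto simp: A_def B_def j'_def)
    hence "cot_kernel_coeff m j p = ((-1) ^ p * Polygamma p (of_real A) - Polygamma p (of_real B)) * c ^ Suc p / fact p"
      unfolding cot_kernel_coeff_Polygamma[OF assms] c_def by (simp only: power_one_over) simp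
    hence "- cot_kernel_coeff m j p = c ^ Suc p * ((-1) ^ Suc p * Polygamma p (of_real A) / fact p) +
              c ^ Suc p * Polygamma p (of_real B) / fact p"
      by (simp add: algebra_simps diff_divide_distrib)
    moreover have "(- c) ^ Suc p * ((-1) ^ Suc p * X / fact p) = c ^ Suc p * X / fact p" for X :: complex
    proof -
      have "(- c) ^ Suc p * (-1) ^ Suc p = c ^ Suc p" by (simp add: power_mult_distrib[symmetric] del: power_Suc)
      thus ?thesis by (metis mult.assoc times_divide_eq_right)
    qed
    ultimately show ?thesis by (simp only:)
  qed
  ultimately show ?thesis by (simp only: h_def)
qed

lemma root_of_unity_sum:
  assumes "m > 0"
  shows "(\<Sum>k<m. exp (2 * pi * \<i> * of_nat k * of_int a / of_nat m)) = (if int m dvd a then of_nat m else 0)"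
proof -
  define q where "q = exp (2 * pi * \<i> * of_int a / of_nat m)"
  have q: "exp (2 * pi * \<i> * of_nat k * of_int a / of_nat m) = q ^ k" for k
    unfolding q_def exp_of_nat_mult[symmetric] by (rule arg_cong[of _ _ exp]) simp
  have q1: "q = 1 \<longleftrightarrow> int m dvd a"
  proof
    assume "q = 1"
    then obtain n :: int where "Im (2 * pi * \<i> * of_int a / of_nat m) = of_int (2 * n) * pi"
      by (auto simp: q_def exp_eq_1)
    hence "real_of_int a = of_int (n * int m)" using assms by (simp add: field_simps)
    hence "a = n * int m" by (simp only: of_int_eq_iff)
    thus "int m dvd a" by simp
  next
    assume "int m dvd a"
    then obtain l where "a = int m * l" by auto
    hence "2 * pi * \<i> * of_int a / of_nat m = 2 * of_int l * pi * \<i>" using assms by simp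
    thus "q = 1" unfolding q_def by (simp only: exp_integer_2pi Ints_of_int)
  qed
  have "q ^ m = exp (2 * of_int a * pi * \<i>)"
    using assms by (simp add: q_def exp_of_nat_mult[symmetric] algebra_simps)
  hence "q ^ m = 1" by (simp only: exp_integer_2pi Ints_of_int)
  thus ?thesis
    unfolding q using geometric_sum[of q m] q1 by auto
qed

text \<open>The indicator of m dividing a + j is 1/m times the sum of exp (2\<pi>\<i>k(a + j)/m)
  over k. The factor 1/m cancels one power of m, and the part that depends on j is \<mu>^k, which
  for \<mu> = \<Lambda>^n will turn z^n into (\<Lambda>^k z)^n.\<close>

lemma cot_kernel_coeff_Fourier:
  assumes "j < m" "p > 0"
  shows "((\<lambda>a. \<Sum>k<m. exp (2 * pi * \<i> * of_nat j / of_nat m) ^ k *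
            (exp (2 * pi * \<i> * of_nat k * of_int a / of_nat m) / (2 * pi * \<i> * of_int a) *
               (of_nat m / (2 * pi * \<i> * of_int a)) ^ p)) has_sum - cot_kernel_coeff m j p) (-{0})"
proof -
  have "(\<Sum>k<m. exp (2 * pi * \<i> * of_nat j / of_nat m) ^ k *
            (exp (2 * pi * \<i> * of_nat k * of_int a / of_nat m) / (2 * pi * \<i> * of_int a) *
               (of_nat m / (2 * pi * \<i> * of_int a)) ^ p)) =
        (if int m dvd a + int j then (of_nat m / (2 * pi * \<i> * of_int a)) ^ Suc p else 0)" for a
  proof -
    have "(\<Sum>k<m. exp (2 * pi * \<i> * of_nat j / of_nat m) ^ k *
            (exp (2 * pi * \<i> * of_nat k * of_int a / of_nat m) / (2 * pi * \<i> * of_int a) *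
               (of_nat m / (2 * pi * \<i> * of_int a)) ^ p)) =
        (\<Sum>k<m. exp (2 * pi * \<i> * of_nat k * of_int (a + int j) / of_nat m)) *
           ((of_nat m / (2 * pi * \<i> * of_int a)) ^ p / (2 * pi * \<i> * of_int a))"
      unfolding sum_distrib_right
    proof (intro sum.cong refl, goal_cases)
      case (1 k)
      have "exp (2 * pi * \<i> * of_nat j / of_nat m) ^ k * exp (2 * pi * \<i> * of_nat k * of_int a / of_nat m)
         = exp (2 * pi * \<i> * of_nat k * of_int (a + int j) / of_nat m)"
        unfolding exp_of_nat_mult[symmetric] mult_exp_exp
        by (rule arg_cong[of _ _ exp]) (simp add: algebra_simps add_divide_distrib)
      thus ?case by (simp add: field_simps)
    qed
    thus ?thesis using assms by (subst (asm) root_of_unity_sum) auto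
  qed
  thus ?thesis using cot_kernel_coeff_has_sum[OF assms] by simp
qed

section \<open>Remainder bound for a single monomial, uniform in its degree\<close>

lemma exp_minus_1_lower_bound:
  fixes x :: real
  shows "min 1 \<bar>x\<bar> / 2 \<le> \<bar>exp x - 1\<bar>"
proof (cases "x \<ge> 0")
  case True
  thus ?thesis using exp_ge_add_one_self[of x] by linarith
next
  case False
  have "exp x * (1 - x) \<le> exp x * exp (- x)"
    using exp_ge_add_one_self[of "-x"] by (intro mult_left_mono) auto
  hence "exp x \<le> 1 / (1 - x)"
    using False by (simp add: exp_minus field_simps)
  hence "- x / (1 - x) \<le> \<bar>exp x - 1\<bar>"
    using False by (simp add: field_simps abs_if)
  moreover have "min 1 \<bar>x\<bar> / 2 \<le> - x / (1 - x)"
    using False mult_nonpos_nonneg[of x "1 + x"] by (auto simp: min_def field_simps)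
  ultimately show ?thesis by linarith
qed

text \<open>Apostol-Bernoulli numbers divided by factorials: the Taylor coefficients of \<open>s / (\<mu> exp s - 1)\<close>
  for \<open>\<mu> = exp (2\<pi>ij/m)\<close>.\<close>

definition apostol_coeff :: "nat \<Rightarrow> nat \<Rightarrow> nat \<Rightarrow> complex" where
  "apostol_coeff m j p = (if p = 0 then (if j = 0 then 1 else 0) else cot_kernel_coeff m j (p - 1))"

lemma apostol_coeff_sums:
  assumes "j < m" "norm s < 2 * pi / m" "s \<noteq> 0"
  shows "(\<lambda>p. apostol_coeff m j p * s ^ p) sums (s / (exp (2 * pi * \<i> * of_nat j / of_nat m) * exp s - 1))"
proof -
  have "(\<lambda>p. s * (cot_kernel_coeff m j p * s ^ p)) sums (s * cot_kernel m j s)"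
    by (intro sums_mult cot_kernel_sums assms)
  hence "(\<lambda>p. apostol_coeff m j (Suc p) * s ^ Suc p) sums (s * cot_kernel m j s)"
    by (simp add: apostol_coeff_def algebra_simps)
  hence "(\<lambda>p. apostol_coeff m j p * s ^ p) sums (s * cot_kernel m j s + apostol_coeff m j 0 * s ^ 0)"
    by (subst (asm) sums_Suc_iff) simp
  also have "s * cot_kernel m j s + apostol_coeff m j 0 * s ^ 0 = s * ((if j = 0 then 1 / s else 0) + cot_kernel m j s)"
    using assms(3) by (simp add: apostol_coeff_def algebra_simps)
  also have "(if j = 0 then 1 / s else 0) + cot_kernel m j s = 1 / (exp (2 * pi * \<i> * of_nat j / of_nat m) * exp s - 1)"
    using cot_kernel_eq[of j m s] assms by simp
  finally show ?thesis by simp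
qed

text \<open>A Cauchy estimate: s = 1/m lies in the disk of convergence because 1 < 2\<pi>, so the
  terms of the series at this point are bounded. The finitely many constants are dominated by their
  sum.\<close>

lemma apostol_coeff_bound:
  "\<exists>C>0. \<forall>j<m. \<forall>p. norm (apostol_coeff m j p) \<le> C * real m ^ p"
proof -
  have "\<exists>C>0. \<forall>p. norm (apostol_coeff m j p) \<le> C * real m ^ p" if j: "j < m" for j
  proof -
    have "1 < 2 * pi" using pi_ge_two by linarith
    hence "norm (1 / of_nat m :: complex) < 2 * pi / m"
      using j by (simp add: norm_divide divide_strict_right_mono)
    from apostol_coeff_sums[OF j this] j have "summable (\<lambda>p. apostol_coeff m j p * (1 / of_nat m) ^ p)"
      by (auto simp: sums_iff)
    hence "Bseq (\<lambda>p. apostol_coeff m j p * (1 / of_nat m) ^ p)"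
      using convergent_imp_Bseq convergentI summable_LIMSEQ_zero by blast
    then obtain C where C: "C > 0" "\<And>p. norm (apostol_coeff m j p * (1 / of_nat m) ^ p) \<le> C"
      by (auto simp: Bseq_def)
    have "norm (apostol_coeff m j p) \<le> C * real m ^ p" for p
      using C(2)[of p] j by (simp add: norm_mult norm_power norm_divide field_simps)
    thus ?thesis using C(1) by blast
  qed
  then obtain C where C: "\<And>j. j < m \<Longrightarrow> C j > 0" "\<And>j p. j < m \<Longrightarrow> norm (apostol_coeff m j p) \<le> C j * real m ^ p"
    by metis
  have "norm (apostol_coeff m j p) \<le> (1 + (\<Sum>j<m. C j)) * real m ^ p" if "j < m" for j p
  proof -
    have "C j \<le> (\<Sum>j<m. C j)" using that C(1) by (intro member_le_sum) (auto intro: less_imp_le)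
    hence "C j * real m ^ p \<le> (1 + (\<Sum>j<m. C j)) * real m ^ p" by (intro mult_right_mono) auto
    thus ?thesis using C(2)[OF that, of p] by linarith
  qed
  moreover have "1 + (\<Sum>j<m. C j) > 0" using C(1) by (intro add_pos_nonneg sum_nonneg) (auto intro: less_imp_le)
  ultimately show ?thesis by blast
qed

lemma sum_power_le_power:
  fixes x :: real
  assumes "x \<ge> 2"
  shows "(\<Sum>p<N. x ^ p) \<le> x ^ N"
proof (induction N)
  case (Suc N)
  have "(\<Sum>p<Suc N. x ^ p) \<le> 2 * x ^ N" using Suc by simp
  also have "\<dots> \<le> x * x ^ N" using assms by (intro mult_right_mono) auto
  finally show ?case by simp
qed auto

lemma norm_suminf_tail_le:
  fixes f :: "nat \<Rightarrow> complex"
  assumes "f sums S" "\<And>p. norm (f p) \<le> C * x ^ p" "0 \<le> x" "x < 1 / 2" "C \<ge> 0"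
  shows "norm (S - (\<Sum>p<N. f p)) \<le> 2 * C * x ^ N"
proof -
  have 1: "(\<lambda>p. f (p + N)) sums (S - (\<Sum>p<N. f p))"
    using assms(1) by (subst sums_iff_shift) simp
  have "(\<lambda>p. x ^ p) sums (1 / (1 - x))" using assms by (intro geometric_sums) auto
  hence 2: "(\<lambda>p. C * x ^ N * x ^ p) sums (C * x ^ N * (1 / (1 - x)))" by (rule sums_mult)
  have "norm (f (p + N)) \<le> C * x ^ N * x ^ p" for p
    using assms(2)[of "p + N"] by (simp add: power_add mult_ac)
  from norm_sums_le[OF 1 2 this]
  have "norm (S - (\<Sum>p<N. f p)) \<le> C * x ^ N * (1 / (1 - x))" .
  also have "\<dots> \<le> C * x ^ N * 2"
    using assms by (intro mult_left_mono) (auto simp: field_simps)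
  finally show ?thesis by simp
qed

lemma norm_exp_minus_1_ge:
  assumes "norm \<mu> = 1"
  shows "min 1 \<bar>Re s\<bar> / 2 \<le> norm (\<mu> * exp s - 1)"
proof -
  have "min 1 \<bar>Re s\<bar> / 2 \<le> \<bar>norm (\<mu> * exp s) - norm (1::complex)\<bar>"
    using exp_minus_1_lower_bound[of "Re s"] assms by (simp add: norm_mult)
  also have "\<dots> \<le> norm (\<mu> * exp s - 1)" by (rule norm_triangle_ineq3)
  finally show ?thesis .
qed

lemma divide_nat_le:
  fixes x :: real
  assumes "x \<ge> 0" "n \<ge> 1"
  shows "x / real n \<le> x"
  using assms mult_left_mono[of 1 "real n" x] by (simp add: divide_le_eq)

text \<open>The constants must not depend on n, since the bounds are summed over n afterwards; hence
  everything is expressed in s = n\<eta>. For m\<bar>s\<bar> < 1/2 the remainder is a geometric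
  tail. Otherwise (A\<bar>s\<bar>)^N is at least 1, and it absorbs the function and the Taylor
  polynomial separately.\<close>

lemma monomial_remainder_bound:
  fixes K :: real
  assumes m: "m > 0" and K: "K \<ge> 0"
  obtains C A where "C > 0" "A > 0"
    "\<And>j n \<eta> N. j < m \<Longrightarrow> n \<ge> 1 \<Longrightarrow> \<eta> \<noteq> 0 \<Longrightarrow> norm \<eta> \<le> 1 \<Longrightarrow> norm \<eta> ^ 2 \<le> K * \<bar>Re \<eta>\<bar> \<Longrightarrow>
     norm (\<eta> / (exp (2 * pi * \<i> * of_nat j / of_nat m) * exp (of_nat n * \<eta>) - 1)
            - (\<Sum>p<N. apostol_coeff m j p * of_nat n ^ p / of_nat n * \<eta> ^ p)) \<le> C * (A * (real n * norm \<eta>)) ^ N"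
proof -
  obtain C where C: "C > 0" "\<And>j p. j < m \<Longrightarrow> norm (apostol_coeff m j p) \<le> C * real m ^ p"
    using apostol_coeff_bound[of m] by blast
  \<comment> \<open>\<open>D\<close> bounds the function when m\<bar>s\<bar> \<ge> 1/2: the 2 covers
    \<bar>Re s\<bar> \<ge> 1, where the bound is 2\<bar>\<eta>\<bar>, and 4mK covers smaller
    \<bar>Re s\<bar>, where the tangency hypothesis gives 2K/\<bar>s\<bar> and 1/\<bar>s\<bar> \<le>
    2m.\<close>
  define D where "D = 2 + 4 * real m * K"
  have D: "D \<ge> 2" "D \<ge> 4 * real m * K" using K by (simp_all add: D_def)
  define C' where "C' = 2 * C + D"
  \<comment> \<open>This makes A\<bar>s\<bar> at least 2 as soon as m\<bar>s\<bar> \<ge> 1/2, so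
    that the powers of exponent below N add up to at most the N-th power.\<close>
  define A where "A = 4 * real m"
  have C': "C' > 0" "C' \<ge> 2 * C" using C(1) D by (simp_all add: C'_def)
  have "norm (\<eta> / (\<mu> * exp (of_nat n * \<eta>) - 1)
            - (\<Sum>p<N. apostol_coeff m j p * of_nat n ^ p / of_nat n * \<eta> ^ p)) \<le> C' * (A * (real n * norm \<eta>)) ^ N"
    if j: "j < m" and n: "n \<ge> 1" and e: "\<eta> \<noteq> 0" "norm \<eta> \<le> 1" "norm \<eta> ^ 2 \<le> K * \<bar>Re \<eta>\<bar>"
      and \<mu>: "\<mu> = exp (2 * pi * \<i> * of_nat j / of_nat m)"
    for j n \<eta> N \<mu>
  proof -
    define s where "s = of_nat n * \<eta>"
    have s0: "s \<noteq> 0" and ns: "norm s = real n * norm \<eta>" using n e by (auto simp: s_def norm_mult)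
    have nmu: "norm \<mu> = 1" by (simp add: \<mu>)
    have eq: "\<eta> / (\<mu> * exp (of_nat n * \<eta>) - 1)
            - (\<Sum>p<N. apostol_coeff m j p * of_nat n ^ p / of_nat n * \<eta> ^ p) =
          (s / (\<mu> * exp s - 1) - (\<Sum>p<N. apostol_coeff m j p * s ^ p)) / of_nat n"
      using n by (simp add: s_def diff_divide_distrib sum_divide_distrib power_mult_distrib mult_ac)
    show ?thesis
    proof (cases "m * norm s < 1 / 2")
      case True
      hence "norm s < 2 * pi / m" using m pi_ge_two by (simp add: field_simps)
      from apostol_coeff_sums[OF j this s0]
      have "(\<lambda>p. apostol_coeff m j p * s ^ p) sums (s / (\<mu> * exp s - 1))" by (simp add: \<mu>)
      moreover have "norm (apostol_coeff m j p * s ^ p) \<le> C * (m * norm s) ^ p" for p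
        using C(2)[OF j, of p] mult_right_mono[of _ _ "norm s ^ p"]
        by (simp add: norm_mult norm_power power_mult_distrib mult.assoc[symmetric])
      ultimately have "norm (s / (\<mu> * exp s - 1) - (\<Sum>p<N. apostol_coeff m j p * s ^ p)) \<le> 2 * C * (m * norm s) ^ N"
        using True C(1) by (intro norm_suminf_tail_le) auto
      also have "\<dots> \<le> C' * (A * norm s) ^ N"
        using C' C(1) by (intro mult_mono power_mono) (auto simp: A_def)
      finally have "norm (s / (\<mu> * exp s - 1) - (\<Sum>p<N. apostol_coeff m j p * s ^ p)) \<le> C' * (A * norm s) ^ N" .
      from order_trans[OF divide_nat_le[OF norm_ge_zero n] this] show ?thesis unfolding eq norm_divide using n by (simp add: ns)
    next
      case False
      hence big: "A * norm s \<ge> 2" by (simp add: A_def)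
      have "norm (\<Sum>p<N. apostol_coeff m j p * s ^ p) \<le> (\<Sum>p<N. C * (A * norm s) ^ p)"
      proof (intro sum_norm_le)
        fix p
        have "norm (apostol_coeff m j p * s ^ p) \<le> (C * m ^ p) * norm s ^ p"
          using C(2)[OF j, of p] by (simp add: norm_mult norm_power mult_right_mono)
        also have "\<dots> = C * (m * norm s) ^ p" by (simp add: power_mult_distrib)
        also have "\<dots> \<le> C * (A * norm s) ^ p" using C(1)
          by (intro mult_left_mono power_mono) (auto simp: A_def)
        finally show "norm (apostol_coeff m j p * s ^ p) \<le> C * (A * norm s) ^ p" .
      qed
      also have "\<dots> \<le> C * (A * norm s) ^ N"
        unfolding sum_distrib_left[symmetric] using C(1) big by (intro mult_left_mono sum_power_le_power) auto
      finally have 1: "norm ((\<Sum>p<N. apostol_coeff m j p * s ^ p) / of_nat n) \<le> C * (A * norm s) ^ N"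
        unfolding norm_divide using order_trans[OF divide_nat_le[OF norm_ge_zero n]] by simp
      have Re0: "Re \<eta> \<noteq> 0" using e K by auto
      have "norm (s / (\<mu> * exp s - 1) / of_nat n) = norm \<eta> / norm (\<mu> * exp s - 1)"
        using n by (simp add: s_def norm_divide norm_mult)
      \<comment> \<open>outside the disk of convergence the function itself is controlled by \<open>\<bar>exp (Re s) - 1\<bar>\<close>\<close>
      also have "\<dots> \<le> norm \<eta> / (min 1 \<bar>Re s\<bar> / 2)"
      proof -
        have "min 1 \<bar>Re s\<bar> / 2 > 0" using Re0 n by (auto simp: s_def)
        with norm_exp_minus_1_ge[OF nmu, of s] show ?thesis
          by (intro divide_left_mono mult_pos_pos) auto
      qed
      also have "\<dots> \<le> D"
      proof (cases "\<bar>Re s\<bar> \<ge> 1")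
        case True
        hence "norm \<eta> / (min 1 \<bar>Re s\<bar> / 2) = 2 * norm \<eta>" by (simp add: min_def)
        also have "\<dots> \<le> D" using e(2) D(1) by linarith
        finally show ?thesis .
      next
        case F: False
        have "norm \<eta> * norm \<eta> \<le> K * \<bar>Re \<eta>\<bar>" using e by (simp add: power2_eq_square)
        moreover have "x * x \<le> K * y \<Longrightarrow> x > 0 \<Longrightarrow> y > 0 \<Longrightarrow> x / y \<le> K / x" for x y :: real
          by (simp add: pos_divide_le_eq pos_le_divide_eq)
        ultimately have "norm \<eta> / \<bar>Re \<eta>\<bar> \<le> K / norm \<eta>" using Re0 e by simp
        hence "2 / real n * (norm \<eta> / \<bar>Re \<eta>\<bar>) \<le> 2 / real n * (K / norm \<eta>)"
          by (intro mult_left_mono) auto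
        moreover have "norm \<eta> / (min 1 \<bar>Re s\<bar> / 2) = 2 / real n * (norm \<eta> / \<bar>Re \<eta>\<bar>)"
          using F by (simp add: min_def s_def abs_mult)
        ultimately have "norm \<eta> / (min 1 \<bar>Re s\<bar> / 2) \<le> 2 / n * (K / norm \<eta>)"
          by simp
        also have "\<dots> = 2 * K * (1 / norm s)" by (simp add: ns)
        also have "\<dots> \<le> 2 * K * (2 * m)"
        proof (intro mult_left_mono)
          have "1 / 2 \<le> m * x \<Longrightarrow> x > 0 \<Longrightarrow> 1 / x \<le> 2 * m" for x m :: real
            by (simp add: pos_divide_le_eq)
          thus "1 / norm s \<le> 2 * m" using False s0 by simp
        qed (use K in auto)
        also have "\<dots> \<le> D" using D(2) by (simp add: mult_ac)
        finally show ?thesis .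
      qed
      also have "\<dots> \<le> D * (A * norm s) ^ N"
      proof -
        have "1 \<le> (A * norm s) ^ N" using big by (intro one_le_power) auto
        from mult_left_mono[OF this, of D] show ?thesis using D by simp
      qed
      finally have "norm (s / (\<mu> * exp s - 1) / of_nat n) \<le> D * (A * norm s) ^ N" .
      hence "norm ((s / (\<mu> * exp s - 1) - (\<Sum>p<N. apostol_coeff m j p * s ^ p)) / of_nat n)
           \<le> D * (A * norm s) ^ N + C * (A * norm s) ^ N"
        unfolding diff_divide_distrib using 1 by (intro order_trans[OF norm_triangle_ineq4] add_mono)
      also have "\<dots> \<le> C' * (A * norm s) ^ N"
        unfolding distrib_right[symmetric] using big C(1) by (intro mult_right_mono) (auto simp: C'_def)
      finally show ?thesis unfolding eq by (simp add: ns)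
    qed
  qed
  note main = this
  have "A > 0" using m by (simp add: A_def)
  show thesis by (rule that[OF C'(1) \<open>A > 0\<close> main[OF _ _ _ _ _ refl]])
qed

section \<open>The Gevrey expansion\<close>

lemma abs_exp_minus_1_le:
  fixes y :: real
  shows "\<bar>exp y - 1\<bar> \<le> \<bar>y\<bar> * exp \<bar>y\<bar>"
proof (cases "y \<ge> 0")
  case True
  have "exp y * (1 - y) \<le> exp y * exp (- y)"
    using exp_ge_add_one_self[of "-y"] by (intro mult_left_mono) auto
  hence "exp y - 1 \<le> y * exp y" by (simp add: exp_minus algebra_simps)
  thus ?thesis using True by simp
next
  case False
  have "exp y < 1" using False by simp
  hence "\<bar>exp y - 1\<bar> \<le> \<bar>y\<bar> * 1" using exp_ge_add_one_self[of y] False by linarith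
  also have "\<dots> \<le> \<bar>y\<bar> * exp \<bar>y\<bar>" by (intro mult_left_mono) auto
  finally show ?thesis .
qed

lemma norm_diff_real_less_imp:
  fixes x :: complex
  assumes "norm (x - of_real c) < \<bar>c\<bar>"
  shows "norm x ^ 2 < 2 * c * Re x"
proof -
  have "norm (x - of_real c) ^ 2 < \<bar>c\<bar> ^ 2" using assms by (intro power_strict_mono) auto
  thus ?thesis unfolding cmod_power2 by (simp add: power2_eq_square algebra_simps)
qed

text \<open>In the coordinate x = exp \<eta> - 1 the two disks become \<bar>x - c\<bar> <
  \<bar>c\<bar> with c = 1/4 or c = -1/4, that is \<bar>x\<bar>^2 < 2c Re x. Then \<bar>x\<bar>^2 is
  at most the distance of \<bar>exp \<eta>\<bar>^2 = exp (2 Re \<eta>) from 1, hence O(\<bar>Re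
  \<eta>\<bar>). The constant 8 exp 2 results from \<bar>\<eta>\<bar> \<le> 2\<bar>x\<bar> and
  \<bar>Re \<eta>\<bar> \<le> 1.\<close>

lemma region_estimates:
  assumes \<Lambda>: "norm \<Lambda> = 1" and "\<eta> \<in> left_region \<Lambda> (1/4) \<union> right_region \<Lambda> (1/4)"
  shows "\<eta> \<noteq> 0" "norm \<eta> \<le> 1" "norm \<eta> ^ 2 \<le> 8 * exp 2 * \<bar>Re \<eta>\<bar>"
proof -
  define x where "x = exp \<eta> - 1"
  have ex: "exp \<eta> = 1 + x" by (simp add: x_def)
  from assms(2) obtain c :: real where c: "\<bar>Im \<eta>\<bar> < pi" "c = 1/4 \<or> c = - 1/4"
    "\<Lambda> * exp \<eta> \<in> ball (of_real (1 + c) * \<Lambda>) (1/4)"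
  proof (elim UnE)
    assume "\<eta> \<in> left_region \<Lambda> (1/4)"
    thus thesis by (intro that[of "-1/4"]) (simp_all add: left_region_def)
  next
    assume "\<eta> \<in> right_region \<Lambda> (1/4)"
    thus thesis by (intro that[of "1/4"]) (simp_all add: right_region_def)
  qed
  have "norm (x - of_real c) = norm (\<Lambda> * (x - of_real c))" using \<Lambda> by (simp add: norm_mult)
  also have "\<Lambda> * (x - of_real c) = - (of_real (1 + c) * \<Lambda> - \<Lambda> * exp \<eta>)"
    by (simp add: x_def algebra_simps)
  also have "norm \<dots> < \<bar>c\<bar>" using c by (auto simp: dist_norm norm_minus_commute)
  finally have xc: "norm (x - of_real c) < \<bar>c\<bar>" .
  have x2: "norm x ^ 2 < 2 * c * Re x" using norm_diff_real_less_imp[OF xc] .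
  have "norm x \<le> norm (x - of_real c) + norm (of_real c :: complex)"
    using norm_triangle_ineq[of "x - of_real c" "of_real c"] by simp
  hence xh: "norm x < 1 / 2" using xc c(2) by auto
  show "\<eta> \<noteq> 0" using x2 by (auto simp: x_def)
  \<comment> \<open>The bound on Im \<eta> in the definition of the regions makes \<eta> the
    principal logarithm; the radius 1/4 was taken so that \<bar>x\<bar> < 1/2, where \<bar>Ln (1 +
    x)\<bar> \<le> 2\<bar>x\<bar>.\<close>
  have "\<eta> = Ln (exp \<eta>)" using c(1) by (intro Ln_exp[symmetric]) auto
  hence "norm \<eta> = norm (Ln (1 + x))" by (simp add: ex)
  also have "\<dots> \<le> 2 * norm x" by (intro norm_Ln_le xh)
  finally have ex2: "norm \<eta> \<le> 2 * norm x" .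
  show e1: "norm \<eta> \<le> 1" using ex2 xh by linarith
  have "norm (exp \<eta>) ^ 2 = 1 + 2 * Re x + norm x ^ 2"
    by (simp only: ex cmod_power2) (simp add: power2_eq_square algebra_simps)
  moreover have "norm x ^ 2 < Re x / 2 \<or> norm x ^ 2 < - Re x / 2"
  proof (cases "c = 1 / 4")
    case True
    show ?thesis using x2[unfolded True] by simp
  next
    case False
    hence cneg: "c = - 1 / 4" using c(2) by simp
    show ?thesis using x2[unfolded cneg] by simp
  qed
  ultimately have "norm x ^ 2 \<le> \<bar>norm (exp \<eta>) ^ 2 - 1\<bar>"
    using zero_le_power2[of "norm x"] by linarith
  also have "norm (exp \<eta>) ^ 2 = exp (2 * Re \<eta>)" by (simp add: exp_double)
  also have "\<bar>exp (2 * Re \<eta>) - 1\<bar> \<le> \<bar>2 * Re \<eta>\<bar> * exp \<bar>2 * Re \<eta>\<bar>" by (rule abs_exp_minus_1_le)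
  also have "\<dots> \<le> \<bar>2 * Re \<eta>\<bar> * exp 2"
    using abs_Re_le_cmod[of \<eta>] e1 by (intro mult_left_mono) (auto simp: abs_mult)
  finally have "norm x ^ 2 \<le> 2 * (\<bar>Re \<eta>\<bar> * exp 2)" by (simp add: abs_mult)
  moreover have "norm \<eta> ^ 2 \<le> (2 * norm x) ^ 2" using ex2 by (intro power_mono) auto
  hence "norm \<eta> ^ 2 \<le> 4 * norm x ^ 2" by (simp add: power_mult_distrib)
  ultimately have "norm \<eta> ^ 2 \<le> 4 * (2 * (\<bar>Re \<eta>\<bar> * exp 2))" unfolding power_mult_distrib by linarith
  thus "norm \<eta> ^ 2 \<le> 8 * exp 2 * \<bar>Re \<eta>\<bar>" by (simp add: mult_ac)
qed

text \<open>Shrinking the radius from R to r buys geometric decay instead of mere boundedness: the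
  terms are bounded at an intermediate radius r', and x = r/r'. This decay is the reserve from which
  powers of n are paid later.\<close>

lemma taylor_coeff_geometric_bound:
  assumes "g holomorphic_on ball 0 R" "0 < r" "r < R"
  shows "\<exists>G>0. \<exists>x>0. x < 1 \<and> (\<forall>n. norm (fps_nth (fps_expansion g 0) n) * r ^ n \<le> G * x ^ n)"
proof -
  define r' where "r' = (r + R) / 2"
  have r': "r < r'" "r' < R" "r' > 0" using assms by (auto simp: r'_def)
  have "(\<lambda>n. fps_nth (fps_expansion g 0) n * of_real r' ^ n) sums g (of_real r')"
    using holomorphic_power_series[OF assms(1), of "of_real r'"] r' by (simp add: fps_expansion_def)
  hence "Bseq (\<lambda>n. fps_nth (fps_expansion g 0) n * of_real r' ^ n)"
    using convergent_imp_Bseq convergentI summable_LIMSEQ_zero sums_summable by blast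
  then obtain G where G: "G > 0" "\<And>n. norm (fps_nth (fps_expansion g 0) n * of_real r' ^ n) \<le> G"
    by (auto simp: Bseq_def)
  have "norm (fps_nth (fps_expansion g 0) n) * r ^ n \<le> G * (r / r') ^ n" for n
  proof -
    have "norm (fps_nth (fps_expansion g 0) n) * r' ^ n * (r / r') ^ n \<le> G * (r / r') ^ n"
      using G(2)[of n] r' assms by (intro mult_right_mono) (auto simp: norm_mult norm_power)
    thus ?thesis using r' by (simp add: power_divide)
  qed
  thus ?thesis using G(1) r' assms by (intro exI[of _ G] exI[of _ "r / r'"] conjI) auto
qed

lemma power_div_fact_le_exp:
  fixes x :: real
  assumes "x \<ge> 0"
  shows "x ^ n / fact n \<le> exp x"
proof -
  have "(\<Sum>k\<in>{n}. x ^ k /\<^sub>R fact k) \<le> (\<Sum>k. x ^ k /\<^sub>R fact k)"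
    using assms by (intro sum_le_suminf summable_exp_generic) auto
  thus ?thesis by (simp add: exp_def divide_inverse mult.commute)
qed

text \<open>The origin of N! in the Gevrey bound. In x^n = y^n y^n one factor is spent on n^N,
  through t^N/N! \<le> exp t with t = n ln (1/y); the other is kept so that the sum over n still
  converges.\<close>

lemma power_times_geometric_le:
  fixes x :: real
  assumes "0 < x" "x < 1"
  shows "\<exists>A>0. \<exists>y>0. y < 1 \<and> (\<forall>n N. real n ^ N * x ^ n \<le> fact N * A ^ N * y ^ n)"
proof -
  define y where "y = sqrt x"
  define e where "e = - ln y"
  have y: "0 < y" "y < 1" "x = y * y" using assms by (auto simp: y_def)
  have e: "e > 0" using y by (simp add: e_def)
  have "real n ^ N * x ^ n \<le> fact N * (1 / e) ^ N * y ^ n" for n N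
  proof -
    have "exp (e * n) * y ^ n = 1"
    proof -
      have "y ^ n = exp (- e * n)" using y by (simp add: e_def exp_of_nat2_mult)
      thus ?thesis by (simp add: exp_minus)
    qed
    moreover have "(e * n) ^ N / fact N * y ^ n \<le> exp (e * n) * y ^ n"
      using e y by (intro mult_right_mono power_div_fact_le_exp) auto
    ultimately have "(e * n) ^ N / fact N * y ^ n \<le> 1" by simp
    hence "(e * n) ^ N * y ^ n \<le> fact N" by (simp add: field_simps)
    hence "(e * n) ^ N * y ^ n * y ^ n \<le> fact N * y ^ n" using y by (intro mult_right_mono) auto
    thus ?thesis using e y by (simp add: power_mult_distrib field_simps)
  qed
  thus ?thesis using e y by (intro exI[of _ "1 / e"] exI[of _ y] conjI) auto
qed

text \<open>The explicit candidate for the coefficient of \<eta>^p. With s = n\<eta>, the factor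
  \<eta>/(\<Lambda>^n exp (n\<eta>) - 1) is 1/n times s/(\<mu> exp s - 1), whence n^p/n; for
  \<Lambda> = exp (2\<pi>\<i>n0/m), the root \<mu> = \<Lambda>^n has the index n n0 mod m.\<close>

definition psi_series :: "nat \<Rightarrow> nat \<Rightarrow> (complex \<Rightarrow> complex) \<Rightarrow> nat \<Rightarrow> complex \<Rightarrow> complex" where
  "psi_series m n0 g p z = (\<Sum>n. fps_nth (fps_expansion g 0) (Suc n) *
     (apostol_coeff m (Suc n * n0 mod m) p * of_nat (Suc n) ^ p / of_nat (Suc n)) * z ^ Suc n)"

lemma root_power_mod:
  assumes "m > 0"
  shows "exp (2 * pi * \<i> * of_nat n0 / of_nat m) ^ n = exp (2 * pi * \<i> * of_nat (n * n0 mod m) / of_nat m)"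
proof -
  have "exp (2 * pi * \<i> * of_nat n0 / of_nat m) ^ n = exp (2 * pi * \<i> * of_nat (n * n0) / of_nat m)"
    unfolding exp_of_nat_mult[symmetric] by (rule arg_cong[of _ _ exp]) simp
  also have "of_nat (n * n0) = (of_nat (n * n0 mod m) + of_nat m * of_nat (n * n0 div m) :: complex)"
    by (metis mod_mult_div_eq of_nat_add of_nat_mult)
  also have "2 * pi * \<i> * \<dots> / of_nat m = 2 * pi * \<i> * of_nat (n * n0 mod m) / of_nat m + 2 * of_nat (n * n0 div m) * pi * \<i>"
    using assms by (simp add: field_simps)
  also have "exp \<dots> = exp (2 * pi * \<i> * of_nat (n * n0 mod m) / of_nat m) * exp (2 * of_nat (n * n0 div m) * pi * \<i>)"
    by (rule exp_add)
  also have "exp (2 * of_nat (n * n0 div m) * pi * \<i>) = 1"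
    by (rule exp_integer_2pi) auto
  finally show ?thesis by simp
qed

lemma psi_seriesoeff_bound:
  assumes m: "m > 0" and g: "g holomorphic_on ball 0 R" and r: "0 < r" "r < R"
  shows "\<exists>D>0. \<exists>A>0. \<exists>y>0. y < 1 \<and> (\<forall>n p. norm (fps_nth (fps_expansion g 0) n *
     (apostol_coeff m (n * n0 mod m) p * of_nat n ^ p / of_nat n)) * r ^ n \<le> D * A ^ p * fact p * y ^ n)"
proof -
  obtain G x where G: "G > 0" "x > 0" "x < 1"
    "\<And>n. norm (fps_nth (fps_expansion g 0) n) * r ^ n \<le> G * x ^ n"
    using taylor_coeff_geometric_bound[OF g r] by metis
  obtain A y where A: "A > 0" "y > 0" "y < 1" "\<And>n N. real n ^ N * x ^ n \<le> fact N * A ^ N * y ^ n"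
    using power_times_geometric_le[OF G(2,3)] by metis
  obtain C where C: "C > 0" "\<And>j p. j < m \<Longrightarrow> norm (apostol_coeff m j p) \<le> C * real m ^ p"
    using apostol_coeff_bound[of m] by metis
  have "norm (fps_nth (fps_expansion g 0) n *
     (apostol_coeff m (n * n0 mod m) p * of_nat n ^ p / of_nat n)) * r ^ n \<le> (C * G) * (m * A) ^ p * fact p * y ^ n" for n p
  proof (cases "n = 0")
    \<comment> \<open>For n = 0 the division by \<open>of_nat 0\<close> yields 0, so the left-hand
      side vanishes.\<close>
    case True
    thus ?thesis using C G A by simp
  next
    case False
    have "norm (apostol_coeff m (n * n0 mod m) p) * real n ^ p / real n \<le> norm (apostol_coeff m (n * n0 mod m) p) * real n ^ p"
      using False by (intro divide_nat_le) auto
    also have "\<dots> \<le> C * real m ^ p * real n ^ p"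
      using C(2)[of "n * n0 mod m" p] m by (intro mult_right_mono) auto
    finally have "norm (apostol_coeff m (n * n0 mod m) p * of_nat n ^ p / of_nat n) \<le> C * real m ^ p * real n ^ p"
      by (simp add: norm_mult norm_divide norm_power)
    from mult_mono[OF G(4)[of n] this]
    have "(norm (fps_nth (fps_expansion g 0) n) * r ^ n) * norm (apostol_coeff m (n * n0 mod m) p * of_nat n ^ p / of_nat n)
        \<le> (G * x ^ n) * (C * real m ^ p * real n ^ p)"
      using G(1,2) by simp
    also have "\<dots> = C * G * real m ^ p * (real n ^ p * x ^ n)" by simp
    also have "\<dots> \<le> C * G * real m ^ p * (fact p * A ^ p * y ^ n)"
      using C G A by (intro mult_left_mono) auto
    finally show ?thesis by (simp add: norm_mult norm_divide norm_power power_mult_distrib mult_ac)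
  qed
  thus ?thesis using C G A m
    by (intro exI[of _ "C * G"] exI[of _ "m * A"] exI[of _ y] conjI) auto
qed

lemma psi_series_sums:
  assumes m: "m > 0" and g: "g holomorphic_on ball 0 R" and z: "norm z < R"
  shows "(\<lambda>n. fps_nth (fps_expansion g 0) (Suc n) *
     (apostol_coeff m (Suc n * n0 mod m) p * of_nat (Suc n) ^ p / of_nat (Suc n)) * z ^ Suc n) sums psi_series m n0 g p z"
proof -
  define r where "r = (norm z + R) / 2"
  have r: "0 < r" "r < R" "norm z \<le> r" using z norm_ge_zero[of z] by (auto simp: r_def simp del: norm_ge_zero)
  let ?a = "\<lambda>n. fps_nth (fps_expansion g 0) n * (apostol_coeff m (n * n0 mod m) p * of_nat n ^ p / of_nat n)"
  from psi_seriesoeff_bound[OF m g r(1,2), of n0] obtain D A y where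
    D: "y > 0" "y < 1" "\<And>n p. norm (fps_nth (fps_expansion g 0) n *
     (apostol_coeff m (n * n0 mod m) p * of_nat n ^ p / of_nat n)) * r ^ n \<le> D * A ^ p * fact p * y ^ n"
    by metis
  have "summable (\<lambda>n. ?a n * z ^ n)"
  proof (rule summable_comparison_test')
    show "summable (\<lambda>n. (D * A ^ p * fact p) * y ^ n)"
      using D by (intro summable_mult summable_geometric) auto
    fix n
    have "norm (?a n * z ^ n) \<le> norm (?a n) * r ^ n"
      unfolding norm_mult[of "?a n"] norm_power[of z] using r by (intro mult_left_mono power_mono) auto
    thus "norm (?a n * z ^ n) \<le> D * A ^ p * fact p * y ^ n" using D(3)[of n p] by linarith
  qed
  hence "summable (\<lambda>n. ?a (Suc n) * z ^ Suc n)" by (subst summable_Suc_iff)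
  thus ?thesis unfolding psi_series_def by (rule summable_sums)
qed

lemma psi_series_in_B_space:
  assumes m: "m > 0" and g: "g holomorphic_on ball 0 R" and r: "0 < r" "r < R"
  shows "psi_series m n0 g p \<in> B_space r"
proof -
  let ?a = "\<lambda>n. fps_nth (fps_expansion g 0) n * (apostol_coeff m (n * n0 mod m) p * of_nat n ^ p / of_nat n)"
  from psi_seriesoeff_bound[OF m g r(1,2), of n0] obtain D A y where
    D: "D > 0" "A > 0" "y > 0" "y < 1" "\<And>n p. norm (fps_nth (fps_expansion g 0) n *
     (apostol_coeff m (n * n0 mod m) p * of_nat n ^ p / of_nat n)) * r ^ n \<le> D * A ^ p * fact p * y ^ n"
    by metis
  \<comment> \<open>The sum is started at n = 0 to obtain a genuine power series; the added
    coefficient is 0 because of the division by zero in it.\<close>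
  have s: "(\<lambda>n. ?a n * (z - 0) ^ n) sums psi_series m n0 g p z" if "norm z < R" for z
    using psi_series_sums[OF m g that, of n0 p]
    by (subst (asm) sums_Suc_iff) simp
  have "psi_series m n0 g p holomorphic_on ball 0 r"
    by (rule power_series_holomorphic[of 0 r ?a]) (use s r in auto)
  moreover have "norm (psi_series m n0 g p z) \<le> (D * A ^ p * fact p) * (1 / (1 - y))" if "norm z < r" for z
  proof (rule norm_sums_le[OF s])
    show "(\<lambda>n. (D * A ^ p * fact p) * y ^ n) sums ((D * A ^ p * fact p) * (1 / (1 - y)))"
      using D by (intro sums_mult geometric_sums) auto
    fix n
    have "norm (?a n * (z - 0) ^ n) \<le> norm (?a n) * r ^ n"
      unfolding norm_mult[of "?a n"] norm_power diff_0_right using that by (intro mult_left_mono power_mono) auto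
    thus "norm (?a n * (z - 0) ^ n) \<le> D * A ^ p * fact p * y ^ n" using D(5)[of n p] by linarith
  qed (use that r in auto)
  hence "bounded (psi_series m n0 g p ` ball 0 r)"
    unfolding bounded_iff by (intro exI[of _ "(D * A ^ p * fact p) * (1 / (1 - y))"]) simp
  moreover have "psi_series m n0 g p 0 = 0" by (simp add: psi_series_def)
  ultimately show ?thesis by (simp add: B_space_def)
qed

lemma psi_series_gevrey:
  assumes m: "m > 0" and g: "g holomorphic_on ball 0 R"
  shows "gevrey_expansion (exp (2 * pi * \<i> * of_nat n0 / of_nat m)) g R (psi_series m n0 g)"
  unfolding gevrey_expansion_def
proof (intro allI impI conjI)
  fix r assume r: "0 < r \<and> r < R"
  thus "psi_series m n0 g p \<in> B_space r" for p by (intro psi_series_in_B_space[OF m g]) auto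
  define \<Lambda> where "\<Lambda> = exp (2 * pi * \<i> * of_nat n0 / of_nat m)"
  have n\<Lambda>: "norm \<Lambda> = 1" by (simp add: \<Lambda>_def)
  let ?a = "\<lambda>n. fps_nth (fps_expansion g 0) n"
  obtain G x where G: "G > 0" "x > 0" "x < 1" "\<And>n. norm (?a n) * r ^ n \<le> G * x ^ n"
    using taylor_coeff_geometric_bound[OF g] r by metis
  obtain B y where B: "B > 0" "y > 0" "y < 1" "\<And>n N. real n ^ N * x ^ n \<le> fact N * B ^ N * y ^ n"
    using power_times_geometric_le[OF G(2,3)] by metis
  obtain C A where C: "C > 0" "A > 0" and CA: "\<And>j n \<eta> N. j < m \<Longrightarrow> n \<ge> 1 \<Longrightarrow> \<eta> \<noteq> 0 \<Longrightarrow> norm \<eta> \<le> 1 \<Longrightarrow> norm \<eta> ^ 2 \<le> 8 * exp 2 * \<bar>Re \<eta>\<bar> \<Longrightarrow>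
     norm (\<eta> / (exp (2 * pi * \<i> * of_nat j / of_nat m) * exp (of_nat n * \<eta>) - 1)
            - (\<Sum>p<N. apostol_coeff m j p * of_nat n ^ p / of_nat n * \<eta> ^ p)) \<le> C * (A * (real n * norm \<eta>)) ^ N"
    by (rule monomial_remainder_bound[OF m, of "8 * exp 2"]) auto
  have bound: "norm (\<eta> * cohom_sol g (\<Lambda> * exp \<eta>) z - (\<Sum>p<N. psi_series m n0 g p z * \<eta> ^ p))
                \<le> (G * C / (1 - y)) * (A * B) ^ N * fact N * norm \<eta> ^ N"
    if eta: "\<eta> \<in> left_region \<Lambda> (1/4) \<union> right_region \<Lambda> (1/4)" and z: "z \<in> ball 0 r" for N \<eta> z
  proof -
    note re = region_estimates[OF n\<Lambda> eta]
    have q: "(\<Lambda> * exp \<eta>) ^ n = exp (2 * pi * \<i> * of_nat (n * n0 mod m) / of_nat m) * exp (of_nat n * \<eta>)" for n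
      unfolding \<Lambda>_def by (simp only: power_mult_distrib root_power_mod[OF m] exp_of_nat_mult)
    let ?rem = "\<lambda>N n. \<eta> / ((\<Lambda> * exp \<eta>) ^ n - 1) - (\<Sum>p<N. apostol_coeff m (n * n0 mod m) p * of_nat n ^ p / of_nat n * \<eta> ^ p)"
    have tb: "norm (?a n * z ^ n * ?rem N n) \<le> G * C * (A * B) ^ N * fact N * norm \<eta> ^ N * y ^ n" if n: "n \<ge> 1" for n N
    proof -
      have rb: "norm (?rem N n) \<le> C * (A * (real n * norm \<eta>)) ^ N"
        unfolding q using m by (intro CA re n) auto
      have "norm (?a n) * norm z ^ n \<le> norm (?a n) * r ^ n"
        using z by (intro mult_left_mono power_mono) auto
      hence "norm (?a n) * norm z ^ n \<le> G * x ^ n" using G(4)[of n] by linarith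
      from mult_mono[OF this rb]
      have "(norm (?a n) * norm z ^ n) * norm (?rem N n) \<le> (G * x ^ n) * (C * (A * (real n * norm \<eta>)) ^ N)"
        using G(1,2) by simp
      also have "\<dots> = G * C * A ^ N * norm \<eta> ^ N * (real n ^ N * x ^ n)" by (simp add: power_mult_distrib)
      also have "\<dots> \<le> G * C * A ^ N * norm \<eta> ^ N * (fact N * B ^ N * y ^ n)"
        using B C G by (intro mult_left_mono) auto
      finally show ?thesis by (simp add: norm_mult norm_power power_mult_distrib mult_ac)
    qed
    have geo: "(\<lambda>n. K * y ^ Suc n) sums (K * (y / (1 - y)))" for K
      using sums_mult[OF geometric_sums[of y], of "K * y"] B(2,3) by (simp add: mult_ac)
    \<comment> \<open>For N = 0 the remainder is the function itself, so the same bound yields the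
      convergence of the series behind \<open>cohom_sol\<close>, without which its
      \<open>suminf\<close> would carry no information.\<close>
    have "summable (\<lambda>n. ?a (Suc n) * z ^ Suc n * ?rem 0 (Suc n))"
      by (rule summable_comparison_test'[OF sums_summable[OF geo]], rule tb) simp
    hence sum0: "summable (\<lambda>n. \<eta> * (?a (Suc n) * z ^ Suc n / ((\<Lambda> * exp \<eta>) ^ Suc n - 1)))"
      by (simp add: mult_ac)
    have "summable (\<lambda>n. ?a (Suc n) * z ^ Suc n / ((\<Lambda> * exp \<eta>) ^ Suc n - 1))"
      using summable_mult[OF sum0, of "1 / \<eta>"] re(1) by simp
    hence "(\<lambda>n. \<eta> * (?a (Suc n) * z ^ Suc n / ((\<Lambda> * exp \<eta>) ^ Suc n - 1))) sums (\<eta> * cohom_sol g (\<Lambda> * exp \<eta>) z)"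
      unfolding cohom_sol_def by (intro sums_mult summable_sums)
    moreover have "(\<lambda>n. \<Sum>p<N. ?a (Suc n) * (apostol_coeff m (Suc n * n0 mod m) p * of_nat (Suc n) ^ p / of_nat (Suc n)) * z ^ Suc n * \<eta> ^ p)
        sums (\<Sum>p<N. psi_series m n0 g p z * \<eta> ^ p)"
      using z r by (intro sums_sum sums_mult2 psi_series_sums[OF m g]) auto
    ultimately have "(\<lambda>n. \<eta> * (?a (Suc n) * z ^ Suc n / ((\<Lambda> * exp \<eta>) ^ Suc n - 1)) -
         (\<Sum>p<N. ?a (Suc n) * (apostol_coeff m (Suc n * n0 mod m) p * of_nat (Suc n) ^ p / of_nat (Suc n)) * z ^ Suc n * \<eta> ^ p))
        sums (\<eta> * cohom_sol g (\<Lambda> * exp \<eta>) z - (\<Sum>p<N. psi_series m n0 g p z * \<eta> ^ p))" (is "?f sums ?S")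
      by (rule sums_diff)
    moreover have "?f = (\<lambda>n. ?a (Suc n) * z ^ Suc n * ?rem N (Suc n))"
      by (simp add: fun_eq_iff right_diff_distrib sum_distrib_left mult_ac del: power_Suc)
    ultimately have "(\<lambda>n. ?a (Suc n) * z ^ Suc n * ?rem N (Suc n)) sums ?S" by simp
    from norm_sums_le[OF this geo tb]
    have "norm ?S \<le> G * C * (A * B) ^ N * fact N * norm \<eta> ^ N * (y / (1 - y))" by simp
    also have "\<dots> \<le> G * C * (A * B) ^ N * fact N * norm \<eta> ^ N * (1 / (1 - y))"
      using B C G by (intro mult_left_mono divide_right_mono mult_nonneg_nonneg) auto
    finally show ?thesis by (simp add: mult_ac)
  qed
  show "\<exists>\<rho> c0 c1. 0 < \<rho> \<and> \<rho> < 1 \<and> c0 > 0 \<and> c1 > 0 \<and>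
           (\<forall>N. \<forall>\<eta> \<in> left_region (exp (2 * pi * \<i> * of_nat n0 / of_nat m)) \<rho> \<union> right_region (exp (2 * pi * \<i> * of_nat n0 / of_nat m)) \<rho>. \<forall>z \<in> ball 0 r.
              norm (\<eta> * cohom_sol g (exp (2 * pi * \<i> * of_nat n0 / of_nat m) * exp \<eta>) z - (\<Sum>p<N. psi_series m n0 g p z * \<eta> ^ p))
                \<le> c0 * c1 ^ N * fact N * norm \<eta> ^ N)"
    unfolding \<Lambda>_def[symmetric]
    by (intro exI[of _ "1/4"] exI[of _ "G * C / (1 - y)"] exI[of _ "A * B"] conjI allI ballI bound)
       (use B C G in auto)
qed

section \<open>Uniqueness of the asymptotic expansion\<close>

lemma gevrey_expansion_remainder:
  assumes "gevrey_expansion \<Lambda> g R c" "0 < r" "r < R"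
  obtains \<rho> c0 c1 where "0 < \<rho>" "\<rho> < 1" "c0 > 0" "c1 > 0"
    "\<And>N \<eta> z. \<eta> \<in> right_region \<Lambda> \<rho> \<Longrightarrow> z \<in> ball 0 r \<Longrightarrow>
       norm (\<eta> * cohom_sol g (\<Lambda> * exp \<eta>) z - (\<Sum>p<N. c p z * \<eta> ^ p)) \<le> c0 * c1 ^ N * fact N * norm \<eta> ^ N"
proof -
  have "\<exists>\<rho> c0 c1. 0 < \<rho> \<and> \<rho> < 1 \<and> c0 > 0 \<and> c1 > 0 \<and>
           (\<forall>N. \<forall>\<eta> \<in> left_region \<Lambda> \<rho> \<union> right_region \<Lambda> \<rho>. \<forall>z \<in> ball 0 r.
              norm (\<eta> * cohom_sol g (\<Lambda> * exp \<eta>) z - (\<Sum>p<N. c p z * \<eta> ^ p))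
                \<le> c0 * c1 ^ N * fact N * norm \<eta> ^ N)"
    using assms unfolding gevrey_expansion_def by simp
  then obtain \<rho> c0 c1 where "0 < \<rho>" "\<rho> < 1" "c0 > 0" "c1 > 0"
    and *: "\<forall>N. \<forall>\<eta> \<in> left_region \<Lambda> \<rho> \<union> right_region \<Lambda> \<rho>. \<forall>z \<in> ball 0 r.
              norm (\<eta> * cohom_sol g (\<Lambda> * exp \<eta>) z - (\<Sum>p<N. c p z * \<eta> ^ p))
                \<le> c0 * c1 ^ N * fact N * norm \<eta> ^ N" by (elim exE conjE)
  thus thesis by (intro that[of \<rho> c0 c1]) simp_all
qed

text \<open>\<open>Psi_coeff\<close> is an arbitrary choice among expansions, so its values are
  accessible only through uniqueness. Positive real \<eta> tending to 0 are enough as test points: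
  once the lower coefficients agree, the two remainders of order p + 1 give c p z - d p z =
  O(\<eta>).\<close>

lemma gevrey_expansion_unique:
  assumes \<Lambda>: "norm \<Lambda> = 1" and c: "gevrey_expansion \<Lambda> g R c" and d: "gevrey_expansion \<Lambda> g R d" and z: "norm z < R"
  shows "c p z = d p z"
proof -
  define r where "r = (norm z + R) / 2"
  have r: "0 < r" "r < R" "norm z < r" using z norm_ge_zero[of z] by (auto simp: r_def simp del: norm_ge_zero)
  from gevrey_expansion_remainder[OF c r(1,2)] obtain \<rho>1 a0 a1 where 1: "0 < \<rho>1" "\<rho>1 < 1" "a0 > 0" "a1 > 0"
    "\<And>N \<eta> z. \<eta> \<in> right_region \<Lambda> \<rho>1 \<Longrightarrow> z \<in> ball 0 r \<Longrightarrow>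
       norm (\<eta> * cohom_sol g (\<Lambda> * exp \<eta>) z - (\<Sum>p<N. c p z * \<eta> ^ p)) \<le> a0 * a1 ^ N * fact N * norm \<eta> ^ N"
    by blast
  from gevrey_expansion_remainder[OF d r(1,2)] obtain \<rho>2 b0 b1 where 2: "0 < \<rho>2" "\<rho>2 < 1" "b0 > 0" "b1 > 0"
    "\<And>N \<eta> z. \<eta> \<in> right_region \<Lambda> \<rho>2 \<Longrightarrow> z \<in> ball 0 r \<Longrightarrow>
       norm (\<eta> * cohom_sol g (\<Lambda> * exp \<eta>) z - (\<Sum>p<N. d p z * \<eta> ^ p)) \<le> b0 * b1 ^ N * fact N * norm \<eta> ^ N"
    by blast
  \<comment> \<open>Each of the two expansions comes with its own \<rho>; small positive reals lie
    in the right region for every \<rho>, namely as soon as exp t < 1 + 2\<rho>.\<close>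
  have region: "eventually (\<lambda>t. of_real t \<in> right_region \<Lambda> \<rho>) (at_right 0)" if "\<rho> > 0" for \<rho>
  proof -
    have "((\<lambda>t::real. exp t) \<longlongrightarrow> exp 0) (at_right 0)" by (intro tendsto_intros)
    hence "eventually (\<lambda>t::real. exp t < 1 + 2 * \<rho>) (at_right 0)"
      using that by (intro order_tendstoD(2)) auto
    moreover have "eventually (\<lambda>t::real. t > 0) (at_right 0)" by (simp add: eventually_at_right_less)
    ultimately show ?thesis
    proof eventually_elim
      case (elim t)
      have "dist (of_real (1 + \<rho>) * \<Lambda>) (\<Lambda> * exp (of_real t)) = norm (\<Lambda> * of_real (1 + \<rho> - exp t))"
        by (simp add: dist_norm algebra_simps exp_of_real)
      also have "\<dots> = \<bar>1 + \<rho> - exp t\<bar>" using \<Lambda> by (simp only: norm_mult norm_of_real) simp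
      also have "\<dots> < \<rho>" using elim by (simp add: abs_if)
      finally show ?case using pi_gt_zero by (simp add: right_region_def)
    qed
  qed
  show ?thesis
  proof (induction p rule: less_induct)
    case (less p)
    define K where "K = a0 * a1 ^ Suc p * fact (Suc p) + b0 * b1 ^ Suc p * fact (Suc p)"
    have "eventually (\<lambda>t. norm (c p z - d p z) \<le> K * t) (at_right 0)"
      using region[OF 1(1)] region[OF 2(1)] eventually_at_right_less[of "0::real"]
    proof eventually_elim
      case (elim t)
      let ?\<eta> = "of_real t :: complex"
      let ?f = "?\<eta> * cohom_sol g (\<Lambda> * exp ?\<eta>) z"
      have zr: "z \<in> ball 0 r" using r by simp
      have "(\<Sum>q<Suc p. d q z * ?\<eta> ^ q) = (\<Sum>q<p. c q z * ?\<eta> ^ q) + d p z * ?\<eta> ^ p"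
        using less by simp
      hence "(c p z - d p z) * ?\<eta> ^ p = (?f - (\<Sum>q<Suc p. d q z * ?\<eta> ^ q)) - (?f - (\<Sum>q<Suc p. c q z * ?\<eta> ^ q))"
        by (simp add: algebra_simps)
      also have "norm \<dots> \<le> b0 * b1 ^ Suc p * fact (Suc p) * norm ?\<eta> ^ Suc p + a0 * a1 ^ Suc p * fact (Suc p) * norm ?\<eta> ^ Suc p"
        by (rule order_trans[OF norm_triangle_ineq4 add_mono[OF 2(5)[OF elim(2) zr, of "Suc p"] 1(5)[OF elim(1) zr, of "Suc p"]]])
      also have "\<dots> = (K * t) * t ^ p" using elim(3) by (simp add: K_def algebra_simps)
      finally have "norm (c p z - d p z) * t ^ p \<le> (K * t) * t ^ p"
        using elim(3) by (simp add: norm_mult norm_power)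
      thus ?case using elim(3) by (simp only: mult_le_cancel_right_pos zero_less_power)
    qed
    moreover have "((\<lambda>t. K * t) \<longlongrightarrow> K * 0) (at_right 0)" by (intro tendsto_intros)
    ultimately have "norm (c p z - d p z) \<le> K * 0"
      by (intro tendsto_lowerbound[of "\<lambda>t. K * t"]) auto
    thus ?case by simp
  qed
qed

lemma Psi_coeff_eq:
  assumes "m > 0" and "g holomorphic_on ball 0 R" and "norm z < R"
  shows "Psi_coeff (exp (2 * pi * \<i> * of_nat n0 / of_nat m)) g R p z = psi_series m n0 g p z"
proof (rule gevrey_expansion_unique[OF _ _ _ assms(3)])
  show "gevrey_expansion (exp (2 * pi * \<i> * of_nat n0 / of_nat m)) g R (Psi_coeff (exp (2 * pi * \<i> * of_nat n0 / of_nat m)) g R)"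
    unfolding Psi_coeff_def by (rule someI[of _ "psi_series m n0 g"], rule psi_series_gevrey[OF assms(1,2)])
  show "gevrey_expansion (exp (2 * pi * \<i> * of_nat n0 / of_nat m)) g R (psi_series m n0 g)"
    by (rule psi_series_gevrey[OF assms(1,2)])
qed simp

section \<open>The Borel transform as a Fourier series\<close>

lemma inverse_squares_int_summable: "(\<lambda>a::int. 1 / real_of_int a ^ 2) summable_on (-{0})"
proof -
  have s: "(\<lambda>n::nat. 1 / (real n + 1) ^ 2) summable_on UNIV"
    using inverse_squares_sums by (subst summable_on_UNIV_nonneg_real_iff) (auto simp: sums_iff add_ac)
  have 1: "(\<lambda>a::int. 1 / real_of_int a ^ 2) summable_on range (\<lambda>n::nat. int n + 1)"
    by (subst summable_on_reindex) (use s in \<open>auto simp: inj_on_def o_def\<close>)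
  have "real_of_int (- (int n) - 1) ^ 2 = (real n + 1) ^ 2" for n
    by (simp add: power2_eq_square algebra_simps)
  hence 2: "(\<lambda>a::int. 1 / real_of_int a ^ 2) summable_on range (\<lambda>n::nat. - (int n) - 1)"
    by (subst summable_on_reindex) (use s in \<open>auto simp: inj_on_def o_def\<close>)
  have "a \<in> range (\<lambda>n::nat. int n + 1) \<union> range (\<lambda>n::nat. - (int n) - 1)" if "a \<noteq> 0" for a :: int
  proof (cases "a > 0")
    case True
    hence "a = int (nat (a - 1)) + 1" by simp
    thus ?thesis by blast
  next
    case False
    hence "a = - int (nat (- a - 1)) - 1" using that by simp
    thus ?thesis by blast
  qed
  hence "(-{0}) \<subseteq> range (\<lambda>n::nat. int n + 1) \<union> range (\<lambda>n::nat. - (int n) - 1)" by auto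
  moreover have "range (\<lambda>n::nat. int n + 1) \<inter> range (\<lambda>n::nat. - (int n) - 1) = {}" by auto
  ultimately show ?thesis
    using summable_on_Un_disjoint[OF 1 2] summable_on_subset_banach by blast
qed

lemma abs_summable_product_comparison:
  fixes f :: "'a \<times> 'b \<Rightarrow> complex" and u :: "'a \<Rightarrow> real" and v :: "'b \<Rightarrow> real"
  assumes "u summable_on A" "v summable_on B" "\<And>x. x \<in> A \<Longrightarrow> u x \<ge> 0" "\<And>y. y \<in> B \<Longrightarrow> v y \<ge> 0"
    and "\<And>x y. x \<in> A \<Longrightarrow> y \<in> B \<Longrightarrow> norm (f (x, y)) \<le> u x * v y"
  shows "f summable_on A \<times> B"
proof -
  have "(\<lambda>(x, y). u x * v y) summable_on A \<times> B"
  proof (rule summable_on_SigmaI)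
    show "((\<lambda>y. case (x, y) of (x, y) \<Rightarrow> u x * v y) has_sum u x * infsum v B) B" for x
      using has_sum_infsum[OF assms(2)] by (simp add: has_sum_cmult_right)
    show "(\<lambda>x. u x * infsum v B) summable_on A" by (intro summable_on_cmult_left assms)
  qed (use assms in auto)
  from Infinite_Sum.abs_summable_on_comparison_test'[OF this, of f] have "(\<lambda>x. norm (f x)) summable_on A \<times> B"
    using assms(5) by auto
  thus ?thesis by (rule abs_summable_summable)
qed

lemma taylor_norm_summable:
  assumes "g holomorphic_on ball 0 R" "norm w < R"
  shows "summable (\<lambda>n. norm (fps_nth (fps_expansion g 0) n * w ^ n))"
proof -
  define r where "r = (norm w + R) / 2"
  have r: "0 < r" "r < R" "norm w < r" using assms(2) norm_ge_zero[of w] by (auto simp: r_def simp del: norm_ge_zero)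
  obtain G x where G: "x > 0" "x < 1" "\<And>n. norm (fps_nth (fps_expansion g 0) n) * r ^ n \<le> G * x ^ n"
    using taylor_coeff_geometric_bound[OF assms(1) r(1,2)] by metis
  show ?thesis
  proof (rule summable_comparison_test')
    show "summable (\<lambda>n. G * x ^ n)" using G by (intro summable_mult summable_geometric) auto
    fix n
    have "norm (fps_nth (fps_expansion g 0) n) * norm w ^ n \<le> norm (fps_nth (fps_expansion g 0) n) * r ^ n"
      using r by (intro mult_left_mono power_mono) auto
    also have "\<dots> \<le> G * x ^ n" by (rule G)
    finally show "norm (norm (fps_nth (fps_expansion g 0) n * w ^ n)) \<le> G * x ^ n"
      by (simp add: norm_mult norm_power)
  qed
qed

lemma taylor_has_sum:
  assumes "g holomorphic_on ball 0 R" "norm w < R"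
  shows "((\<lambda>n. fps_nth (fps_expansion g 0) n * w ^ n) has_sum g w) UNIV"
proof (rule norm_summable_imp_has_sum[OF taylor_norm_summable[OF assms]])
  show "(\<lambda>n. fps_nth (fps_expansion g 0) n * w ^ n) sums g w"
    using holomorphic_power_series[OF assms(1), of w] assms(2) by (simp add: fps_expansion_def)
qed

lemma exp_minus_1_has_sum:
  fixes x :: "'a :: {banach, real_normed_field}"
  shows "((\<lambda>q. x ^ Suc q / fact (Suc q)) has_sum (exp x - 1)) UNIV"
proof (rule norm_summable_imp_has_sum)
  have "(\<lambda>q. x ^ q / fact q) sums exp x"
    using exp_converges[of x] by (simp add: scaleR_conv_of_real divide_inverse mult.commute)
  thus "(\<lambda>q. x ^ Suc q / fact (Suc q)) sums (exp x - 1)"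
    by (subst sums_Suc_iff) simp
  have "summable (\<lambda>q. norm x ^ q / fact q)"
    using summable_exp[of "norm x"] by (simp add: divide_inverse mult.commute)
  hence "summable (\<lambda>q. norm x ^ Suc q / fact (Suc q))" by (subst summable_Suc_iff)
  thus "summable (\<lambda>q. norm (x ^ Suc q / fact (Suc q)))"
    by (simp add: norm_divide norm_mult norm_power del: fact_Suc)
qed

text \<open>Summed over q first, the terms give \<bar>g_n\<bar> \<bar>z\<bar>^n (exp (nK) - 1),
  which is dominated by the Taylor series of absolute values at \<bar>z\<bar> exp K. This is where
  the smallness condition on z and \<xi> comes from.\<close>

lemma borel_majorant_summable:
  fixes z :: complex
  assumes g: "g holomorphic_on ball 0 R" and K: "K \<ge> 0" and z: "norm z * exp K < R"
  shows "(\<lambda>(q, n). norm (fps_nth (fps_expansion g 0) n) * norm z ^ n * ((real n * K) ^ Suc q / fact (Suc q)))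
           summable_on UNIV \<times> UNIV"
proof -
  let ?a = "\<lambda>n. norm (fps_nth (fps_expansion g 0) n)"
  have "(\<lambda>(n, q). ?a n * norm z ^ n * ((real n * K) ^ Suc q / fact (Suc q))) summable_on UNIV \<times> UNIV"
  proof (rule summable_on_SigmaI)
    fix n :: nat
    show "((\<lambda>q. case (n, q) of (n, q) \<Rightarrow> ?a n * norm z ^ n * ((real n * K) ^ Suc q / fact (Suc q))) has_sum
            ?a n * norm z ^ n * (exp (real n * K) - 1)) UNIV"
      by (simp only: prod.case) (intro has_sum_cmult_right exp_minus_1_has_sum)
  next
    have "norm (z * of_real (exp K)) < R" using z by (simp add: norm_mult)
    from taylor_norm_summable[OF g this]
    have "summable (\<lambda>n. ?a n * (norm z * exp K) ^ n)" by (simp add: norm_mult norm_power)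
    hence "(\<lambda>n. ?a n * (norm z * exp K) ^ n) summable_on UNIV"
      by (subst summable_on_UNIV_nonneg_real_iff) auto
    thus "(\<lambda>n. ?a n * norm z ^ n * (exp (real n * K) - 1)) summable_on UNIV"
    proof (rule summable_on_comparison_test)
      fix n
      have "?a n * norm z ^ n * (exp (real n * K) - 1) \<le> ?a n * norm z ^ n * exp (real n * K)"
        by (intro mult_left_mono) auto
      thus "?a n * norm z ^ n * (exp (real n * K) - 1) \<le> ?a n * (norm z * exp K) ^ n"
        by (simp add: power_mult_distrib exp_of_nat_mult mult.assoc)
      show "0 \<le> ?a n * norm z ^ n * (exp (real n * K) - 1)" using K by simp
    qed
  qed (use K in auto)
  thus ?thesis by (subst summable_on_swap) (simp add: case_prod_unfold)
qed

lemma has_sum_finite_sum: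
  fixes f :: "'i \<Rightarrow> 'a \<Rightarrow> 'b::topological_comm_monoid_add"
  assumes "\<And>i. i \<in> I \<Longrightarrow> (f i has_sum s i) A"
  shows "((\<lambda>x. \<Sum>i\<in>I. f i x) has_sum (\<Sum>i\<in>I. s i)) A"
  using assms by (induction I rule: infinite_finite_induct) (auto intro!: has_sum_add)

definition fourier_coeff :: "nat \<Rightarrow> nat \<Rightarrow> int \<Rightarrow> complex" where
  "fourier_coeff m k a = exp (2 * pi * \<i> * of_nat k * of_int a / of_nat m) / (2 * pi * \<i> * of_int a)"

lemma norm_fourier_coeff: "norm (fourier_coeff m k a) = 1 / (2 * pi * \<bar>real_of_int a\<bar>)"
proof -
  have "norm (exp (2 * pi * \<i> * of_nat k * of_int a / of_nat m)) = 1"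
    by (simp add: norm_exp_eq_Re)
  thus ?thesis by (simp only: fourier_coeff_def norm_divide norm_mult norm_of_real norm_ii norm_of_int) simp
qed

lemma norm_fourier_coeff_le:
  assumes "a \<noteq> 0"
  shows "norm (fourier_coeff m k a) \<le> 1 / \<bar>real_of_int a\<bar>"
proof -
  have "1 \<le> 2 * pi" using pi_ge_two by linarith
  hence "1 * \<bar>real_of_int a\<bar> \<le> 2 * pi * \<bar>real_of_int a\<bar>" by (intro mult_right_mono) auto
  thus ?thesis unfolding norm_fourier_coeff using assms by (intro divide_left_mono) auto
qed

lemma borel_term_eq:
  "borel_term m \<Lambda> g k \<xi> z a =
     fourier_coeff m k a * (g (\<Lambda> ^ k * z * exp (of_nat m * \<xi> / (2 * pi * \<i> * of_int a))) - g (\<Lambda> ^ k * z))"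
  by (simp add: borel_term_def fourier_coeff_def)

lemma norm_borel_exponent:
  "norm (of_nat m * \<xi> / (2 * pi * \<i> * of_int a)) = real m * norm \<xi> / (2 * pi) / \<bar>real_of_int a\<bar>"
  by (simp add: norm_divide norm_mult)

text \<open>The Fourier coefficient contributes one factor 1/\<bar>a\<bar>, and the power
  \<open>Suc q\<close> of the exponent at least another one. The powers start at 1 because the value
  of g at the unshifted point is subtracted; without this only 1/\<bar>a\<bar> would remain.\<close>

lemma borel_term_triple_norm:
  assumes "a \<noteq> 0" "norm \<Lambda> = 1"
  shows "norm (fourier_coeff m k a * (A * (\<Lambda> ^ k * z) ^ n *
            ((of_nat n * (of_nat m * \<xi> / (2 * pi * \<i> * of_int a))) ^ Suc q / fact (Suc q))))
         \<le> 1 / real_of_int a ^ 2 * (norm A * norm z ^ n * ((real n * (real m * norm \<xi> / (2 * pi))) ^ Suc q / fact (Suc q)))"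
proof -
  define K where "K = real m * norm \<xi> / (2 * pi)"
  have K: "K \<ge> 0" by (simp add: K_def)
  have a1: "\<bar>real_of_int a\<bar> \<ge> 1" using assms by linarith
  have "norm (fourier_coeff m k a * (A * (\<Lambda> ^ k * z) ^ n *
            ((of_nat n * (of_nat m * \<xi> / (2 * pi * \<i> * of_int a))) ^ Suc q / fact (Suc q))))
      = norm (fourier_coeff m k a) * (norm A * norm z ^ n * ((real n * (K / \<bar>real_of_int a\<bar>)) ^ Suc q / fact (Suc q)))"
    using assms(2) by (simp only: norm_mult norm_divide[of _ "fact (Suc q)"] norm_power norm_borel_exponent K_def norm_fact) simp
  also have "\<dots> \<le> 1 / \<bar>real_of_int a\<bar> * (norm A * norm z ^ n * ((real n * K) ^ Suc q / \<bar>real_of_int a\<bar> / fact (Suc q)))"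
  proof (intro mult_mono norm_fourier_coeff_le[OF assms(1)] mult_left_mono divide_right_mono)
    have "(real n * (K / \<bar>real_of_int a\<bar>)) ^ Suc q = (real n * K) ^ Suc q / \<bar>real_of_int a\<bar> ^ Suc q"
      by (simp add: power_divide)
    also have "\<dots> \<le> (real n * K) ^ Suc q / \<bar>real_of_int a\<bar> ^ 1"
      using a1 K by (intro divide_left_mono power_increasing mult_pos_pos zero_less_power) auto
    finally show "(real n * (K / \<bar>real_of_int a\<bar>)) ^ Suc q \<le> (real n * K) ^ Suc q / \<bar>real_of_int a\<bar>" by simp
  qed (use K in auto)
  also have "\<dots> = 1 / (\<bar>real_of_int a\<bar> * \<bar>real_of_int a\<bar>) * (norm A * norm z ^ n * ((real n * K) ^ Suc q / fact (Suc q)))"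
    by simp
  finally show ?thesis unfolding K_def by (simp only: abs_mult_self_eq power2_eq_square)
qed

text \<open>One absolutely summable family, indexed by the pole a, the power q of \<xi> and the
  Taylor index n, is summed in two ways. With (q, n) inside it gives the terms
  \<open>borel_term\<close>; with a inside it gives the Taylor coefficients of
  \<open>cot_kernel\<close>, which then rebuild the Borel series.\<close>

lemma Borel_sums_formula:
  fixes m n0 :: nat and \<xi> z :: complex
  defines "\<Lambda> \<equiv> exp (2 * pi * \<i> * of_nat n0 / of_nat m)"
  assumes m: "m > 0" and g: "g holomorphic_on ball 0 R" "g 0 = 0"
    and z: "norm z * exp (real m * norm \<xi> / (2 * pi)) < R"
  shows "k < m \<Longrightarrow> borel_term m \<Lambda> g k \<xi> z summable_on (-{0})"
    and "Borel_sums \<Lambda> g R \<xi> z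
           ((\<Sum>k<m. (of_nat k / of_nat m - 1 / 2) * g (\<Lambda> ^ k * z))
             - (\<Sum>k<m. \<Sum>\<^sub>\<infinity>a\<in>- {0}. borel_term m \<Lambda> g k \<xi> z a))"
proof -
  define K where "K = real m * norm \<xi> / (2 * pi)"
  have K: "K \<ge> 0" by (simp add: K_def)
  have n\<Lambda>: "norm \<Lambda> = 1" by (simp add: \<Lambda>_def)
  have zR: "norm z < R"
  proof -
    have "norm z * 1 \<le> norm z * exp K" using K by (intro mult_left_mono) auto
    thus ?thesis using z by (simp add: K_def)
  qed
  define c where "c n = fps_nth (fps_expansion g 0) n" for n
  define X where "X a = of_nat m * \<xi> / (2 * pi * \<i> * of_int a)" for a :: int
  define T where "T k = (\<lambda>(a, q, n). fourier_coeff m k a * (c n * (\<Lambda> ^ k * z) ^ n * ((of_nat n * X a) ^ Suc q / fact (Suc q))))" for k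
  define V where "V = (\<lambda>(q, n). norm (c n) * norm z ^ n * ((real n * K) ^ Suc q / fact (Suc q)))"
  have V: "V summable_on UNIV \<times> UNIV" "V x \<ge> 0" for x
    using borel_majorant_summable[OF g(1) K] z K by (auto simp: V_def c_def K_def case_prod_unfold)
  have Tb: "norm (T k (a, y)) \<le> 1 / real_of_int a ^ 2 * V y" if "a \<noteq> 0" for k a y
    using borel_term_triple_norm[OF that n\<Lambda>] unfolding T_def V_def X_def K_def by (simp only: case_prod_unfold fst_conv snd_conv)
  have Tsum: "T k summable_on (-{0}) \<times> (UNIV \<times> UNIV)" for k
    by (rule abs_summable_product_comparison[OF inverse_squares_int_summable V(1)]) (use V(2) Tb in auto)
  \<comment> \<open>At fixed a, the sum over q is exp (n X a) - 1, and the sum over n is then the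
    difference of two Taylor series of g. As \<bar>a\<bar> \<ge> 1 gives \<bar>X a\<bar> \<le> K,
    the shifted point stays in the disk of radius R.\<close>
  have slice: "((\<lambda>y. T k (a, y)) has_sum borel_term m \<Lambda> g k \<xi> z a) (UNIV \<times> UNIV)" if a: "a \<noteq> 0" for k a
  proof -
    define w where "w = \<Lambda> ^ k * z"
    have nw: "norm w = norm z" by (simp add: w_def norm_mult norm_power n\<Lambda>)
    have w1: "norm w < R" using nw zR by simp
    have "norm (exp (X a)) \<le> exp (norm (X a))" by (rule norm_exp)
    also have "norm (X a) = K / \<bar>real_of_int a\<bar>" unfolding X_def norm_borel_exponent K_def ..
    also have "exp \<dots> \<le> exp (K / 1)"
    proof -
      have "\<bar>real_of_int a\<bar> \<ge> 1" using a by linarith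
      thus ?thesis unfolding exp_le_cancel_iff using K by (intro divide_left_mono) auto
    qed
    finally have "norm (w * exp (X a)) \<le> norm z * exp K"
      unfolding norm_mult nw by (intro mult_left_mono) auto
    hence w2: "norm (w * exp (X a)) < R" using z by (simp add: K_def)
    have "T k summable_on {a} \<times> (UNIV \<times> UNIV)" by (rule summable_on_subset_banach[OF Tsum]) (use a in auto)
    hence "(\<lambda>y. T k (a, y)) summable_on UNIV \<times> UNIV"
      using summable_on_SigmaD1[of "\<lambda>x y. T k (x, y)" "{a}" "\<lambda>_. UNIV \<times> UNIV" a] by simp
    hence "(\<lambda>(n, q). T k (a, q, n)) summable_on UNIV \<times> UNIV" by (subst summable_on_swap) (simp add: case_prod_unfold)
    moreover have "((\<lambda>q. case (n, q) of (n, q) \<Rightarrow> T k (a, q, n)) has_sum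
            fourier_coeff m k a * (c n * w ^ n * (exp (of_nat n * X a) - 1))) UNIV" for n
      unfolding T_def w_def prod.case by (intro has_sum_cmult_right exp_minus_1_has_sum)
    moreover have "((\<lambda>n. fourier_coeff m k a * (c n * w ^ n * (exp (of_nat n * X a) - 1))) has_sum
            fourier_coeff m k a * (g (w * exp (X a)) - g w)) UNIV"
    proof (intro has_sum_cmult_right)
      have "((\<lambda>n. - (c n * w ^ n)) has_sum - g w) UNIV"
        unfolding c_def by (subst has_sum_uminus) (use taylor_has_sum[OF g(1) w1] in simp)
      hence "((\<lambda>n. c n * (w * exp (X a)) ^ n + - (c n * w ^ n)) has_sum (g (w * exp (X a)) + - g w)) UNIV"
        unfolding c_def by (intro has_sum_add taylor_has_sum[OF g(1)] w2)
      thus "((\<lambda>n. c n * w ^ n * (exp (of_nat n * X a) - 1)) has_sum (g (w * exp (X a)) - g w)) UNIV"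
        by (simp add: power_mult_distrib exp_of_nat_mult algebra_simps)
    qed
    ultimately have "((\<lambda>(n, q). T k (a, q, n)) has_sum fourier_coeff m k a * (g (w * exp (X a)) - g w)) (UNIV \<times> UNIV)"
      by (intro has_sum_SigmaI) auto
    hence "((\<lambda>y. T k (a, y)) has_sum fourier_coeff m k a * (g (w * exp (X a)) - g w)) (UNIV \<times> UNIV)"
      by (subst has_sum_swap) (simp add: case_prod_unfold)
    thus ?thesis by (simp add: borel_term_eq w_def X_def)
  qed
  have bt: "(borel_term m \<Lambda> g k \<xi> z has_sum infsum (T k) ((-{0}) \<times> (UNIV \<times> UNIV))) (-{0})" for k
    by (rule has_sum_SigmaD[OF has_sum_infsum[OF Tsum] slice]) auto
  thus "borel_term m \<Lambda> g k \<xi> z summable_on (-{0})" if "k < m"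
    by (auto simp: summable_on_def)
  define S where "S = (\<Sum>k<m. \<Sum>\<^sub>\<infinity>a\<in>- {0}. borel_term m \<Lambda> g k \<xi> z a)"
  have "((\<lambda>x. \<Sum>k<m. T k x) has_sum (\<Sum>k<m. infsum (T k) ((-{0}) \<times> (UNIV \<times> UNIV)))) ((-{0}) \<times> (UNIV \<times> UNIV))"
    by (intro has_sum_finite_sum has_sum_infsum Tsum)
  also have "(\<Sum>k<m. infsum (T k) ((-{0}) \<times> (UNIV \<times> UNIV))) = S"
    unfolding S_def using bt by (intro sum.cong refl infsumI[symmetric])
  finally have "((\<lambda>(y, a). \<Sum>k<m. T k (a, y)) has_sum S) ((UNIV \<times> UNIV) \<times> (-{0}))"
    by (subst (asm) has_sum_swap) (simp add: case_prod_unfold)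
  \<comment> \<open>The value of the sum over k and a at fixed (q, n), as given by the Fourier
    representation of the coefficient of order q + 1 of \<open>cot_kernel\<close>.\<close>
  moreover define W where "W = (\<lambda>(q, n). - (c n * cot_kernel_coeff m (n * n0 mod m) (Suc q) * of_nat n ^ Suc q * z ^ n) * (\<xi> ^ Suc q / fact (Suc q)))"
  have "((\<lambda>a. case (y, a) of (y, a) \<Rightarrow> \<Sum>k<m. T k (a, y)) has_sum W y) (-{0})" if "y \<in> UNIV \<times> UNIV" for y
  proof -
    obtain q n where y: "y = (q, n)" by (cases y)
    have "((\<lambda>a. c n * of_nat n ^ Suc q * z ^ n * (\<xi> ^ Suc q / fact (Suc q)) * (\<Sum>k<m. exp (2 * pi * \<i> * of_nat (n * n0 mod m) / of_nat m) ^ k *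
            (exp (2 * pi * \<i> * of_nat k * of_int a / of_nat m) / (2 * pi * \<i> * of_int a) *
               (of_nat m / (2 * pi * \<i> * of_int a)) ^ Suc q))) has_sum
             c n * of_nat n ^ Suc q * z ^ n * (\<xi> ^ Suc q / fact (Suc q)) * (- cot_kernel_coeff m (n * n0 mod m) (Suc q))) (-{0})"
      using m by (intro has_sum_cmult_right cot_kernel_coeff_Fourier) auto
    also have "c n * of_nat n ^ Suc q * z ^ n * (\<xi> ^ Suc q / fact (Suc q)) * (- cot_kernel_coeff m (n * n0 mod m) (Suc q)) = W y"
      by (simp add: W_def y)
    also have "(\<lambda>a. c n * of_nat n ^ Suc q * z ^ n * (\<xi> ^ Suc q / fact (Suc q)) * (\<Sum>k<m. exp (2 * pi * \<i> * of_nat (n * n0 mod m) / of_nat m) ^ k *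
            (exp (2 * pi * \<i> * of_nat k * of_int a / of_nat m) / (2 * pi * \<i> * of_int a) *
               (of_nat m / (2 * pi * \<i> * of_int a)) ^ Suc q))) = (\<lambda>a. \<Sum>k<m. T k (a, y))"
    proof (intro ext, unfold sum_distrib_left, intro sum.cong refl, goal_cases)
      case (1 a k)
      have "(of_nat n * X a) ^ Suc q = of_nat n ^ Suc q * \<xi> ^ Suc q * (of_nat m / (2 * pi * \<i> * of_int a)) ^ Suc q"
        unfolding power_mult_distrib[symmetric] X_def by (simp add: mult_ac)
      moreover have "(\<Lambda> ^ k * z) ^ n = exp (2 * pi * \<i> * of_nat (n * n0 mod m) / of_nat m) ^ k * z ^ n"
        unfolding root_power_mod[OF m, symmetric] \<Lambda>_def by (simp only: power_mult_distrib power_mult[symmetric] mult.commute)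
      ultimately show ?case
        unfolding T_def y prod.case fourier_coeff_def by (simp only:) (simp only: divide_inverse mult_ac)
    qed
    finally show ?thesis by simp
  qed
  ultimately have "(W has_sum S) (UNIV \<times> UNIV)"
    by (rule has_sum_SigmaD)
  \<comment> \<open>The power \<xi>^(q+1) goes with \<open>psi_series\<close> at q + 2, since the
    Borel transform drops the coefficient of order 0. This matches \<open>W\<close>, because
    \<open>apostol_coeff\<close> at q + 2 is \<open>cot_kernel_coeff\<close> at q + 1 and n^(q+2)/n
    = n^(q+1).\<close>
  moreover have "((\<lambda>n. W (q, n)) has_sum - (psi_series m n0 g (Suc (Suc q)) z * \<xi> ^ Suc q / fact (Suc q))) UNIV" for q
  proof -
    have "(\<lambda>(q, n). W (q, n)) summable_on UNIV \<times> UNIV" using calculation by (auto simp: summable_on_def)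
    hence s: "(\<lambda>n. W (q, n)) summable_on UNIV"
      using summable_on_SigmaD1[of "\<lambda>q n. W (q, n)" UNIV "\<lambda>_. UNIV" q] by simp
    have "(\<lambda>n. - (fps_nth (fps_expansion g 0) (Suc n) *
     (apostol_coeff m (Suc n * n0 mod m) (Suc (Suc q)) * of_nat (Suc n) ^ (Suc (Suc q)) / of_nat (Suc n)) * z ^ Suc n) * (\<xi> ^ Suc q / fact (Suc q)))
       sums (- psi_series m n0 g (Suc (Suc q)) z * (\<xi> ^ Suc q / fact (Suc q)))"
      by (intro sums_mult2 sums_minus psi_series_sums[OF m g(1) zR])
    also have "(\<lambda>n. - (fps_nth (fps_expansion g 0) (Suc n) *
     (apostol_coeff m (Suc n * n0 mod m) (Suc (Suc q)) * of_nat (Suc n) ^ (Suc (Suc q)) / of_nat (Suc n)) * z ^ Suc n) * (\<xi> ^ Suc q / fact (Suc q)))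
       = (\<lambda>n. W (q, Suc n))"
    proof
      fix n
      have "x * (of_nat (Suc n) :: complex) ^ Suc (Suc q) / of_nat (Suc n) = x * of_nat (Suc n) ^ Suc q" for x
        by (simp del: of_nat_Suc)
      thus "- (fps_nth (fps_expansion g 0) (Suc n) *
     (apostol_coeff m (Suc n * n0 mod m) (Suc (Suc q)) * of_nat (Suc n) ^ (Suc (Suc q)) / of_nat (Suc n)) * z ^ Suc n) * (\<xi> ^ Suc q / fact (Suc q))
       = W (q, Suc n)"
        unfolding W_def c_def prod.case by (simp only: apostol_coeff_def nat.simps if_False diff_Suc_1) (simp only: mult_ac)
    qed
    finally have "(\<lambda>n. W (q, n)) sums (- psi_series m n0 g (Suc (Suc q)) z * (\<xi> ^ Suc q / fact (Suc q)) + W (q, 0))"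
      by (subst (asm) sums_Suc_iff) (simp add: add_ac)
    moreover have "W (q, 0) = 0" by (simp add: W_def)
    ultimately have "(\<lambda>n. W (q, n)) sums (- (psi_series m n0 g (Suc (Suc q)) z * \<xi> ^ Suc q / fact (Suc q)))" by simp
    with s show ?thesis
      by (metis has_sum_imp_sums has_sum_infsum sums_unique2)
  qed
  ultimately have "((\<lambda>q. - (psi_series m n0 g (Suc (Suc q)) z * \<xi> ^ Suc q / fact (Suc q))) has_sum S) UNIV"
    by (rule has_sum_SigmaD)
  hence "(\<lambda>q. - (psi_series m n0 g (Suc (Suc q)) z * \<xi> ^ Suc q / fact (Suc q))) sums S" by (rule has_sum_imp_sums)
  from sums_minus[OF this]
  have "(\<lambda>q. psi_series m n0 g (Suc (Suc q)) z * \<xi> ^ Suc q / fact (Suc q)) sums (- S)" by simp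
  hence "(\<lambda>q. psi_series m n0 g (Suc q) z * \<xi> ^ q / fact q) sums (- S + psi_series m n0 g (Suc 0) z)"
    by (subst (asm) sums_Suc_iff) simp
  \<comment> \<open>The term constant in \<xi> is the one that the triple sum leaves out. Its
    coefficients are finite Fourier sums, and summing over n reassembles g(\<Lambda>^k z); g 0 = 0
    accounts for the missing index n = 0.\<close>
  moreover have "psi_series m n0 g (Suc 0) z = (\<Sum>k<m. (of_nat k / of_nat m - 1 / 2) * g (\<Lambda> ^ k * z))"
  proof -
    have "(\<lambda>n. \<Sum>k<m. (of_nat k / of_nat m - 1 / 2) * (c n * (\<Lambda> ^ k * z) ^ n)) sums (\<Sum>k<m. (of_nat k / of_nat m - 1 / 2) * g (\<Lambda> ^ k * z))"
      unfolding c_def using zR n\<Lambda>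
      by (intro sums_sum sums_mult has_sum_imp_sums[OF taylor_has_sum[OF g(1)]]) (simp add: norm_mult norm_power)
    moreover have c0: "c 0 = 0" using g(2) by (simp add: c_def fps_expansion_def)
    ultimately have "(\<lambda>n. \<Sum>k<m. (of_nat k / of_nat m - 1 / 2) * (c (Suc n) * (\<Lambda> ^ k * z) ^ Suc n)) sums (\<Sum>k<m. (of_nat k / of_nat m - 1 / 2) * g (\<Lambda> ^ k * z))"
      by (subst sums_Suc_iff) simp
    also have "(\<lambda>n. \<Sum>k<m. (of_nat k / of_nat m - 1 / 2) * (c (Suc n) * (\<Lambda> ^ k * z) ^ Suc n)) =
        (\<lambda>n. fps_nth (fps_expansion g 0) (Suc n) *
           (apostol_coeff m (Suc n * n0 mod m) (Suc 0) * of_nat (Suc n) ^ (Suc 0) / of_nat (Suc n)) * z ^ Suc n)"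
    proof
      fix n
      have L: "(\<Lambda> ^ k * z) ^ Suc n = exp (2 * pi * \<i> * of_nat (Suc n * n0 mod m) / of_nat m) ^ k * z ^ Suc n" for k
        unfolding root_power_mod[OF m, symmetric] \<Lambda>_def by (simp only: power_mult_distrib power_mult[symmetric] mult.commute)
      have "apostol_coeff m (Suc n * n0 mod m) (Suc 0) * of_nat (Suc n) ^ (Suc 0) / of_nat (Suc n) = cot_kernel_coeff m (Suc n * n0 mod m) 0"
        by (simp add: apostol_coeff_def del: of_nat_Suc)
      also have "\<dots> = (\<Sum>k<m. (of_nat k / of_nat m - 1 / 2) * exp (2 * pi * \<i> * of_nat (Suc n * n0 mod m) / of_nat m) ^ k)"
        using m by (intro cot_kernel_coeff_0) auto
      finally show "(\<Sum>k<m. (of_nat k / of_nat m - 1 / 2) * (c (Suc n) * (\<Lambda> ^ k * z) ^ Suc n)) =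
        fps_nth (fps_expansion g 0) (Suc n) *
           (apostol_coeff m (Suc n * n0 mod m) (Suc 0) * of_nat (Suc n) ^ (Suc 0) / of_nat (Suc n)) * z ^ Suc n"
        unfolding L c_def by (simp only: sum_distrib_left sum_distrib_right mult_ac)
    qed
    finally show ?thesis using psi_series_sums[OF m g(1) zR] sums_unique2 by blast
  qed
  ultimately have "Borel_sums \<Lambda> g R \<xi> z ((\<Sum>k<m. (of_nat k / of_nat m - 1 / 2) * g (\<Lambda> ^ k * z)) - S)"
    unfolding Borel_sums_def using Psi_coeff_eq[OF m g(1) zR, of n0] by (simp add: \<Lambda>_def)
  thus "Borel_sums \<Lambda> g R \<xi> z
           ((\<Sum>k<m. (of_nat k / of_nat m - 1 / 2) * g (\<Lambda> ^ k * z))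
             - (\<Sum>k<m. \<Sum>\<^sub>\<infinity>a\<in>- {0}. borel_term m \<Lambda> g k \<xi> z a))"
    unfolding S_def .
qed

section \<open>Holomorphy in two variables\<close>

text \<open>For w \<noteq> 0 the y with \<bar>w exp y\<bar> \<le> R' form a half-plane, which is
  convex and contains 0. The mean value inequality therefore applies between 0 and y, and the
  derivative w exp y g'(w exp y) is bounded there by a constant that depends on neither w nor
  y.\<close>

lemma multiplicative_shift_bound:
  assumes g: "g holomorphic_on ball 0 R" and R': "R' < R"
  obtains B where "B \<ge> 0"
    "\<And>w y. norm w \<le> R' \<Longrightarrow> norm (w * exp y) \<le> R' \<Longrightarrow> norm (g (w * exp y) - g w) \<le> B * norm y"
proof -
  have sub: "cball 0 R' \<subseteq> ball 0 R" using R' by auto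
  have "continuous_on (cball 0 R') (deriv g)"
    using sub by (intro holomorphic_on_imp_continuous_on holomorphic_on_subset[OF holomorphic_deriv[OF g]]) auto
  hence "bounded (deriv g ` cball 0 R')"
    by (intro compact_imp_bounded compact_continuous_image) auto
  then obtain D where D: "\<And>u. u \<in> cball 0 R' \<Longrightarrow> norm (deriv g u) \<le> D"
    unfolding bounded_iff by blast
  define B where "B = \<bar>D\<bar> * \<bar>R'\<bar>"
  have "norm (g (w * exp y) - g w) \<le> B * norm y" if w: "norm w \<le> R'" "norm (w * exp y) \<le> R'" for w y
  proof (cases "w = 0")
    case False
    define S where "S = {y. Re y \<le> ln (R' / norm w)}"
    have R'0: "R' > 0" using w False by (meson less_le_trans zero_less_norm_iff)
    have S_iff: "y \<in> S \<longleftrightarrow> norm (w * exp y) \<le> R'" for y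
    proof -
      have "y \<in> S \<longleftrightarrow> exp (Re y) \<le> R' / norm w"
        using ln_ge_iff[of "R' / norm w" "Re y"] R'0 False by (simp add: S_def)
      also have "\<dots> \<longleftrightarrow> norm w * exp (Re y) \<le> R'" using False by (simp add: pos_le_divide_eq mult.commute)
      finally show ?thesis by (simp add: norm_mult)
    qed
    have "norm ((\<lambda>y. g (w * exp y)) y - (\<lambda>y. g (w * exp y)) 0) \<le> B * norm (y - 0)"
    proof (rule field_differentiable_bound[of S])
      show "convex S" unfolding S_def by (rule convex_halfspace_Re_le)
      fix x assume x: "x \<in> S"
      hence wx: "w * exp x \<in> cball 0 R'" by (simp add: S_iff)
      have "(g has_field_derivative deriv g (w * exp x)) (at (w * exp x))"
        using subsetD[OF sub wx] by (intro holomorphic_derivI[OF g]) auto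
      thus "((\<lambda>y. g (w * exp y)) has_field_derivative deriv g (w * exp x) * (w * exp x)) (at x within S)"
        by (rule DERIV_chain2[where f = g and g = "\<lambda>y. w * exp y"]) (auto intro!: derivative_eq_intros)
      have "norm (deriv g (w * exp x)) * norm (w * exp x) \<le> \<bar>D\<bar> * \<bar>R'\<bar>"
        using D[OF wx] wx by (intro mult_mono) auto
      thus "norm (deriv g (w * exp x) * (w * exp x)) \<le> B" by (simp only: B_def norm_mult)
    qed (use w in \<open>auto simp: S_iff\<close>)
    thus ?thesis by simp
  qed (simp add: B_def)
  moreover have "B \<ge> 0" by (simp add: B_def)
  ultimately show thesis using that by blast
qed

text \<open>Division by \<i> moves Im \<xi> into the real part of the exponent: real translations of
  \<xi> merely rotate the argument of g. Hence the formula lives on a strip in \<xi> and not only on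
  a disk.\<close>

lemma norm_exp_borel_exponent:
  "norm (exp (of_nat m * \<xi> / (2 * pi * \<i> * of_int a))) = exp (real m * Im \<xi> / (2 * pi * real_of_int a))"
proof -
  have "of_nat m * \<xi> / (2 * pi * \<i> * of_int a) = of_real (real m / (2 * pi * real_of_int a)) * (\<xi> / \<i>)"
    by (simp only: of_real_divide of_real_mult of_real_of_nat_eq of_real_of_int_eq times_divide_times_eq mult_ac)
  hence "Re (of_nat m * \<xi> / (2 * pi * \<i> * of_int a)) = real m / (2 * pi * real_of_int a) * Re (\<xi> / \<i>)"
    by (simp only: Re_complex_of_real times_complex.sel Im_complex_of_real mult_zero_left diff_zero)
  thus ?thesis by simp
qed

lemma norm_exp_borel_exponent_le:
  assumes "a \<noteq> 0" "\<bar>Im \<xi>\<bar> \<le> \<epsilon>"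
  shows "norm (exp (of_nat m * \<xi> / (2 * pi * \<i> * of_int a))) \<le> exp (real m * \<epsilon> / (2 * pi))"
proof -
  have "\<bar>real_of_int a\<bar> \<ge> 1" using assms by linarith
  have "real m * Im \<xi> / (2 * pi * real_of_int a) \<le> \<bar>real m * Im \<xi> / (2 * pi * real_of_int a)\<bar>" by (rule abs_ge_self)
  also have "\<dots> = real m * \<bar>Im \<xi>\<bar> / (2 * pi) / \<bar>real_of_int a\<bar>" by (simp add: abs_mult)
  also have "\<dots> \<le> real m * \<bar>Im \<xi>\<bar> / (2 * pi) / 1"
    using \<open>\<bar>real_of_int a\<bar> \<ge> 1\<close> by (intro divide_left_mono) auto
  also have "\<dots> \<le> real m * \<epsilon> / (2 * pi)" using assms by (simp add: divide_right_mono mult_left_mono)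
  finally show ?thesis unfolding norm_exp_borel_exponent by simp
qed

text \<open>The M-test makes both families of partial sums converge uniformly, hence the
  differentials converge uniformly relative to the norm of h; this is the condition for termwise
  differentiation on a convex set. Openness of S then gives a derivative at p rather than within
  S.\<close>

lemma has_derivative_series_pair:
  fixes f :: "nat \<Rightarrow> complex \<times> complex \<Rightarrow> complex"
  assumes S: "convex S" "open S"
    and f: "\<And>n p. p \<in> S \<Longrightarrow> (f n has_derivative (\<lambda>h. A n p * fst h + B n p * snd h)) (at p)"
    and A: "\<And>n p. p \<in> S \<Longrightarrow> norm (A n p) \<le> M n" and B: "\<And>n p. p \<in> S \<Longrightarrow> norm (B n p) \<le> M n"
    and M: "summable M" and p: "p \<in> S" and sm: "summable (\<lambda>n. f n p)"
  shows "((\<lambda>p. \<Sum>n. f n p) has_derivative (\<lambda>h. (\<Sum>n. A n p) * fst h + (\<Sum>n. B n p) * snd h)) (at p)"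
proof -
  have uA: "uniform_limit S (\<lambda>n p. \<Sum>i<n. A i p) (\<lambda>p. \<Sum>i. A i p) sequentially"
   and uB: "uniform_limit S (\<lambda>n p. \<Sum>i<n. B i p) (\<lambda>p. \<Sum>i. B i p) sequentially"
    using A B M by (auto intro!: Weierstrass_m_test)
  have "\<exists>g. \<forall>x\<in>S. (\<lambda>n. f n x) sums (g x) \<and>
           (g has_derivative (\<lambda>h. (\<Sum>n. A n x) * fst h + (\<Sum>n. B n x) * snd h)) (at x within S)"
  proof (rule has_derivative_series[where f' = "\<lambda>n x h. A n x * fst h + B n x * snd h" and x = p and l = "\<Sum>n. f n p"])
    show "convex S" "p \<in> S" "(\<lambda>n. f n p) sums (\<Sum>n. f n p)" using S p sm by (simp_all add: summable_sums)
    show "(f n has_derivative (\<lambda>h. A n x * fst h + B n x * snd h)) (at x within S)" if "x \<in> S" for n x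
      using f[OF that] by (rule has_derivative_at_withinI)
    fix e :: real assume e: "e > 0"
    hence "eventually (\<lambda>n. \<forall>x\<in>S. dist (\<Sum>i<n. A i x) (\<Sum>i. A i x) < e / 2) sequentially"
          "eventually (\<lambda>n. \<forall>x\<in>S. dist (\<Sum>i<n. B i x) (\<Sum>i. B i x) < e / 2) sequentially"
      using uA uB unfolding uniform_limit_iff by (meson half_gt_zero)+
    thus "\<forall>\<^sub>F n in sequentially. \<forall>x\<in>S. \<forall>h. norm ((\<Sum>i<n. A i x * fst h + B i x * snd h) -
              ((\<Sum>n. A n x) * fst h + (\<Sum>n. B n x) * snd h)) \<le> e * norm h"
    proof eventually_elim
      case (elim n)
      show ?case
      proof (intro ballI allI)
        fix x and h :: "complex \<times> complex" assume x: "x \<in> S"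
        have "(\<Sum>i<n. A i x * fst h + B i x * snd h) - ((\<Sum>n. A n x) * fst h + (\<Sum>n. B n x) * snd h) =
          ((\<Sum>i<n. A i x) - (\<Sum>n. A n x)) * fst h + ((\<Sum>i<n. B i x) - (\<Sum>n. B n x)) * snd h"
          by (simp add: sum.distrib sum_distrib_right left_diff_distrib)
        also have "norm \<dots> \<le> e / 2 * norm h + e / 2 * norm h"
        proof (rule order_trans[OF norm_triangle_ineq add_mono])
          show "norm (((\<Sum>i<n. A i x) - (\<Sum>n. A n x)) * fst h) \<le> e / 2 * norm h"
            unfolding norm_mult using elim(1) x e norm_fst_le[of "fst h" "snd h"]
            by (intro mult_mono) (auto simp: dist_norm intro: less_imp_le)
          show "norm (((\<Sum>i<n. B i x) - (\<Sum>n. B n x)) * snd h) \<le> e / 2 * norm h"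
            unfolding norm_mult using elim(2) x e norm_snd_le[of "snd h" "fst h"]
            by (intro mult_mono) (auto simp: dist_norm intro: less_imp_le)
        qed
        finally show "norm ((\<Sum>i<n. A i x * fst h + B i x * snd h) -
              ((\<Sum>n. A n x) * fst h + (\<Sum>n. B n x) * snd h)) \<le> e * norm h" by simp
      qed
    qed
  qed
  then obtain G where G: "\<And>x. x \<in> S \<Longrightarrow> (\<lambda>n. f n x) sums (G x)"
     "\<And>x. x \<in> S \<Longrightarrow> (G has_derivative (\<lambda>h. (\<Sum>n. A n x) * fst h + (\<Sum>n. B n x) * snd h)) (at x within S)"
    by blast
  have "(G has_derivative (\<lambda>h. (\<Sum>n. A n p) * fst h + (\<Sum>n. B n p) * snd h)) (at p)"
    using G(2)[OF p] by (simp add: at_within_open[OF p S(2)])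
  thus ?thesis
    by (rule has_derivative_transform_within_open[OF _ S(2) p]) (use G(1) in \<open>auto simp: sums_iff\<close>)
qed

text \<open>Again two factors 1/\<bar>a\<bar>, the second one now through the shift bound with y
  proportional to \<xi>/a. The constant precedes k, a, \<xi> and z, so that it serves on a whole
  strip as well as for all distant terms of \<delta>.\<close>

lemma borel_term_norm_le:
  assumes g: "g holomorphic_on ball 0 R" and R': "R' < R" and \<Lambda>: "norm \<Lambda> = 1"
  obtains B where "B \<ge> 0" "\<And>k a \<xi> z. a \<noteq> 0 \<Longrightarrow> norm z \<le> R' \<Longrightarrow>
     norm (z * exp (of_nat m * \<xi> / (2 * pi * \<i> * of_int a))) \<le> R' \<Longrightarrow>
     norm (borel_term m \<Lambda> g k \<xi> z a) \<le> B * norm \<xi> * (1 / real_of_int a ^ 2)"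
proof -
  obtain B where B: "B \<ge> 0"
    "\<And>w y. norm w \<le> R' \<Longrightarrow> norm (w * exp y) \<le> R' \<Longrightarrow> norm (g (w * exp y) - g w) \<le> B * norm y"
    using multiplicative_shift_bound[OF g R'] by metis
  have "norm (borel_term m \<Lambda> g k \<xi> z a) \<le> (B * (real m / (2 * pi))) * norm \<xi> * (1 / real_of_int a ^ 2)"
    if a: "a \<noteq> 0" and z: "norm z \<le> R'" "norm (z * exp (of_nat m * \<xi> / (2 * pi * \<i> * of_int a))) \<le> R'"
    for k a \<xi> z
  proof -
    let ?y = "of_nat m * \<xi> / (2 * pi * \<i> * of_int a)"
    have "norm (g (\<Lambda> ^ k * z * exp ?y) - g (\<Lambda> ^ k * z)) \<le> B * norm ?y"
      using z by (intro B(2)) (simp_all add: norm_mult norm_power \<Lambda>)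
    hence "norm (borel_term m \<Lambda> g k \<xi> z a) \<le> 1 / \<bar>real_of_int a\<bar> * (B * norm ?y)"
      unfolding borel_term_eq norm_mult by (intro mult_mono norm_fourier_coeff_le a) (use B in auto)
    also have "\<dots> = B * (real m * norm \<xi> / (2 * pi)) * (1 / (\<bar>real_of_int a\<bar> * \<bar>real_of_int a\<bar>))"
      unfolding norm_borel_exponent by simp
    finally show ?thesis by (simp only: abs_mult_self_eq power2_eq_square) (simp add: mult_ac)
  qed
  thus thesis using that[of "B * (real m / (2 * pi))"] B(1) by simp
qed

text \<open>The last inequality ensures that for \<bar>Im \<xi>\<bar> < \<epsilon> and \<bar>z\<bar>
  < \<epsilon> all arguments of g in the formula stay in a closed disk of radius smaller than
  R.\<close>

locale borel_domain =
  fixes m :: nat and \<Lambda> :: complex and g :: "complex \<Rightarrow> complex" and R \<epsilon> :: real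
  assumes g: "g holomorphic_on ball 0 R" and \<Lambda>: "norm \<Lambda> = 1" and \<epsilon>: "\<epsilon> > 0"
    and \<epsilon>R: "\<epsilon> * exp (real m * \<epsilon> / (2 * pi)) < R"
begin

definition R' where "R' = \<epsilon> * exp (real m * \<epsilon> / (2 * pi))"

lemma R': "R' < R" "\<epsilon> \<le> R'"
proof -
  have "\<epsilon> * 1 \<le> R'" unfolding R'_def using \<epsilon> by (intro mult_left_mono) auto
  thus "\<epsilon> \<le> R'" by simp
qed (use \<epsilon>R in \<open>simp add: R'_def\<close>)

lemma in_range:
  assumes "a \<noteq> 0" "\<bar>Im \<xi>\<bar> < \<epsilon>" "norm z < \<epsilon>"
  shows "norm (z * exp (of_nat m * \<xi> / (2 * pi * \<i> * of_int a))) \<le> R'"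
  unfolding norm_mult R'_def using assms \<epsilon>
  by (intro mult_mono norm_exp_borel_exponent_le) auto

lemma borel_term_summable:
  assumes "\<bar>Im \<xi>\<bar> < \<epsilon>" "norm z < \<epsilon>"
  shows "borel_term m \<Lambda> g k \<xi> z summable_on (-{0})"
proof -
  obtain B where B: "B \<ge> 0" "\<And>k a \<xi> z. a \<noteq> 0 \<Longrightarrow> norm z \<le> R' \<Longrightarrow>
     norm (z * exp (of_nat m * \<xi> / (2 * pi * \<i> * of_int a))) \<le> R' \<Longrightarrow>
     norm (borel_term m \<Lambda> g k \<xi> z a) \<le> B * norm \<xi> * (1 / real_of_int a ^ 2)"
    using borel_term_norm_le[OF g R'(1) \<Lambda>] by metis
  have "(\<lambda>a. B * norm \<xi> * (1 / real_of_int a ^ 2)) summable_on (-{0})"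
    by (intro summable_on_cmult_right inverse_squares_int_summable)
  hence "(\<lambda>a. norm (borel_term m \<Lambda> g k \<xi> z a)) summable_on (-{0})"
  proof (rule Infinite_Sum.abs_summable_on_comparison_test')
    fix a :: int assume "a \<in> -{0}"
    hence a: "a \<noteq> 0" by simp
    show "norm (borel_term m \<Lambda> g k \<xi> z a) \<le> B * norm \<xi> * (1 / real_of_int a ^ 2)"
      by (rule B(2)[OF a _ in_range[OF a assms]]) (use assms R' in simp)
  qed
  thus ?thesis by (rule abs_summable_summable)
qed

text \<open>The partial derivative of the a-th term with respect to \<xi>; \<open>dterm2\<close> is
  the one with respect to z.\<close>

definition dterm1 :: "nat \<Rightarrow> int \<Rightarrow> complex \<times> complex \<Rightarrow> complex" where
  "dterm1 k a p = (let y = of_nat m * fst p / (2 * pi * \<i> * of_int a); w = \<Lambda> ^ k * snd p in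
     fourier_coeff m k a * (deriv g (w * exp y) * (w * exp y) * (of_nat m / (2 * pi * \<i> * of_int a))))"

definition dterm2 :: "nat \<Rightarrow> int \<Rightarrow> complex \<times> complex \<Rightarrow> complex" where
  "dterm2 k a p = (let y = of_nat m * fst p / (2 * pi * \<i> * of_int a); w = \<Lambda> ^ k * snd p in
     fourier_coeff m k a * ((deriv g (w * exp y) * exp y - deriv g w) * \<Lambda> ^ k))"

lemma borel_term_has_derivative:
  assumes a: "a \<noteq> 0" and p: "\<bar>Im (fst p)\<bar> < \<epsilon>" "norm (snd p) < \<epsilon>"
  shows "((\<lambda>p. borel_term m \<Lambda> g k (fst p) (snd p) a) has_derivative
            (\<lambda>h. dterm1 k a p * fst h + dterm2 k a p * snd h)) (at p)"
proof -
  define c where "c = of_nat m / (2 * pi * \<i> * of_int a)"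
  have c: "of_nat m * \<xi> / (2 * pi * \<i> * of_int a) = c * \<xi>" for \<xi> by (simp add: c_def)
  let ?w = "\<Lambda> ^ k * snd p"
  have nw: "norm ?w = norm (snd p)" by (simp add: norm_mult norm_power \<Lambda>)
  have 1: "norm ?w < R" using nw p(2) R' by linarith
  have 2: "norm (?w * exp (c * fst p)) < R"
    using in_range[OF a p] R'(1) unfolding c norm_mult[of _ "exp (c * fst p)"] nw by linarith
  have d: "(g has_derivative (\<lambda>x. deriv g u * x)) (at u)" if "norm u < R" for u
    using holomorphic_derivI[OF g, of u] that by (simp add: has_field_derivative_def)
  have i1: "((\<lambda>p. \<Lambda> ^ k * snd p * exp (c * fst p)) has_derivative
      (\<lambda>h. \<Lambda> ^ k * snd h * exp (c * fst p) + \<Lambda> ^ k * snd p * (exp (c * fst p) * (c * fst h)))) (at p)"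
  proof -
    have "((\<lambda>p. exp (c * fst p)) has_derivative (\<lambda>h. exp (c * fst p) * (c * fst h))) (at p)"
      by (rule has_derivative_compose[of "\<lambda>p. c * fst p" _ _ _ exp "\<lambda>x. exp (c * fst p) * x"])
         (auto intro!: derivative_eq_intros DERIV_exp[unfolded has_field_derivative_def])
    thus ?thesis by (auto intro!: derivative_eq_intros)
  qed
  have i2: "((\<lambda>p. \<Lambda> ^ k * snd p) has_derivative (\<lambda>h. \<Lambda> ^ k * snd h)) (at p)"
    by (auto intro!: derivative_eq_intros)
  have "((\<lambda>p. fourier_coeff m k a * (g (\<Lambda> ^ k * snd p * exp (c * fst p)) - g (\<Lambda> ^ k * snd p))) has_derivative
     (\<lambda>h. fourier_coeff m k a * (deriv g (?w * exp (c * fst p)) * (\<Lambda> ^ k * snd h * exp (c * fst p) + \<Lambda> ^ k * snd p * (exp (c * fst p) * (c * fst h)))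
         - deriv g ?w * (\<Lambda> ^ k * snd h)))) (at p)"
    by (intro has_derivative_mult_right has_derivative_diff has_derivative_compose[OF i1 d[OF 2]] has_derivative_compose[OF i2 d[OF 1]])
  also have "(\<lambda>h. fourier_coeff m k a * (deriv g (?w * exp (c * fst p)) * (\<Lambda> ^ k * snd h * exp (c * fst p) + \<Lambda> ^ k * snd p * (exp (c * fst p) * (c * fst h)))
         - deriv g ?w * (\<Lambda> ^ k * snd h))) = (\<lambda>h. dterm1 k a p * fst h + dterm2 k a p * snd h)"
    unfolding dterm1_def dterm2_def Let_def c c_def[symmetric] by (simp add: fun_eq_iff algebra_simps)
  finally show ?thesis by (simp only: borel_term_eq c)
qed

text \<open>In \<open>dterm1\<close> the second factor 1/a is the inner derivative. In
  \<open>dterm2\<close> it must come from a difference, which is split into the variation of g' and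
  exp y - 1, both O(\<bar>y\<bar>). As \<bar>y\<bar> is proportional to
  \<bar>\<xi>\<bar>/\<bar>a\<bar>, the bound Q on \<bar>\<xi>\<bar> enters.\<close>

lemma dterm_bound:
  obtains C where "\<And>k a p. a \<noteq> 0 \<Longrightarrow> \<bar>Im (fst p)\<bar> < \<epsilon> \<Longrightarrow> norm (snd p) < \<epsilon> \<Longrightarrow> norm (fst p) < Q \<Longrightarrow>
      norm (dterm1 k a p) \<le> C * (1 / real_of_int a ^ 2) \<and> norm (dterm2 k a p) \<le> C * (1 / real_of_int a ^ 2)"
proof -
  define M where "M = real m * \<epsilon> / (2 * pi)"
  have M: "M \<ge> 0" using \<epsilon> by (simp add: M_def)
  have g': "deriv g holomorphic_on ball 0 R" by (intro holomorphic_deriv g) auto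
  have "continuous_on (cball 0 R') (deriv g)"
    using R'(1) by (intro holomorphic_on_imp_continuous_on holomorphic_on_subset[OF g']) auto
  hence "bounded (deriv g ` cball 0 R')"
    by (intro compact_imp_bounded compact_continuous_image) auto
  then obtain D where "\<And>u. u \<in> cball 0 R' \<Longrightarrow> norm (deriv g u) \<le> D"
    unfolding bounded_iff by blast
  hence D: "norm (deriv g u) \<le> D" if "norm u \<le> R'" for u
    using that by simp
  have D0: "D \<ge> 0" using D[of 0] R'(2) \<epsilon> by (smt (verit) norm_ge_zero norm_zero)
  have R'0: "R' \<ge> 0" using R'(2) \<epsilon> by linarith
  obtain B1 where B1: "B1 \<ge> 0"
    "\<And>w y. norm w \<le> R' \<Longrightarrow> norm (w * exp y) \<le> R' \<Longrightarrow> norm (deriv g (w * exp y) - deriv g w) \<le> B1 * norm y"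
    using multiplicative_shift_bound[OF g' R'(1)] by metis
  \<comment> \<open>The shift bound for the identity function; at w = 1 it says \<bar>exp y -
    1\<bar> \<le> B2 \<bar>y\<bar> as long as \<bar>exp y\<bar> \<le> exp M.\<close>
  obtain B2 where B2: "B2 \<ge> 0"
    "\<And>w y :: complex. norm w \<le> exp M \<Longrightarrow> norm (w * exp y) \<le> exp M \<Longrightarrow> norm (w * exp y - w) \<le> B2 * norm y"
    using multiplicative_shift_bound[of "\<lambda>x. x" "exp M + 1" "exp M"] by (metis holomorphic_on_ident less_add_one)
  define K where "K = real m / (2 * pi)"
  have K: "K \<ge> 0" by (simp add: K_def)
  define C1 where "C1 = D * R' * K"
  define C2 where "C2 = (B1 * exp M + D * B2) * (K * \<bar>Q\<bar>)"
  have "norm (dterm1 k a p) \<le> (C1 + C2) * (1 / real_of_int a ^ 2) \<and> norm (dterm2 k a p) \<le> (C1 + C2) * (1 / real_of_int a ^ 2)"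
    if a: "a \<noteq> 0" and p: "\<bar>Im (fst p)\<bar> < \<epsilon>" "norm (snd p) < \<epsilon>" "norm (fst p) < Q" for k a p
  proof -
    define y where "y = of_nat m * fst p / (2 * pi * \<i> * of_int a)"
    define w where "w = \<Lambda> ^ k * snd p"
    have w: "norm w \<le> R'" using p R' by (simp add: w_def norm_mult norm_power \<Lambda>)
    have wy: "norm (w * exp y) \<le> R'" using in_range[OF a p(1,2)] by (simp add: w_def y_def norm_mult norm_power \<Lambda>)
    have ey: "norm (exp y) \<le> exp M" unfolding y_def M_def using p by (intro norm_exp_borel_exponent_le a) auto
    have a2: "1 / \<bar>real_of_int a\<bar> * (X / \<bar>real_of_int a\<bar>) = X * (1 / real_of_int a ^ 2)" for X
      by (simp add: power2_eq_square)
    have "norm (dterm1 k a p) = norm (fourier_coeff m k a) * (norm (deriv g (w * exp y)) * norm (w * exp y) * (K / \<bar>real_of_int a\<bar>))"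
      unfolding dterm1_def Let_def y_def[symmetric] w_def[symmetric] by (simp add: norm_mult norm_divide K_def)
    also have "\<dots> \<le> 1 / \<bar>real_of_int a\<bar> * (D * R' * (K / \<bar>real_of_int a\<bar>))"
      using D0 R'0 K by (intro mult_mono mult_right_mono norm_fourier_coeff_le a D wy) auto
    also have "\<dots> = C1 * (1 / real_of_int a ^ 2)" unfolding a2[symmetric] C1_def by simp
    finally have 1: "norm (dterm1 k a p) \<le> C1 * (1 / real_of_int a ^ 2)" .
    have ny: "norm y \<le> K * \<bar>Q\<bar> / \<bar>real_of_int a\<bar>"
    proof -
      have "norm y = K * norm (fst p) / \<bar>real_of_int a\<bar>" unfolding y_def norm_borel_exponent K_def by simp
      also have "\<dots> \<le> K * \<bar>Q\<bar> / \<bar>real_of_int a\<bar>" using p(3) K by (intro divide_right_mono mult_left_mono) auto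
      finally show ?thesis .
    qed
    have "deriv g (w * exp y) * exp y - deriv g w = (deriv g (w * exp y) - deriv g w) * exp y + deriv g w * (1 * exp y - 1)"
      by (simp add: algebra_simps)
    also have "norm \<dots> \<le> (B1 * norm y) * exp M + D * (B2 * norm y)"
      unfolding norm_mult[of "deriv g (w * exp y) - deriv g w"] norm_mult[of "deriv g w"]
    proof (rule order_trans[OF norm_triangle_ineq add_mono])
      show "norm ((deriv g (w * exp y) - deriv g w) * exp y) \<le> (B1 * norm y) * exp M"
        unfolding norm_mult[of "deriv g (w * exp y) - deriv g w"] using B1 w wy ey by (intro mult_mono) auto
      show "norm (deriv g w * (1 * exp y - 1)) \<le> D * (B2 * norm y)"
        unfolding norm_mult[of "deriv g w"] using D D0 w ey M by (intro mult_mono B2(2)) auto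
    qed
    also have "\<dots> = (B1 * exp M + D * B2) * norm y" by (simp add: algebra_simps)
    also have "\<dots> \<le> (B1 * exp M + D * B2) * (K * \<bar>Q\<bar> / \<bar>real_of_int a\<bar>)"
      using ny B1 B2 D0 by (intro mult_left_mono) auto
    also have "\<dots> = C2 / \<bar>real_of_int a\<bar>" by (simp add: C2_def)
    finally have "norm (dterm2 k a p) \<le> 1 / \<bar>real_of_int a\<bar> * (C2 / \<bar>real_of_int a\<bar>)"
      unfolding dterm2_def Let_def y_def[symmetric] w_def[symmetric]
        norm_mult[of "fourier_coeff m k a"] norm_mult[of _ "\<Lambda> ^ k"] norm_power \<Lambda> power_one mult_1_right
      by (intro mult_mono norm_fourier_coeff_le a) auto
    hence 2: "norm (dterm2 k a p) \<le> C2 * (1 / real_of_int a ^ 2)" unfolding a2 .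
    have "C1 \<ge> 0" "C2 \<ge> 0" using D0 R'0 K B1 B2 by (auto simp: C1_def C2_def)
    hence "C1 * (1 / real_of_int a ^ 2) \<le> (C1 + C2) * (1 / real_of_int a ^ 2)"
          "C2 * (1 / real_of_int a ^ 2) \<le> (C1 + C2) * (1 / real_of_int a ^ 2)"
      by (intro mult_right_mono; simp)+
    thus ?thesis using 1 2 by linarith
  qed
  thus thesis by (rule that)
qed

lemma borel_series_differentiable:
  assumes p: "\<bar>Im (fst p)\<bar> < \<epsilon>" "norm (snd p) < \<epsilon>"
  shows "\<exists>A B. ((\<lambda>p. \<Sum>\<^sub>\<infinity>a\<in>-{0}. borel_term m \<Lambda> g k (fst p) (snd p) a) has_derivative
            (\<lambda>h. A * fst h + B * snd h)) (at p)"
proof -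
  \<comment> \<open>An enumeration of the nonzero integers turns the unconditional sum into a series
    that can be differentiated termwise.\<close>
  define e where "e = from_nat_into (-{0::int})"
  have inf: "infinite (-{0::int})" by (simp add: finite_compl infinite_UNIV_int)
  have e: "bij_betw e UNIV (-{0})" unfolding e_def by (rule bij_betw_from_nat_into) (use inf in auto)
  have e0: "e n \<noteq> 0" for n using e by (auto simp: bij_betw_def)
  define Q where "Q = norm (fst p) + 1"
  \<comment> \<open>A convex open neighbourhood of p in which the strip is cut off at
    \<bar>\<xi>\<bar> < Q, since the bounds on the derivatives are uniform only for bounded
    \<xi>.\<close>
  define S where "S = ({\<xi>. Im \<xi> < \<epsilon>} \<inter> {\<xi>. Im \<xi> > - \<epsilon>} \<inter> ball 0 Q) \<times> ball (0::complex) \<epsilon>"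
  have S: "convex S" "open S"
    unfolding S_def by (intro convex_Times convex_Int convex_halfspace_Im_lt convex_halfspace_Im_gt convex_ball
        open_Times open_Int open_halfspace_Im_lt open_halfspace_Im_gt open_ball)+
  have SD: "\<bar>Im (fst q)\<bar> < \<epsilon>" "norm (snd q) < \<epsilon>" "norm (fst q) < Q" if "q \<in> S" for q
    using that by (auto simp: S_def)
  have pS: "p \<in> S" using p by (cases p) (auto simp: S_def Q_def)
  obtain C where C: "\<And>k a p. a \<noteq> 0 \<Longrightarrow> \<bar>Im (fst p)\<bar> < \<epsilon> \<Longrightarrow> norm (snd p) < \<epsilon> \<Longrightarrow> norm (fst p) < Q \<Longrightarrow>
      norm (dterm1 k a p) \<le> C * (1 / real_of_int a ^ 2) \<and> norm (dterm2 k a p) \<le> C * (1 / real_of_int a ^ 2)"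
    using dterm_bound[of Q] by metis
  have sums: "(\<lambda>n. f (e n)) sums infsum f (-{0})" if "f summable_on (-{0})" for f :: "int \<Rightarrow> complex"
    by (rule has_sum_imp_sums, subst has_sum_reindex_bij_betw[OF e]) (rule has_sum_infsum[OF that])
  have "(\<lambda>n. C * (1 / real_of_int (e n) ^ 2)) summable_on UNIV"
    by (subst summable_on_reindex_bij_betw[OF e, of "\<lambda>a. C * (1 / real_of_int a ^ 2)"])
       (intro summable_on_cmult_right inverse_squares_int_summable)
  hence M: "summable (\<lambda>n. C * (1 / real_of_int (e n) ^ 2))" by (rule summable_on_imp_summable)
  have "((\<lambda>p. \<Sum>n. borel_term m \<Lambda> g k (fst p) (snd p) (e n)) has_derivative
            (\<lambda>h. (\<Sum>n. dterm1 k (e n) p) * fst h + (\<Sum>n. dterm2 k (e n) p) * snd h)) (at p)"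
  proof (rule has_derivative_series_pair[OF S _ _ _ M pS])
    show "summable (\<lambda>n. borel_term m \<Lambda> g k (fst p) (snd p) (e n))"
      using sums[OF borel_term_summable[OF p]] by (rule sums_summable)
    fix n q assume q: "q \<in> S"
    show "((\<lambda>p. borel_term m \<Lambda> g k (fst p) (snd p) (e n)) has_derivative
            (\<lambda>h. dterm1 k (e n) q * fst h + dterm2 k (e n) q * snd h)) (at q)"
      by (rule borel_term_has_derivative[OF e0 SD(1,2)[OF q]])
    show "norm (dterm1 k (e n) q) \<le> C * (1 / real_of_int (e n) ^ 2)"
         "norm (dterm2 k (e n) q) \<le> C * (1 / real_of_int (e n) ^ 2)"
      using C[OF e0 SD[OF q], of k n] by blast+
  qed
  moreover have "(\<Sum>n. borel_term m \<Lambda> g k (fst q) (snd q) (e n)) = (\<Sum>\<^sub>\<infinity>a\<in>-{0}. borel_term m \<Lambda> g k (fst q) (snd q) a)"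
    if "q \<in> S" for q
    by (rule sums_unique[OF sums[OF borel_term_summable[OF SD(1,2)[OF that]]], symmetric])
  ultimately have "((\<lambda>p. \<Sum>\<^sub>\<infinity>a\<in>-{0}. borel_term m \<Lambda> g k (fst p) (snd p) a) has_derivative
            (\<lambda>h. (\<Sum>n. dterm1 k (e n) p) * fst h + (\<Sum>n. dterm2 k (e n) p) * snd h)) (at p)"
    by (rule has_derivative_transform_within_open[OF _ S(2) pS])
  thus ?thesis by blast
qed

lemma borel_formula_holomorphic2:
  "holomorphic2_on (\<lambda>(\<xi>, z). (\<Sum>k<m. (of_nat k / of_nat m - 1 / 2) * g (\<Lambda> ^ k * z))
             - (\<Sum>k<m. \<Sum>\<^sub>\<infinity>a\<in>- {0}. borel_term m \<Lambda> g k \<xi> z a)) ({\<xi>. \<bar>Im \<xi>\<bar> < \<epsilon>} \<times> ball 0 \<epsilon>)"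
  unfolding holomorphic2_on_def
proof
  fix p assume "p \<in> {\<xi>. \<bar>Im \<xi>\<bar> < \<epsilon>} \<times> ball (0::complex) \<epsilon>"
  hence p: "\<bar>Im (fst p)\<bar> < \<epsilon>" "norm (snd p) < \<epsilon>" by auto
  have "\<forall>k. \<exists>AB. ((\<lambda>p. \<Sum>\<^sub>\<infinity>a\<in>-{0}. borel_term m \<Lambda> g k (fst p) (snd p) a) has_derivative
            (\<lambda>h. fst AB * fst h + snd AB * snd h)) (at p)"
  proof
    fix k
    from borel_series_differentiable[OF p, of k] obtain A B where
      "((\<lambda>p. \<Sum>\<^sub>\<infinity>a\<in>-{0}. borel_term m \<Lambda> g k (fst p) (snd p) a) has_derivative (\<lambda>h. A * fst h + B * snd h)) (at p)"
      by (elim exE)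
    thus "\<exists>AB. ((\<lambda>p. \<Sum>\<^sub>\<infinity>a\<in>-{0}. borel_term m \<Lambda> g k (fst p) (snd p) a) has_derivative
            (\<lambda>h. fst AB * fst h + snd AB * snd h)) (at p)"
      by (intro exI[of _ "(A, B)"]) (simp only: fst_conv snd_conv)
  qed
  from choice[OF this] obtain c where c: "\<forall>k. ((\<lambda>p. \<Sum>\<^sub>\<infinity>a\<in>-{0}. borel_term m \<Lambda> g k (fst p) (snd p) a) has_derivative
            (\<lambda>h. fst (c k) * fst h + snd (c k) * snd h)) (at p)" by (elim exE)
  define A where "A k = fst (c k)" for k
  define B where "B k = snd (c k)" for k
  have AB: "((\<lambda>p. \<Sum>\<^sub>\<infinity>a\<in>-{0}. borel_term m \<Lambda> g k (fst p) (snd p) a) has_derivative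
            (\<lambda>h. A k * fst h + B k * snd h)) (at p)" for k
    unfolding A_def B_def using c by (rule spec)
  define D where "D k = deriv g (\<Lambda> ^ k * snd p)" for k
  have 1: "((\<lambda>p. g (\<Lambda> ^ k * snd p)) has_derivative (\<lambda>h. D k * (\<Lambda> ^ k * snd h))) (at p)" for k
  proof -
    have i: "((\<lambda>p. \<Lambda> ^ k * snd p) has_derivative (\<lambda>h. \<Lambda> ^ k * snd h)) (at p)"
      by (auto intro!: derivative_eq_intros)
    have "norm (\<Lambda> ^ k * snd p) < R" using p(2) R' by (simp add: norm_mult norm_power \<Lambda>)
    hence "(g has_derivative (\<lambda>x. D k * x)) (at (\<Lambda> ^ k * snd p))"
      using holomorphic_derivI[OF g] by (simp add: has_field_derivative_def D_def)
    from has_derivative_compose[OF i this] show ?thesis .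
  qed
  have "((\<lambda>p. (\<Sum>k<m. (of_nat k / of_nat m - 1 / 2) * g (\<Lambda> ^ k * snd p))
             - (\<Sum>k<m. \<Sum>\<^sub>\<infinity>a\<in>- {0}. borel_term m \<Lambda> g k (fst p) (snd p) a)) has_derivative
        (\<lambda>h. (\<Sum>k<m. (of_nat k / of_nat m - 1 / 2) * (D k * (\<Lambda> ^ k * snd h))) - (\<Sum>k<m. A k * fst h + B k * snd h))) (at p)"
    by (intro has_derivative_diff has_derivative_sum has_derivative_mult_right 1 AB)
  also have "(\<lambda>h. (\<Sum>k<m. (of_nat k / of_nat m - 1 / 2) * (D k * (\<Lambda> ^ k * snd h))) - (\<Sum>k<m. A k * fst h + B k * snd h)) =
     (\<lambda>h. (- (\<Sum>k<m. A k)) * fst h + ((\<Sum>k<m. (of_nat k / of_nat m - 1 / 2) * (D k * \<Lambda> ^ k)) - (\<Sum>k<m. B k)) * snd h)"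
    by (simp add: fun_eq_iff sum_distrib_left sum.distrib algebra_simps)
  finally show "\<exists>a b. ((\<lambda>(\<xi>, z). (\<Sum>k<m. (of_nat k / of_nat m - 1 / 2) * g (\<Lambda> ^ k * z))
             - (\<Sum>k<m. \<Sum>\<^sub>\<infinity>a\<in>- {0}. borel_term m \<Lambda> g k \<xi> z a)) has_derivative (\<lambda>h. a * fst h + b * snd h))
           (at p within {\<xi>. \<bar>Im \<xi>\<bar> < \<epsilon>} \<times> ball 0 \<epsilon>)"
    unfolding case_prod_unfold by (blast intro: has_derivative_at_withinI)
qed

end

section \<open>Poles and growth of the Borel transform of \<open>\<delta>\<close>\<close>

lemma delta_holomorphic: "delta holomorphic_on ball 0 1"
  unfolding delta_def by (intro holomorphic_intros) auto

text \<open>In logarithms the condition reads 2\<pi>\<i>k n0/m + lz + m\<xi>/(2\<pi>\<i>a) =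
  2\<pi>\<i>l for an integer l, and its solution is the singular point with b = k n0 - m l. For
  given a, the index k thus selects the residue class of b modulo m.\<close>

lemma singular_argument_iff:
  fixes a :: int
  assumes m: "m > 0" and a: "a \<noteq> 0" and lz: "exp lz = z"
  shows "exp (2 * pi * \<i> * of_nat n0 / of_nat m) ^ k * z * exp (of_nat m * \<xi> / (2 * pi * \<i> * of_int a)) = 1 \<longleftrightarrow>
           (\<exists>b. [b = int k * int n0] (mod int m) \<and> \<xi> = sing_pt m lz a b)"
proof -
  define x where "x = of_nat k * (2 * pi * \<i> * of_nat n0 / of_nat m) + lz + of_nat m * \<xi> / (2 * pi * \<i> * of_int a)"
  have "exp (2 * pi * \<i> * of_nat n0 / of_nat m) ^ k * z * exp (of_nat m * \<xi> / (2 * pi * \<i> * of_int a)) = exp x"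
    by (simp only: x_def exp_add exp_of_nat_mult lz)
  also have "exp x = 1 \<longleftrightarrow> (\<exists>l::int. x = of_int (2 * l) * pi * \<i>)"
    using exp_eq[of x 0] by simp
  also have "\<dots> \<longleftrightarrow> (\<exists>l::int. \<xi> = sing_pt m lz a (int k * int n0 - int m * l))"
  proof (rule iff_exI)
    fix l :: int
    have mn: "of_nat m \<noteq> (0::complex)" "of_int a \<noteq> (0::complex)" using m a by auto
    have pin: "complex_of_real pi \<noteq> 0" by simp
    have 1: "sing_pt m lz a (int k * int n0 - int m * l) =
       2 * pi * \<i> * of_int a / of_nat m * (of_int (2 * l) * pi * \<i> - of_nat k * (2 * pi * \<i> * of_nat n0 / of_nat m) - lz)"
      using mn by (simp add: sing_pt_def field_simps)
    have "x = of_int (2 * l) * pi * \<i> \<longleftrightarrow>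
       of_nat m * \<xi> / (2 * pi * \<i> * of_int a) = of_int (2 * l) * pi * \<i> - of_nat k * (2 * pi * \<i> * of_nat n0 / of_nat m) - lz" (is "_ \<longleftrightarrow> _ = ?r")
      unfolding x_def by (auto simp: algebra_simps)
    also have "\<dots> \<longleftrightarrow> \<xi> = 2 * pi * \<i> * of_int a / of_nat m * ?r"
    proof -
      have "u * \<xi> / v = r \<longleftrightarrow> \<xi> = v / u * r" if "u \<noteq> 0" "v \<noteq> 0" for u v r :: complex
        using that by (auto simp: field_simps)
      from this[of "of_nat m" "2 * pi * \<i> * of_int a" ?r] show ?thesis using mn pin by simp
    qed
    finally show "x = of_int (2 * l) * pi * \<i> \<longleftrightarrow> \<xi> = sing_pt m lz a (int k * int n0 - int m * l)"
      unfolding 1 .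
  qed
  also have "\<dots> \<longleftrightarrow> (\<exists>b. [b = int k * int n0] (mod int m) \<and> \<xi> = sing_pt m lz a b)"
  proof safe
    fix l
    show "\<exists>b. [b = int k * int n0] (mod int m) \<and> sing_pt m lz a (int k * int n0 - int m * l) = sing_pt m lz a b"
      by (rule exI[of _ "int k * int n0 - int m * l"], rule conjI[OF _ refl]) (simp add: cong_iff_dvd_diff)
  next
    fix b assume "[b = int k * int n0] (mod int m)"
    then obtain l where "int k * int n0 = b + int m * l" unfolding cong_iff_lin by blast
    hence "b = int k * int n0 - int m * l" by simp
    thus "\<exists>l. sing_pt m lz a b = sing_pt m lz a (int k * int n0 - int m * l)" by blast
  qed
  finally show ?thesis .
qed

text \<open>As Re lz is nonzero, the imaginary part determines a, and then the real part determines
  b. Together with the invertibility of n0 modulo m, this prevents two different terms from sharing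
  a pole.\<close>

lemma sing_pt_inject:
  assumes m: "m > 0" and a: "a \<noteq> 0" and lz: "Re lz < 0" and eq: "sing_pt m lz a b = sing_pt m lz a' b'"
  shows "a = a' \<and> b = b'"
proof -
  have e: "sing_pt m lz a b = of_real (2 * pi * real_of_int a / real m) * (- \<i> * lz + of_real (2 * pi * real_of_int b / real m))" for a b
    by (simp add: sing_pt_def)
  have Im: "Im (sing_pt m lz a b) = 2 * pi * real_of_int a / real m * (- Re lz)" for a b
    unfolding e by simp
  have Re: "Re (sing_pt m lz a b) = 2 * pi * real_of_int a / real m * (Im lz + 2 * pi * real_of_int b / real m)" for a b
    unfolding e by simp
  have "2 * pi * real_of_int a / real m * (- Re lz) = 2 * pi * real_of_int a' / real m * (- Re lz)"
    using arg_cong[OF eq, of Im] unfolding Im .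
  hence aa: "a = a'" using m lz by simp
  have "2 * pi * real_of_int a / real m * (Im lz + 2 * pi * real_of_int b / real m) =
        2 * pi * real_of_int a / real m * (Im lz + 2 * pi * real_of_int b' / real m)"
    using arg_cong[OF eq, of Re] unfolding Re aa[symmetric] .
  hence "b = b'" using m a by simp
  thus ?thesis using aa by simp
qed

lemma quotient_simple_pole:
  assumes P: "P analytic_on {x}" and q: "q analytic_on {x}" "(q has_field_derivative q') (at x)" "q x = 0" "q' \<noteq> 0"
    and Px: "P x \<noteq> 0" and ev: "eventually (\<lambda>w. F w = P w / q w) (at x)" "eventually (\<lambda>w. q w \<noteq> 0) (at x)"
  shows "F meromorphic_on {x}" "is_pole F x" "zorder F x = -1" "residue F x = P x / q'"
proof -
  show "F meromorphic_on {x}"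
  proof (subst meromorphic_on_cong[of "{x}" F "\<lambda>w. P w / q w" "{x}"])
    show "(\<lambda>w. P w / q w) meromorphic_on {x}"
      by (intro meromorphic_on_divide analytic_on_imp_meromorphic_on P q)
  qed (use ev in auto)
  have "is_pole (\<lambda>w. P w / q w) x"
  proof (rule is_pole_divide)
    show "isCont P x" using P by (rule analytic_at_imp_isCont)
    have "q \<midarrow>x\<rightarrow> 0" using q(2,3) by (metis DERIV_isCont isCont_def)
    thus "filterlim q (at 0) (at x)" using ev(2) by (simp add: filterlim_at)
  qed fact
  thus "is_pole F x" using is_pole_cong[OF ev(1) refl] by simp
  obtain r1 where r1: "r1 > 0" "P holomorphic_on ball x r1" using P by (auto simp: analytic_on_def)
  obtain r2 where r2: "r2 > 0" "q holomorphic_on ball x r2" using q(1) by (auto simp: analytic_on_def)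
  define s where "s = ball x (min r1 r2)"
  have s: "P holomorphic_on s" "q holomorphic_on s" "open s" "connected s" "x \<in> s"
    using r1 r2 by (auto simp: s_def intro: holomorphic_on_subset)
  show "zorder F x = -1"
    using porder_simple_pole_deriv[OF s q(2) Px q(3,4)] zorder_cong[OF ev(1) refl] by simp
  show "residue F x = P x / q'"
    using residue_simple_pole_deriv[OF s q(2) Px q(3,4)] residue_cong[OF ev(1) refl] by simp
qed

section \<open>Local structure of the Borel transform of \<delta> at a fixed z\<close>

locale delta_point =
  fixes m n0 :: nat and \<Lambda> z lz :: complex
  assumes m: "m > 0" and \<Lambda>: "\<Lambda> = exp (2 * pi * \<i> * of_nat n0 / of_nat m)"
    and z: "norm z < 1" and lz: "exp lz = z"
begin

lemma norm_\<Lambda>: "norm \<Lambda> = 1"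
  by (simp add: \<Lambda>)

lemma z_nonzero: "z \<noteq> 0"
  using lz by (metis exp_not_eq_zero)

lemma Re_lz: "Re lz < 0"
proof -
  have "exp (Re lz) < 1" using z unfolding lz[symmetric] by simp
  thus ?thesis by simp
qed

abbreviation T :: "nat \<Rightarrow> int \<Rightarrow> complex \<Rightarrow> complex" where
  "T k a \<xi> \<equiv> borel_term m \<Lambda> delta k \<xi> z a"

text \<open>At a pole the singular term has the junk value of \<open>1 / 0\<close>; this is harmless, since neither
  \<open>meromorphic_on\<close> nor order and residue depend on the value at the point itself.\<close>

definition Psi :: "complex \<Rightarrow> complex" where
  "Psi \<xi> = (\<Sum>k<m. (of_nat k / of_nat m - 1 / 2) * delta (\<Lambda> ^ k * z)) - (\<Sum>k<m. \<Sum>\<^sub>\<infinity>a\<in>- {0}. T k a \<xi>)"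

lemma T_analytic:
  assumes "a \<noteq> 0" "\<Lambda> ^ k * z * exp (of_nat m * \<xi> / (2 * pi * \<i> * of_int a)) \<noteq> 1"
  shows "(\<lambda>\<xi>. T k a \<xi>) analytic_on {\<xi>}"
proof -
  define c where "c = of_nat m / (2 * pi * \<i> * of_int a)"
  have c: "of_nat m * \<xi> / (2 * pi * \<i> * of_int a) = c * \<xi>" for \<xi> by (simp add: c_def)
  show ?thesis
    unfolding borel_term_eq c delta_def using assms(2) unfolding c
    by (intro analytic_intros) auto
qed

text \<open>R' is midway between \<bar>z\<bar> and 1, and N is so large that for \<bar>a\<bar> > N
  the exponent has modulus at most ln (R'/\<bar>z\<bar>). The parameter \<open>N0\<close> allows N
  to be enlarged beyond a prescribed set of indices.\<close>

lemma far_terms_in_disk: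
  assumes "Q > 0"
  obtains N :: int and R' :: real where "N \<ge> N0" "N > 0" "norm z \<le> R'" "R' < 1"
    "\<And>a \<xi>. \<bar>a\<bar> > N \<Longrightarrow> norm \<xi> < Q \<Longrightarrow> norm (z * exp (of_nat m * \<xi> / (2 * pi * \<i> * of_int a))) \<le> R'"
proof -
  define R' where "R' = (1 + norm z) / 2"
  have R': "norm z < R'" "R' < 1" using z by (auto simp: R'_def)
  define l where "l = ln (R' / norm z)"
  have "1 < R' / norm z" using R'(1) z_nonzero by (simp add: less_divide_eq)
  hence l: "l > 0" unfolding l_def by (rule ln_gt_zero)
  define X where "X = real m * Q / (2 * pi)"
  define N where "N = max (max N0 1) \<lceil>real m * Q / (2 * pi) / l\<rceil>"
  have N: "N \<ge> N0" "N > 0" "real m * Q / (2 * pi) / l \<le> real_of_int N"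
    by (auto simp: N_def le_max_iff_disj) linarith
  have "norm (z * exp (of_nat m * \<xi> / (2 * pi * \<i> * of_int a))) \<le> R'" if a: "\<bar>a\<bar> > N" and \<xi>: "norm \<xi> < Q" for a \<xi>
  proof -
    have a0: "\<bar>real_of_int a\<bar> > 0" "real_of_int N \<le> \<bar>real_of_int a\<bar>" using a N by linarith+
    have "X \<le> real_of_int N * l" using N(3) l unfolding X_def[symmetric] by (simp add: pos_divide_le_eq)
    also have "\<dots> \<le> \<bar>real_of_int a\<bar> * l" using a0 l by (intro mult_right_mono) auto
    finally have "X / \<bar>real_of_int a\<bar> \<le> l" using a0(1) by (subst pos_divide_le_eq) (simp_all only: mult.commute)
    hence "real m * Q / (2 * pi) / \<bar>real_of_int a\<bar> \<le> l" unfolding X_def .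
    moreover have "real m * norm \<xi> / (2 * pi) / \<bar>real_of_int a\<bar> \<le> real m * Q / (2 * pi) / \<bar>real_of_int a\<bar>"
      using \<xi> by (intro divide_right_mono mult_left_mono) auto
    ultimately have y: "norm (of_nat m * \<xi> / (2 * pi * \<i> * of_int a)) \<le> l"
      unfolding norm_borel_exponent by linarith
    have "norm (z * exp (of_nat m * \<xi> / (2 * pi * \<i> * of_int a))) \<le> norm z * exp (norm (of_nat m * \<xi> / (2 * pi * \<i> * of_int a)))"
      unfolding norm_mult by (intro mult_left_mono norm_exp) auto
    also have "\<dots> \<le> norm z * exp l" using y by (intro mult_left_mono) auto
    also have "\<dots> = R'"
    proof -
      have "R' / norm z > 0" using R' z_nonzero by (meson divide_pos_pos norm_ge_zero order_le_less_trans zero_less_norm_iff)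
      thus ?thesis using z_nonzero by (simp add: l_def)
    qed
    finally show ?thesis .
  qed
  thus thesis using that N(1,2) R' by (meson less_imp_le)
qed

text \<open>On a bounded disk only finitely many a can bring the argument of \<delta> to its pole 1.
  The remaining terms are O(1/a^2) uniformly, so their sum \<open>H k\<close> is a uniform limit of
  holomorphic functions.\<close>

lemma Psi_split:
  assumes Q: "Q > 0"
  obtains N :: int and H where "N \<ge> N0" "\<And>k. H k holomorphic_on ball 0 Q"
    "\<And>k \<xi>. norm \<xi> < Q \<Longrightarrow> (\<lambda>a. T k a \<xi>) summable_on (-{0})"
    "\<And>k \<xi>. norm \<xi> < Q \<Longrightarrow> (\<Sum>\<^sub>\<infinity>a\<in>- {0}. T k a \<xi>) = (\<Sum>a\<in>{-N..N} - {0}. T k a \<xi>) + H k \<xi>"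
proof -
  \<comment> \<open>The radius Q + 1 gives the estimates on a neighbourhood of the closed disk of
    radius Q, since passing to the uniform limit requires continuity up to the boundary.\<close>
  obtain N R' where N: "N \<ge> N0" "N > 0" "norm z \<le> R'" "R' < 1"
    "\<And>a \<xi>. \<bar>a\<bar> > N \<Longrightarrow> norm \<xi> < Q + 1 \<Longrightarrow> norm (z * exp (of_nat m * \<xi> / (2 * pi * \<i> * of_int a))) \<le> R'"
    using far_terms_in_disk[of "Q + 1" N0] Q by (metis add_pos_pos zero_less_one)
  obtain B where B: "B \<ge> 0" "\<And>k a \<xi> z. a \<noteq> 0 \<Longrightarrow> norm z \<le> R' \<Longrightarrow>
     norm (z * exp (of_nat m * \<xi> / (2 * pi * \<i> * of_int a))) \<le> R' \<Longrightarrow>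
     norm (borel_term m \<Lambda> delta k \<xi> z a) \<le> B * norm \<xi> * (1 / real_of_int a ^ 2)"
    using borel_term_norm_le[OF delta_holomorphic N(4) norm_\<Lambda>] by metis
  define X where "X = {a::int. \<bar>a\<bar> > N}"
  define H where "H k \<xi> = (\<Sum>\<^sub>\<infinity>a\<in>X. T k a \<xi>)" for k \<xi>
  have X: "a \<noteq> 0" "\<bar>a\<bar> > N" if "a \<in> X" for a using that N by (auto simp: X_def)
  have bnd: "norm (T k a \<xi>) \<le> B * (Q + 1) * (1 / real_of_int a ^ 2)" if "a \<in> X" "norm \<xi> < Q + 1" for k a \<xi>
  proof -
    have "norm (T k a \<xi>) \<le> B * norm \<xi> * (1 / real_of_int a ^ 2)"
      using X[OF that(1)] N(3) N(5)[OF X(2)[OF that(1)] that(2)] by (intro B(2))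
    also have "\<dots> \<le> B * (Q + 1) * (1 / real_of_int a ^ 2)"
      using that(2) B(1) by (intro mult_right_mono mult_left_mono) auto
    finally show ?thesis .
  qed
  have "X \<subseteq> -{0}" using X by auto
  have M: "(\<lambda>a. B * (Q + 1) * (1 / real_of_int a ^ 2)) summable_on X"
    by (intro summable_on_cmult_right summable_on_subset_banach[OF inverse_squares_int_summable \<open>X \<subseteq> -{0}\<close>])
  have sX: "(\<lambda>a. T k a \<xi>) summable_on X" if "norm \<xi> < Q" for k \<xi>
    by (rule abs_summable_summable, rule Infinite_Sum.abs_summable_on_comparison_test'[OF M], rule bnd) (use that in auto)
  have set: "-{0} = ({-N..N} - {0}) \<union> X" using N(2) by (auto simp: X_def)
  have disj: "({-N..N} - {0}) \<inter> X = {}" by (auto simp: X_def)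
  have hol: "H k holomorphic_on ball 0 Q" for k
  proof -
    have "uniform_limit (cball 0 Q) (\<lambda>Y \<xi>. \<Sum>a\<in>Y. T k a \<xi>) (H k) (finite_subsets_at_top X)"
      unfolding H_def by (rule Weierstrass_m_test_general[OF _ M], rule bnd) auto
    moreover have "eventually (\<lambda>Y. continuous_on (cball 0 Q) (\<lambda>\<xi>. \<Sum>a\<in>Y. T k a \<xi>) \<and> (\<lambda>\<xi>. \<Sum>a\<in>Y. T k a \<xi>) holomorphic_on ball 0 Q) (finite_subsets_at_top X)"
    proof (rule eventually_finite_subsets_at_top_weakI)
      fix Y assume Y: "finite Y" "Y \<subseteq> X"
      have "(\<lambda>\<xi>. \<Sum>a\<in>Y. T k a \<xi>) analytic_on {\<xi>}" if "norm \<xi> < Q + 1" for \<xi>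
      proof (rule analytic_on_sum)
        fix a assume "a \<in> Y"
        hence a: "a \<in> X" using Y by auto
        have "norm (\<Lambda> ^ k * z * exp (of_nat m * \<xi> / (2 * pi * \<i> * of_int a))) \<le> R'"
          using N(5)[OF X(2)[OF a] that] by (simp add: norm_mult norm_power norm_\<Lambda>)
        hence "\<Lambda> ^ k * z * exp (of_nat m * \<xi> / (2 * pi * \<i> * of_int a)) \<noteq> 1" using N(4) by auto
        thus "T k a analytic_on {\<xi>}" by (rule T_analytic[OF X(1)[OF a]])
      qed
      hence "(\<lambda>\<xi>. \<Sum>a\<in>Y. T k a \<xi>) analytic_on ball 0 (Q + 1)"
        by (subst analytic_on_analytic_at) auto
      hence "(\<lambda>\<xi>. \<Sum>a\<in>Y. T k a \<xi>) holomorphic_on ball 0 (Q + 1)" by (rule analytic_imp_holomorphic)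
      thus "continuous_on (cball 0 Q) (\<lambda>\<xi>. \<Sum>a\<in>Y. T k a \<xi>) \<and> (\<lambda>\<xi>. \<Sum>a\<in>Y. T k a \<xi>) holomorphic_on ball 0 Q"
        by (intro conjI holomorphic_on_imp_continuous_on) (auto elim: holomorphic_on_subset)
    qed
    ultimately show ?thesis
      using holomorphic_uniform_limit[of 0 Q "\<lambda>Y \<xi>. \<Sum>a\<in>Y. T k a \<xi>" "finite_subsets_at_top X" "H k"]
      by (metis finite_subsets_at_top_neq_bot)
  qed
  show thesis
  proof (rule that[of N H, OF N(1) hol])
    fix k \<xi> assume \<xi>: "norm (\<xi>::complex) < Q"
    have fin: "(\<lambda>a. T k a \<xi>) summable_on ({-N..N} - {0})" by (rule summable_on_finite) auto
    show "(\<lambda>a. T k a \<xi>) summable_on (-{0})"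
      unfolding set by (rule summable_on_Un_disjoint[OF fin sX[OF \<xi>] disj])
    have "(\<Sum>\<^sub>\<infinity>a\<in>- {0}. T k a \<xi>) = (\<Sum>\<^sub>\<infinity>a\<in>{-N..N} - {0}. T k a \<xi>) + (\<Sum>\<^sub>\<infinity>a\<in>X. T k a \<xi>)"
      unfolding set by (rule infsum_Un_disjoint[OF fin sX[OF \<xi>] disj])
    also have "(\<Sum>\<^sub>\<infinity>a\<in>{-N..N} - {0}. T k a \<xi>) = (\<Sum>a\<in>{-N..N} - {0}. T k a \<xi>)" by (rule infsum_finite) auto
    finally show "(\<Sum>\<^sub>\<infinity>a\<in>- {0}. T k a \<xi>) = (\<Sum>a\<in>{-N..N} - {0}. T k a \<xi>) + H k \<xi>" by (simp only: H_def)
  qed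
qed

lemma T_summable: "(\<lambda>a. T k a \<xi>) summable_on (-{0})"
  using Psi_split[of "norm \<xi> + 1"] by (metis less_add_one add_nonneg_pos norm_ge_zero zero_less_one)

text \<open>P collects the index pairs whose terms are allowed to be singular at \<xi>0: it is empty
  for a regular point and a singleton for a pole.\<close>

lemma Psi_decomposition:
  fixes \<xi>0 :: complex and P :: "(nat \<times> int) set"
  assumes P: "finite P" "P \<subseteq> {..<m} \<times> (-{0})"
    and ns: "\<And>k a. k < m \<Longrightarrow> a \<noteq> 0 \<Longrightarrow> (k, a) \<notin> P \<Longrightarrow>
               \<Lambda> ^ k * z * exp (of_nat m * \<xi>0 / (2 * pi * \<i> * of_int a)) \<noteq> 1"
  obtains G where "G analytic_on {\<xi>0}"
    "eventually (\<lambda>\<xi>. Psi \<xi> = G \<xi> - (\<Sum>(k, a)\<in>P. T k a \<xi>)) (nhds \<xi>0)"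
proof -
  define Q where "Q = norm \<xi>0 + 1"
  have Q: "Q > 0" unfolding Q_def by (simp add: add_nonneg_pos)
  have "finite (snd ` P)" using P by simp
  then obtain N0 where N0: "\<And>a. a \<in> snd ` P \<Longrightarrow> \<bar>a\<bar> \<le> N0"
    by (metis bdd_above.I2 bdd_above_def bdd_above_finite finite_imageI image_eqI)
  obtain N H where N: "N \<ge> N0" "\<And>k. H k holomorphic_on ball 0 Q"
    "\<And>k \<xi>. norm \<xi> < Q \<Longrightarrow> (\<Sum>\<^sub>\<infinity>a\<in>- {0}. T k a \<xi>) = (\<Sum>a\<in>{-N..N} - {0}. T k a \<xi>) + H k \<xi>"
    using Psi_split[OF Q, of N0] by metis
  let ?I = "{..<m} \<times> ({-N..N} - {0})"
  have PI: "P \<subseteq> ?I"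
  proof
    fix x assume x: "x \<in> P"
    hence "\<bar>snd x\<bar> \<le> N" using N0[of "snd x"] N(1) by fastforce
    thus "x \<in> ?I" using P(2) x by (cases x) auto
  qed
  define G where "G \<xi> = (\<Sum>k<m. (of_nat k / of_nat m - 1 / 2) * delta (\<Lambda> ^ k * z)) - (\<Sum>k<m. H k \<xi>)
      - (\<Sum>x\<in>?I - P. T (fst x) (snd x) \<xi>)" for \<xi>
  have b: "\<xi>0 \<in> ball 0 Q" by (simp add: Q_def)
  have "H k analytic_on {\<xi>0}" for k
    using N(2)[of k] b by (metis analytic_on_analytic_at analytic_on_open open_ball)
  moreover have "(\<lambda>\<xi>. T (fst x) (snd x) \<xi>) analytic_on {\<xi>0}" if "x \<in> ?I - P" for x
    using that by (intro T_analytic ns) auto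
  ultimately have "G analytic_on {\<xi>0}"
    unfolding G_def by (intro analytic_intros) auto
  moreover have "eventually (\<lambda>\<xi>. Psi \<xi> = G \<xi> - (\<Sum>(k, a)\<in>P. T k a \<xi>)) (nhds \<xi>0)"
  proof -
    have "eventually (\<lambda>\<xi>. \<xi> \<in> ball 0 Q) (nhds \<xi>0)" using b by (intro eventually_nhds_in_open) auto
    thus ?thesis
    proof eventually_elim
      case (elim \<xi>)
      have "(\<Sum>k<m. \<Sum>\<^sub>\<infinity>a\<in>- {0}. T k a \<xi>) = (\<Sum>k<m. \<Sum>a\<in>{-N..N} - {0}. T k a \<xi>) + (\<Sum>k<m. H k \<xi>)"
        using elim by (simp add: N(3) sum.distrib)
      also have "(\<Sum>k<m. \<Sum>a\<in>{-N..N} - {0}. T k a \<xi>) = (\<Sum>x\<in>?I. T (fst x) (snd x) \<xi>)"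
        by (simp add: sum.cartesian_product case_prod_unfold)
      also have "\<dots> = (\<Sum>x\<in>?I - P. T (fst x) (snd x) \<xi>) + (\<Sum>x\<in>P. T (fst x) (snd x) \<xi>)"
        by (rule sum.subset_diff[OF PI]) auto
      finally show ?case by (simp add: Psi_def G_def case_prod_unfold)
    qed
  qed
  ultimately show thesis by (rule that)
qed

lemma Psi_analytic:
  assumes "\<xi>0 \<notin> {sing_pt m lz a b |a b. a \<noteq> 0}"
  shows "Psi analytic_on {\<xi>0}"
proof -
  obtain G where G: "G analytic_on {\<xi>0}" "eventually (\<lambda>\<xi>. Psi \<xi> = G \<xi> - (\<Sum>(k, a)\<in>{}. T k a \<xi>)) (nhds \<xi>0)"
  proof (rule Psi_decomposition[of "{}" \<xi>0])
    fix k a assume "a \<noteq> (0::int)"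
    thus "\<Lambda> ^ k * z * exp (of_nat m * \<xi>0 / (2 * pi * \<i> * of_int a)) \<noteq> 1"
      using assms singular_argument_iff[OF m _ lz, of a n0 k \<xi>0] unfolding \<Lambda> by blast
  qed auto
  have "eventually (\<lambda>\<xi>. Psi \<xi> = G \<xi>) (nhds \<xi>0)" using G(2) by simp
  thus ?thesis using G(1) analytic_at_cong[of Psi G \<xi>0 \<xi>0] by simp
qed

text \<open>Exactly one pair of indices is singular at \<xi>0: the given a, and the k with b
  congruent to k n0. With c = m/(2\<pi>\<i>a) and y = c(\<xi> - \<xi>0), its term is e exp y/(1 -
  exp y) plus a constant; it is subtracted in \<open>Psi\<close>, so the residue is e/c.\<close>

lemma Psi_pole:
  fixes a b :: int
  assumes n0': "[n0' * int n0 = 1] (mod int m)" and a: "a \<noteq> 0"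
  defines "\<xi>0 \<equiv> sing_pt m lz a b"
  shows "Psi meromorphic_on {\<xi>0}" "is_pole Psi \<xi>0" "zorder Psi \<xi>0 = -1" "residue Psi \<xi>0 = sing_res m n0' a b"
proof -
  \<comment> \<open>The inverse of n0 solves b = k n0 modulo m for k, and the reduction brings k
    into the range of summation.\<close>
  define k where "k = nat ((b * n0') mod int m)"
  have km: "k < m" using m by (simp add: k_def nat_less_iff)
  have k: "[int k = b * n0'] (mod int m)" using m by (simp add: k_def cong_def)
  have cong_iff: "[b = int k' * int n0] (mod int m) \<longleftrightarrow> k' = k" if "k' < m" for k'
  proof
    assume "[b = int k' * int n0] (mod int m)"
    hence "[b * n0' = int k' * int n0 * n0'] (mod int m)" by (intro cong_mult cong_refl)
    also have "int k' * int n0 * n0' = int k' * (n0' * int n0)" by simp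
    also have "[\<dots> = int k' * 1] (mod int m)" by (intro cong_mult cong_refl n0')
    finally have "[int k = int k'] (mod int m)" using k by (simp add: cong_trans)
    thus "k' = k" using km that by (simp add: cong_int_iff cong_def)
  next
    assume "k' = k"
    have "[int k * int n0 = b * n0' * int n0] (mod int m)" using k by (intro cong_mult cong_refl)
    also have "b * n0' * int n0 = b * (n0' * int n0)" by simp
    also have "[\<dots> = b * 1] (mod int m)" by (intro cong_mult cong_refl n0')
    finally show "[b = int k' * int n0] (mod int m)" using \<open>k' = k\<close> by (simp add: cong_sym)
  qed
  have sing: "\<Lambda> ^ k' * z * exp (of_nat m * \<xi>0 / (2 * pi * \<i> * of_int a')) = 1 \<longleftrightarrow> k' = k \<and> a' = a"
    if "k' < m" "a' \<noteq> 0" for k' a'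
    unfolding \<Lambda> singular_argument_iff[OF m that(2) lz] \<xi>0_def
    using sing_pt_inject[OF m a Re_lz] cong_iff[OF that(1)] by metis
  obtain G where G: "G analytic_on {\<xi>0}" "eventually (\<lambda>\<xi>. Psi \<xi> = G \<xi> - (\<Sum>(k, a)\<in>{(k, a)}. T k a \<xi>)) (nhds \<xi>0)"
    by (rule Psi_decomposition[of "{(k, a)}" \<xi>0]) (use km a sing in auto)
  define c where "c = of_nat m / (2 * pi * \<i> * of_int a)"
  have c: "of_nat m * \<xi> / (2 * pi * \<i> * of_int a) = c * \<xi>" for \<xi> by (simp add: c_def)
  have c0: "c \<noteq> 0" using m a by (simp add: c_def)
  define e where "e = fourier_coeff m k a"
  have e0: "e \<noteq> 0" using a by (simp add: e_def fourier_coeff_def)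
  have u0: "\<Lambda> ^ k * z * exp (c * \<xi>0) = 1" using sing[OF km a] unfolding c by simp
  have u: "\<Lambda> ^ k * z * exp (c * \<xi>) = exp (c * (\<xi> - \<xi>0))" for \<xi>
  proof -
    have "exp (c * \<xi>) = exp (c * \<xi>0) * exp (c * (\<xi> - \<xi>0))" by (simp add: exp_add[symmetric] algebra_simps)
    thus ?thesis using u0 by (simp add: mult.assoc[symmetric])
  qed
  have Tk: "T k a \<xi> = e * (exp (c * (\<xi> - \<xi>0)) / (1 - exp (c * (\<xi> - \<xi>0))) - delta (\<Lambda> ^ k * z))" for \<xi>
    unfolding borel_term_eq e_def c u by (simp add: delta_def)
  \<comment> \<open>The whole of \<open>Psi\<close> is put over the denominator \<open>q\<close>,
    which has a simple zero at \<xi>0; there P equals -e and the derivative of q equals -c.\<close>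
  define P where "P \<xi> = (G \<xi> + e * delta (\<Lambda> ^ k * z)) * (1 - exp (c * (\<xi> - \<xi>0))) - e * exp (c * (\<xi> - \<xi>0))" for \<xi>
  define q where "q \<xi> = 1 - exp (c * (\<xi> - \<xi>0))" for \<xi>
  have q_ne: "eventually (\<lambda>\<xi>. q \<xi> \<noteq> 0) (at \<xi>0)"
  proof -
    \<comment> \<open>On this ball \<bar>c(\<xi> - \<xi>0)\<bar> < 1, while the nonzero periods of
      exp have modulus at least 2\<pi>.\<close>
    have "eventually (\<lambda>\<xi>. \<xi> \<in> ball \<xi>0 (1 / norm c) - {\<xi>0}) (at \<xi>0)"
      using c0 by (intro eventually_at_in_open) auto
    thus ?thesis
    proof eventually_elim
      case (elim \<xi>)
      define y where "y = c * (\<xi> - \<xi>0)"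
      have y: "y \<noteq> 0" using elim c0 by (auto simp: y_def)
      have "norm (\<xi> - \<xi>0) < 1 / norm c" using elim by (simp add: dist_norm norm_minus_commute)
      hence "norm (\<xi> - \<xi>0) * norm c < 1" using c0 by (simp add: pos_less_divide_eq)
      hence ny: "norm y < 1" by (simp only: y_def norm_mult mult.commute)
      show ?case
      proof
        assume "q \<xi> = 0"
        hence "exp y = exp 0" by (simp add: q_def y_def)
        then obtain n :: int where n: "y = of_int (2 * n) * pi * \<i>" unfolding exp_eq by auto
        hence "n \<noteq> 0" using y by auto
        hence "1 \<le> \<bar>real_of_int n\<bar>" by linarith
        moreover have "norm y = 2 * \<bar>real_of_int n\<bar> * pi" unfolding n by (simp add: norm_mult)
        moreover have "1 * 1 \<le> (2 * \<bar>real_of_int n\<bar>) * pi"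
          using \<open>1 \<le> \<bar>real_of_int n\<bar>\<close> pi_ge_two by (intro mult_mono) auto
        ultimately show False using ny by linarith
      qed
    qed
  qed
  have ev: "eventually (\<lambda>\<xi>. Psi \<xi> = P \<xi> / q \<xi>) (at \<xi>0)"
    using q_ne eventually_nhds_conv_at[THEN iffD1, OF G(2), THEN conjunct1]
  proof eventually_elim
    case (elim \<xi>)
    thus ?case unfolding P_def Tk by (simp add: q_def field_simps Tk)
  qed
  have dq: "(q has_field_derivative - c) (at \<xi>0)"
    unfolding q_def by (auto intro!: derivative_eq_intros)
  have Pan: "P analytic_on {\<xi>0}" unfolding P_def using G(1) by (intro analytic_intros)
  have qan: "q analytic_on {\<xi>0}" unfolding q_def by (intro analytic_intros)
  have P0: "P \<xi>0 = - e" by (simp add: P_def)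
  note pole = quotient_simple_pole[OF Pan qan dq _ _ _ ev q_ne]
  show "Psi meromorphic_on {\<xi>0}" "is_pole Psi \<xi>0" "zorder Psi \<xi>0 = -1"
    by (rule pole; use c0 e0 P0 in \<open>simp add: q_def\<close>)+
  have "residue Psi \<xi>0 = P \<xi>0 / (- c)"
    by (rule pole; use c0 e0 P0 in \<open>simp add: q_def\<close>)
  also have "\<dots> = e / c" by (simp add: P0)
  also have "\<dots> = exp (2 * pi * \<i> * of_nat k * of_int a / of_nat m) / of_nat m"
    using a m by (simp add: e_def c_def fourier_coeff_def)
  also have "exp (2 * pi * \<i> * of_nat k * of_int a / of_nat m) = exp (2 * pi * \<i> * of_int a * of_int b * of_int n0' / of_nat m)"
  proof -
    obtain l where l: "int k = b * n0' + int m * l"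
      using cong_sym[OF k] unfolding cong_iff_lin by blast
    have "(of_nat k :: complex) = of_int (int k)" by simp
    also have "\<dots> = of_int b * of_int n0' + of_nat m * of_int l" by (simp add: l)
    finally have "2 * pi * \<i> * of_nat k * of_int a / of_nat m =
        2 * pi * \<i> * of_int a * of_int b * of_int n0' / of_nat m + 2 * of_int (a * l) * pi * \<i>"
      using m by (simp add: field_simps)
    thus ?thesis by (simp only: exp_add exp_integer_2pi Ints_of_int mult_1_right)
  qed
  finally show "residue Psi \<xi>0 = sing_res m n0' a b" by (simp add: sing_res_def)
qed

text \<open>The quantity is u \<delta>'(u) along the image u of the line. Either \<bar>u\<bar> =
  \<bar>z\<bar> exp (s\<mu>) is constant and below 1, or u lies in the annulus between radii 1/2 and
  2 only for a bounded range of s. Off the annulus the quantity is at most 2; on a compact range of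
  s continuity suffices, as u never equals 1.\<close>

lemma line_orbit_bounded:
  fixes v :: complex
  assumes avoid: "\<And>s::real. \<Lambda> ^ k * z * exp (of_nat m * (of_real s * v) / (2 * pi * \<i>)) \<noteq> 1"
  obtains C where "C \<ge> 0" "\<And>s::real. norm (\<Lambda> ^ k * z * exp (of_nat m * (of_real s * v) / (2 * pi * \<i>)) /
       (1 - \<Lambda> ^ k * z * exp (of_nat m * (of_real s * v) / (2 * pi * \<i>))) ^ 2) \<le> C"
proof -
  define u where "u s = \<Lambda> ^ k * z * exp (of_nat m * (of_real s * v) / (2 * pi * \<i>))" for s :: real
  define \<mu> where "\<mu> = real m * Im v / (2 * pi)"
  have nu: "norm (u s) = norm z * exp (s * \<mu>)" for s
    using norm_exp_borel_exponent[of m "of_real s * v" 1]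
    by (simp only: u_def norm_mult norm_power norm_\<Lambda> \<mu>_def of_int_1 mult_1_right) simp
  have u1: "u s \<noteq> 1" for s using avoid by (simp add: u_def)
  have "\<exists>C. \<forall>s. norm (u s / (1 - u s) ^ 2) \<le> C"
  proof (cases "\<mu> = 0")
    case True
    have "norm (u s / (1 - u s) ^ 2) \<le> norm z / (1 - norm z) ^ 2" for s
    proof -
      have n: "norm (u s) = norm z" using nu True by simp
      have "1 - norm z \<le> norm (1 - u s)" using norm_triangle_ineq2[of 1 "u s"] n by simp
      hence "(1 - norm z) ^ 2 \<le> norm (1 - u s) ^ 2" using z by (intro power_mono) auto
      thus ?thesis unfolding norm_divide norm_power n using z
        by (intro divide_left_mono mult_pos_pos zero_less_power) (use u1 in auto)
    qed
    thus ?thesis by blast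
  next
    case False
    \<comment> \<open>If \<bar>u s\<bar> lies between 1/2 and 2, taking logarithms gives
      \<bar>s\<mu>\<bar> \<le> ln 2 + \<bar>ln \<bar>z\<bar>\<bar>, that is \<bar>s\<bar> \<le>
      S.\<close>
    define S where "S = (ln 2 + \<bar>ln (norm z)\<bar>) / \<bar>\<mu>\<bar>"
    have "continuous_on {-S..S} (\<lambda>s. u s / (1 - u s) ^ 2)"
      using u1 unfolding u_def by (intro continuous_intros) auto
    hence "bounded ((\<lambda>s. u s / (1 - u s) ^ 2) ` {-S..S})"
      by (intro compact_imp_bounded compact_continuous_image) auto
    then obtain C where C: "\<And>s. s \<in> {-S..S} \<Longrightarrow> norm (u s / (1 - u s) ^ 2) \<le> C"
      unfolding bounded_iff by blast
    have "norm (u s / (1 - u s) ^ 2) \<le> max 2 C" for s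
    proof (cases "norm (u s) \<le> 1 / 2 \<or> norm (u s) \<ge> 2")
      case True
      have "norm (u s / (1 - u s) ^ 2) \<le> 2"
      proof -
        have t: "1 - norm (u s) \<le> norm (1 - u s)" "norm (u s) - 1 \<le> norm (1 - u s)"
          using norm_triangle_ineq2[of 1 "u s"] norm_triangle_ineq2[of "u s" 1] by (simp_all add: norm_minus_commute)
        have pos: "norm (1 - u s) > 0" using u1[of s] by simp
        have "norm (u s) \<le> 2 * norm (1 - u s) ^ 2"
          using True
        proof
          assume h: "norm (u s) \<le> 1 / 2"
          hence "(1 / 2) ^ 2 \<le> norm (1 - u s) ^ 2" using t(1) by (intro power_mono) auto
          thus ?thesis using h by (simp add: power2_eq_square)
        next
          assume h: "norm (u s) \<ge> 2"
          have "norm (u s) / 2 \<le> norm (1 - u s)" using t(2) h by linarith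
          hence "(norm (u s) / 2) ^ 2 \<le> norm (1 - u s) ^ 2" by (intro power_mono) auto
          moreover have "2 * norm (u s) \<le> norm (u s) * norm (u s)" using h by (intro mult_right_mono) auto
          ultimately show ?thesis by (simp add: power2_eq_square)
        qed
        thus ?thesis using pos by (simp add: norm_divide norm_power pos_divide_le_eq)
      qed
      thus ?thesis by simp
    next
      case h: False
      have zp: "norm z > 0" using z_nonzero by simp
      have "ln (norm (u s)) = ln (norm z) + s * \<mu>" unfolding nu using zp by (simp add: ln_mult)
      moreover have "ln (norm (u s)) < ln 2" "ln (1 / 2) < ln (norm (u s))"
        using h u1 by (auto simp del: ln_div intro!: ln_less_cancel_iff[THEN iffD2] less_trans[of 0 "1/2" "norm (u s)"])
      moreover have "ln (1 / 2 :: real) = - ln 2" by (simp add: ln_div)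
      ultimately have "\<bar>s * \<mu>\<bar> \<le> ln 2 + \<bar>ln (norm z)\<bar>" by linarith
      hence "\<bar>s\<bar> * \<bar>\<mu>\<bar> \<le> ln 2 + \<bar>ln (norm z)\<bar>" by (simp add: abs_mult)
      hence "\<bar>s\<bar> \<le> S" using False by (simp add: S_def pos_le_divide_eq)
      thus ?thesis using C[of s] by (simp add: abs_le_iff le_max_iff_disj)
    qed
    thus ?thesis by blast
  qed
  then obtain C where C: "\<And>s. norm (u s / (1 - u s) ^ 2) \<le> C" by blast
  have "C \<ge> 0" using C[of 0] norm_ge_zero order_trans by blast
  thus thesis using that C by (simp only: u_def)
qed

text \<open>The a-th term involves \<xi> only through \<xi>/a, which lies on the same line, so one
  function \<open>f\<close> on the line governs all a. Likewise \<open>sing_pt m lz a b\<close> is a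
  times \<open>sing_pt m lz 1 b\<close>, so the points with a = 1 decide whether the line meets a
  pole. The mean value bound for f(\<xi>/a) - f(0) supplies the second factor 1/a, with B
  independent of a.\<close>

lemma T_line_bound:
  assumes avoid: "\<And>b. sing_pt m lz 1 b \<notin> range (\<lambda>t::real. of_real t * v)"
  shows "\<exists>B. B \<ge> 0 \<and> (\<forall>a (t::real). a \<noteq> 0 \<longrightarrow> norm (T k a (of_real t * v)) \<le> B * norm (of_real t * v) * (1 / real_of_int a ^ 2))"
proof -
  define \<kappa> where "\<kappa> = of_nat m / (2 * pi * \<i>)"
  have \<kappa>: "of_nat m * \<xi> / (2 * pi * \<i>) = \<kappa> * \<xi>" for \<xi> by (simp add: \<kappa>_def)
  have ns: "\<Lambda> ^ k * z * exp (of_nat m * (of_real s * v) / (2 * pi * \<i>)) \<noteq> 1" for s :: real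
  proof
    assume "\<Lambda> ^ k * z * exp (of_nat m * (of_real s * v) / (2 * pi * \<i>)) = 1"
    hence "\<exists>b. [b = int k * int n0] (mod int m) \<and> of_real s * v = sing_pt m lz 1 b"
      using singular_argument_iff[OF m _ lz, of 1 n0 k "of_real s * v"] unfolding \<Lambda> by simp
    then obtain b where "sing_pt m lz 1 b = of_real s * v" by metis
    thus False using avoid[of b] by blast
  qed
  obtain C where C: "C \<ge> 0" "\<And>s::real. norm (\<Lambda> ^ k * z * exp (\<kappa> * (of_real s * v)) /
       (1 - \<Lambda> ^ k * z * exp (\<kappa> * (of_real s * v))) ^ 2) \<le> C"
    using line_orbit_bounded[OF ns] unfolding \<kappa> by metis
  define S where "S = range (\<lambda>t::real. of_real t * v)"
  define f where "f \<xi> = delta (\<Lambda> ^ k * z * exp (\<kappa> * \<xi>))" for \<xi>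
  have "S = span {v}" by (auto simp: S_def span_singleton scaleR_conv_of_real)
  hence "convex S" by (simp add: subspace_imp_convex)
  have bound: "norm (f x - f y) \<le> (norm \<kappa> * C) * norm (x - y)" if "x \<in> S" "y \<in> S" for x y
  proof (rule field_differentiable_bound[OF \<open>convex S\<close> _ _ that])
    fix \<xi> assume "\<xi> \<in> S"
    then obtain s :: real where s: "\<xi> = of_real s * v" by (auto simp: S_def)
    define u where "u = \<Lambda> ^ k * z * exp (\<kappa> * \<xi>)"
    have u1: "1 - u \<noteq> 0" using ns[of s] unfolding \<kappa> u_def s by simp
    have "(delta has_field_derivative 1 / (1 - u) ^ 2) (at u)"
      unfolding delta_def using u1 by (auto intro!: derivative_eq_intros simp: power2_eq_square)
    hence "(f has_field_derivative 1 / (1 - u) ^ 2 * (\<kappa> * u)) (at \<xi>)"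
      unfolding f_def u_def
      by (rule DERIV_chain2[where g = "\<lambda>\<xi>. \<Lambda> ^ k * z * exp (\<kappa> * \<xi>)"]) (auto intro!: derivative_eq_intros)
    thus "(f has_field_derivative \<kappa> * (u / (1 - u) ^ 2)) (at \<xi> within S)"
      by (simp add: has_field_derivative_at_within mult_ac)
    show "norm (\<kappa> * (u / (1 - u) ^ 2)) \<le> norm \<kappa> * C"
      unfolding norm_mult[of \<kappa>] u_def s using C(2)[of s] by (intro mult_left_mono) auto
  qed
  have "norm (T k a (of_real t * v)) \<le> (norm \<kappa> * C) * norm (of_real t * v) * (1 / real_of_int a ^ 2)"
    if a: "a \<noteq> 0" for a and t :: real
  proof -
    let ?\<xi> = "of_real t * v"
    have xa: "of_nat m * ?\<xi> / (2 * pi * \<i> * of_int a) = \<kappa> * (?\<xi> / of_int a)" by (simp add: \<kappa>_def)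
    have "?\<xi> / of_int a = of_real (t / real_of_int a) * v" by simp
    hence inS: "?\<xi> / of_int a \<in> S" unfolding S_def by blast
    have "0 = of_real 0 * v" by simp
    hence zS: "0 \<in> S" unfolding S_def by blast
    have "T k a ?\<xi> = fourier_coeff m k a * (f (?\<xi> / of_int a) - f 0)"
      unfolding borel_term_eq xa f_def by simp
    hence "norm (T k a ?\<xi>) \<le> 1 / \<bar>real_of_int a\<bar> * ((norm \<kappa> * C) * norm (?\<xi> / of_int a - 0))"
      unfolding norm_mult[of "fourier_coeff m k a"]
      by (simp only: norm_mult[of "fourier_coeff m k a"]) (intro mult_mono norm_fourier_coeff_le a bound inS zS; simp)
    also have "\<dots> = (norm \<kappa> * C) * norm ?\<xi> * (1 / (\<bar>real_of_int a\<bar> * \<bar>real_of_int a\<bar>))"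
      by (simp add: norm_divide)
    finally show ?thesis by (simp only: abs_mult_self_eq power2_eq_square)
  qed
  thus ?thesis using C(1) by (intro exI[of _ "norm \<kappa> * C"]) simp
qed

text \<open>Summing the bounds over a and k gives K\<bar>\<xi>\<bar>; the part of \<open>Psi\<close>
  that does not depend on \<xi> accounts for the 1 in 1 + \<bar>\<xi>\<bar>.\<close>

lemma Psi_line_bound:
  assumes avoid: "\<And>b. sing_pt m lz 1 b \<notin> range (\<lambda>t::real. of_real t * v)"
  shows "bounded ((\<lambda>\<xi>. Psi \<xi> / of_real (1 + norm \<xi>)) ` range (\<lambda>t::real. of_real t * v))"
proof -
  have "\<forall>k. \<exists>B. B \<ge> 0 \<and> (\<forall>a (t::real). a \<noteq> 0 \<longrightarrow> norm (T k a (of_real t * v)) \<le> B * norm (of_real t * v) * (1 / real_of_int a ^ 2))"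
    using T_line_bound[OF avoid] by (rule allI)
  from choice[OF this] obtain B where B: "\<And>k. B k \<ge> 0"
    "\<And>k a (t::real). a \<noteq> 0 \<Longrightarrow> norm (T k a (of_real t * v)) \<le> B k * norm (of_real t * v) * (1 / real_of_int a ^ 2)"
    by auto
  define Z where "Z = (\<Sum>\<^sub>\<infinity>a\<in>-{0}. 1 / real_of_int a ^ 2)"
  have Z: "((\<lambda>a. 1 / real_of_int a ^ 2) has_sum Z) (-{0})"
    unfolding Z_def by (rule has_sum_infsum[OF inverse_squares_int_summable])
  have Z0: "Z \<ge> 0" unfolding Z_def by (rule infsum_nonneg) auto
  define c0 where "c0 = (\<Sum>k<m. (of_nat k / of_nat m - 1 / 2) * delta (\<Lambda> ^ k * z))"
  define K where "K = (\<Sum>k<m. B k * Z)"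
  have K0: "K \<ge> 0" unfolding K_def by (intro sum_nonneg mult_nonneg_nonneg B Z0)
  have "norm (Psi \<xi> / of_real (1 + norm \<xi>)) \<le> norm c0 + K" if "\<xi> \<in> range (\<lambda>t::real. of_real t * v)" for \<xi>
  proof -
    from that obtain t :: real where t: "\<xi> = of_real t * v" by auto
    have inf: "norm (\<Sum>\<^sub>\<infinity>a\<in>- {0}. T k a \<xi>) \<le> B k * norm \<xi> * Z" for k
    proof (rule norm_infsum_le[OF has_sum_infsum[OF T_summable]])
      show "((\<lambda>a. B k * norm \<xi> * (1 / real_of_int a ^ 2)) has_sum (B k * norm \<xi> * Z)) (-{0})"
        by (rule has_sum_cmult_right[OF Z])
    qed (use B(2) in \<open>simp add: t\<close>)
    have "norm (Psi \<xi>) \<le> norm c0 + norm (\<Sum>k<m. \<Sum>\<^sub>\<infinity>a\<in>- {0}. T k a \<xi>)"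
      unfolding Psi_def c0_def by (rule norm_triangle_ineq4)
    also have "norm (\<Sum>k<m. \<Sum>\<^sub>\<infinity>a\<in>- {0}. T k a \<xi>) \<le> (\<Sum>k<m. B k * norm \<xi> * Z)"
      by (intro sum_norm_le inf)
    also have "(\<Sum>k<m. B k * norm \<xi> * Z) = K * norm \<xi>" by (simp add: K_def sum_distrib_left mult_ac)
    also have "norm c0 + K * norm \<xi> \<le> (norm c0 + K) * (1 + norm \<xi>)"
      using K0 by (simp add: algebra_simps)
    finally have "norm (Psi \<xi>) \<le> (norm c0 + K) * (1 + norm \<xi>)" by simp
    moreover have "norm (of_real (1 + norm \<xi>) :: complex) = 1 + norm \<xi>"
      by (simp only: norm_of_real) simp
    moreover have "1 + norm \<xi> > 0" by (rule add_pos_nonneg) auto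
    ultimately show ?thesis by (simp only: norm_divide pos_divide_le_eq)
  qed
  thus ?thesis unfolding bounded_iff by (intro exI[of _ "norm c0 + K"]) blast
qed

text \<open>This identifies \<open>Psi\<close> as the continuation of the Borel series. The radius
  is where \<bar>z\<bar> exp (m\<bar>\<xi>\<bar>/(2\<pi>)) reaches 1, as \<bar>z\<bar> = exp (Re
  lz); it is also the imaginary part of the points \<open>sing_pt m lz 1 b\<close>, so the disk
  contains no pole.\<close>

lemma Psi_is_Borel_sum:
  obtains \<epsilon> :: real where "\<epsilon> > 0" "\<And>\<xi>. norm \<xi> < \<epsilon> \<Longrightarrow> Borel_sums \<Lambda> delta 1 \<xi> z (Psi \<xi>)"
proof (rule that[of "2 * pi / real m * (- Re lz)"])
  show "2 * pi / real m * (- Re lz) > 0" using m Re_lz by (intro mult_pos_pos divide_pos_pos) auto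
  fix \<xi> :: complex assume \<xi>: "norm \<xi> < 2 * pi / real m * (- Re lz)"
  have "real m / (2 * pi) * norm \<xi> < real m / (2 * pi) * (2 * pi / real m * (- Re lz))"
    using \<xi> m by (intro mult_strict_left_mono) auto
  also have "\<dots> = - Re lz" using m by simp
  finally have "Re lz + real m * norm \<xi> / (2 * pi) < 0" by simp
  hence "exp (Re lz + real m * norm \<xi> / (2 * pi)) < 1" by simp
  hence "norm z * exp (real m * norm \<xi> / (2 * pi)) < 1"
    unfolding lz[symmetric] by (simp add: exp_add)
  moreover have "delta 0 = 0" by (simp add: delta_def)
  ultimately show "Borel_sums \<Lambda> delta 1 \<xi> z (Psi \<xi>)"
    using Borel_sums_formula(2)[OF m delta_holomorphic, of z \<xi> n0] unfolding Psi_def by (simp only: \<Lambda>)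
qed

end

theorem theorem4p3:
  fixes n0 m0 :: nat and n0' :: int and \<Lambda>0 :: complex
    and r1 :: real and g :: "complex \<Rightarrow> complex" and L :: "complex \<Rightarrow> complex"
  assumes m0: "m0 \<ge> 1" and n0: "n0 \<le> m0 - 1" and cop: "coprime n0 m0"
    and \<Lambda>0: "\<Lambda>0 = exp (2 * pi * \<i> * of_nat n0 / of_nat m0)"
    and n0': "[n0' * int n0 = 1] (mod int m0)"
    and r1: "r1 > 0" and g: "g \<in> B_space r1"
    and L: "\<And>z. z \<in> ball 0 1 - {0} \<Longrightarrow> exp (L z) = z"
  shows
    "(\<exists>\<epsilon>>0. \<exists>F.
        holomorphic2_on F ({\<xi>. \<bar>Im \<xi>\<bar> < \<epsilon>} \<times> ball 0 \<epsilon>) \<and>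
        (\<forall>\<xi> z. norm \<xi> < \<epsilon> \<and> norm z < \<epsilon> \<longrightarrow> Borel_sums \<Lambda>0 g r1 \<xi> z (F (\<xi>, z))) \<and>
        (\<forall>\<xi> z. \<bar>Im \<xi>\<bar> < \<epsilon> \<and> norm z < \<epsilon> \<longrightarrow>
           (\<forall>k<m0. borel_term m0 \<Lambda>0 g k \<xi> z summable_on (- {0})) \<and>
           F (\<xi>, z) =
             (\<Sum>k<m0. (of_nat k / of_nat m0 - 1 / 2) * g (\<Lambda>0 ^ k * z))
             - (\<Sum>k<m0. \<Sum>\<^sub>\<infinity>a\<in>- {0}. borel_term m0 \<Lambda>0 g k \<xi> z a)))
     \<and>
     (\<forall>z \<in> ball 0 1 - {0}. \<exists>F.
        (\<exists>\<epsilon>>0. \<forall>\<xi>. norm \<xi> < \<epsilon> \<longrightarrow> Borel_sums \<Lambda>0 delta 1 \<xi> z (F \<xi>)) \<and>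
        F meromorphic_on UNIV \<and>
        F holomorphic_on (- {sing_pt m0 (L z) a b |a b. a \<noteq> 0}) \<and>
        (\<forall>a b. a \<noteq> 0 \<longrightarrow>
           is_pole F (sing_pt m0 (L z) a b) \<and>
           zorder F (sing_pt m0 (L z) a b) = -1 \<and>
           residue F (sing_pt m0 (L z) a b) = sing_res m0 n0' a b) \<and>
        (\<forall>v. v \<noteq> 0 \<longrightarrow>
           (let \<Delta> = range (\<lambda>t::real. of_real t * v) in
              (\<forall>a b. a \<noteq> 0 \<longrightarrow> sing_pt m0 (L z) a b \<notin> \<Delta>) \<longrightarrow>
              bounded ((\<lambda>\<xi>. F \<xi> / of_real (1 + norm \<xi>)) ` \<Delta>))))"
proof (intro conjI ballI)
  have m: "m0 > 0" using m0 by simp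
  have gh: "g holomorphic_on ball 0 r1" "g 0 = 0" using g by (auto simp: B_space_def)
  have n\<Lambda>: "norm \<Lambda>0 = 1" by (simp add: \<Lambda>0)
  \<comment> \<open>The bound 1 keeps m\<epsilon>/(2\<pi>) below m, and the second entry then makes
    \<epsilon> exp (m\<epsilon>/(2\<pi>)) at most r1/2.\<close>
  define \<epsilon> where "\<epsilon> = min 1 (r1 / (2 * exp (real m0)))"
  have \<epsilon>: "\<epsilon> > 0" "\<epsilon> \<le> 1" using r1 by (auto simp: \<epsilon>_def)
  have "real m0 * \<epsilon> \<le> real m0 * (2 * pi)"
    using \<epsilon> pi_ge_two by (intro mult_left_mono) auto
  hence "real m0 * \<epsilon> / (2 * pi) \<le> real m0" using pi_gt_zero by (simp add: pos_divide_le_eq)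
  hence "\<epsilon> * exp (real m0 * \<epsilon> / (2 * pi)) \<le> r1 / (2 * exp (real m0)) * exp (real m0)"
    using r1 by (intro mult_mono) (auto simp: \<epsilon>_def)
  also have "\<dots> < r1" using r1 by simp
  finally have \<epsilon>r: "\<epsilon> * exp (real m0 * \<epsilon> / (2 * pi)) < r1" .
  interpret borel_domain m0 \<Lambda>0 g r1 \<epsilon>
    by unfold_locales fact+
  define F where "F = (\<lambda>(\<xi>, z). (\<Sum>k<m0. (of_nat k / of_nat m0 - 1 / 2) * g (\<Lambda>0 ^ k * z))
             - (\<Sum>k<m0. \<Sum>\<^sub>\<infinity>a\<in>- {0}. borel_term m0 \<Lambda>0 g k \<xi> z a))"
  \<comment> \<open>The majorant of the Borel series involves \<bar>\<xi>\<bar> and not only Im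
    \<xi>; hence a disk in \<xi> here, as opposed to the strip on which F is defined by the
    formula.\<close>
  have "Borel_sums \<Lambda>0 g r1 \<xi> z (F (\<xi>, z))" if "norm \<xi> < \<epsilon>" "norm z < \<epsilon>" for \<xi> z
  proof -
    have "norm z * exp (real m0 * norm \<xi> / (2 * pi)) \<le> \<epsilon> * exp (real m0 * \<epsilon> / (2 * pi))"
      using that \<epsilon> by (intro mult_mono iffD2[OF exp_le_cancel_iff] divide_right_mono mult_left_mono) auto
    hence "norm z * exp (real m0 * norm \<xi> / (2 * pi)) < r1" using \<epsilon>r by linarith
    from Borel_sums_formula(2)[OF m gh this, of n0] show ?thesis
      by (simp only: F_def prod.case \<Lambda>0)
  qed
  moreover have "holomorphic2_on F ({\<xi>. \<bar>Im \<xi>\<bar> < \<epsilon>} \<times> ball 0 \<epsilon>)"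
    unfolding F_def by (rule borel_formula_holomorphic2)
  ultimately show "\<exists>\<epsilon>>0. \<exists>F.
        holomorphic2_on F ({\<xi>. \<bar>Im \<xi>\<bar> < \<epsilon>} \<times> ball 0 \<epsilon>) \<and>
        (\<forall>\<xi> z. norm \<xi> < \<epsilon> \<and> norm z < \<epsilon> \<longrightarrow> Borel_sums \<Lambda>0 g r1 \<xi> z (F (\<xi>, z))) \<and>
        (\<forall>\<xi> z. \<bar>Im \<xi>\<bar> < \<epsilon> \<and> norm z < \<epsilon> \<longrightarrow>
           (\<forall>k<m0. borel_term m0 \<Lambda>0 g k \<xi> z summable_on (- {0})) \<and>
           F (\<xi>, z) =
             (\<Sum>k<m0. (of_nat k / of_nat m0 - 1 / 2) * g (\<Lambda>0 ^ k * z))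
             - (\<Sum>k<m0. \<Sum>\<^sub>\<infinity>a\<in>- {0}. borel_term m0 \<Lambda>0 g k \<xi> z a))"
    by (intro exI[of _ \<epsilon>] exI[of _ F] conjI \<epsilon>(1)) (auto simp: F_def borel_term_summable)
next
  fix z :: complex assume z: "z \<in> ball 0 1 - {0}"
  interpret delta_point m0 n0 \<Lambda>0 z "L z"
    by unfold_locales (use m0 \<Lambda>0 z L in auto)
  let ?sing = "{sing_pt m0 (L z) a b |a b. a \<noteq> 0}"
  show "\<exists>F.
        (\<exists>\<epsilon>>0. \<forall>\<xi>. norm \<xi> < \<epsilon> \<longrightarrow> Borel_sums \<Lambda>0 delta 1 \<xi> z (F \<xi>)) \<and>
        F meromorphic_on UNIV \<and>
        F holomorphic_on (- ?sing) \<and>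
        (\<forall>a b. a \<noteq> 0 \<longrightarrow>
           is_pole F (sing_pt m0 (L z) a b) \<and>
           zorder F (sing_pt m0 (L z) a b) = -1 \<and>
           residue F (sing_pt m0 (L z) a b) = sing_res m0 n0' a b) \<and>
        (\<forall>v. v \<noteq> 0 \<longrightarrow>
           (let \<Delta> = range (\<lambda>t::real. of_real t * v) in
              (\<forall>a b. a \<noteq> 0 \<longrightarrow> sing_pt m0 (L z) a b \<notin> \<Delta>) \<longrightarrow>
              bounded ((\<lambda>\<xi>. F \<xi> / of_real (1 + norm \<xi>)) ` \<Delta>)))"
  proof (rule exI[of _ Psi], intro conjI allI impI)
    show "\<exists>\<epsilon>>0. \<forall>\<xi>. norm \<xi> < \<epsilon> \<longrightarrow> Borel_sums \<Lambda>0 delta 1 \<xi> z (Psi \<xi>)"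
      using Psi_is_Borel_sum by metis
    have "Psi meromorphic_on {\<xi>}" for \<xi>
    proof (cases "\<xi> \<in> ?sing")
      case True
      thus ?thesis using Psi_pole(1)[OF n0'] by auto
    next
      case False
      thus ?thesis by (intro analytic_on_imp_meromorphic_on Psi_analytic)
    qed
    thus "Psi meromorphic_on UNIV" by (subst meromorphic_on_meromorphic_at) simp
    have "Psi analytic_on - ?sing"
      by (subst analytic_on_analytic_at) (use Psi_analytic in blast)
    thus "Psi holomorphic_on - ?sing" by (rule analytic_imp_holomorphic)
  next
    fix a b :: int assume a: "a \<noteq> 0"
    show "is_pole Psi (sing_pt m0 (L z) a b)" "zorder Psi (sing_pt m0 (L z) a b) = -1"
         "residue Psi (sing_pt m0 (L z) a b) = sing_res m0 n0' a b"
      by (rule Psi_pole[OF n0' a])+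
  next
    fix v :: complex
    show "let \<Delta> = range (\<lambda>t::real. of_real t * v) in
              (\<forall>a b. a \<noteq> 0 \<longrightarrow> sing_pt m0 (L z) a b \<notin> \<Delta>) \<longrightarrow>
              bounded ((\<lambda>\<xi>. Psi \<xi> / of_real (1 + norm \<xi>)) ` \<Delta>)"
      unfolding Let_def
    proof
      assume "\<forall>a b. a \<noteq> 0 \<longrightarrow> sing_pt m0 (L z) a b \<notin> range (\<lambda>t::real. of_real t * v)"
      thus "bounded ((\<lambda>\<xi>. Psi \<xi> / of_real (1 + norm \<xi>)) ` range (\<lambda>t::real. of_real t * v))"
        by (intro Psi_line_bound) simp
    qed
  qed
qed

end
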